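(* Let $\{\alpha_n\}_{n\in\mathbb{N}}$ be a sequence in $\mathrm{M}^+(\Omega)$ and $\alpha\in\mathrm{M}^+(\Omega)$. Assume that for the Lebesgue decomposition of $\alpha_n$ with respect to $\alpha$, given by $$\alpha_n=g_n\alpha+\alpha_n^s,\qquad \alpha_n^s\perp\alpha,$$ we have $\alpha_n^s\to0$ strongly in $\mathrm{M}(\Omega)$ as $n\to\infty$. Further, assume that for all $n\in\mathbb{N}$, $g_n\in C^1(\Omega)$, $g_n$ is bounded, $\nabla g_n\in L^1(\Omega,\alpha)^N$, and that $$\sup_{x\in\Omega}|g_n(x)-1|\to0\quad\text{as }n\to\infty.$$ (i) If $\int_\Omega|\nabla g_n|\,d\alpha\to0$ as $n\to\infty$, then for every $\mu\in K_0(\alpha)$, where $K_0(\alpha)=\{\sigma\in\mathrm{DM}(\Omega):|\sigma|\le\alpha\}$, there exists a sequence $\{\mu_n\}$ in $\mathrm{DM}(\Omega)$ such that $\mu_n\in K_0(\alpha_n)$ for all $n\in\mathbb{N}$ and $\mu_n\to\mu$ in $\mathrm{DM}(\Omega)$ as $n\to\infty$. (ii) Let $1\le p\le+\infty$, let $\alpha=F^\alpha\mathcal{L}^N+\alpha^s$ be the Lebesgue and Radon-Nikodym decomposition of $\alpha$ with respect to the Lebesgue measure $\mathcal{L}^N$ (with $\alpha^s\perp\mathcal{L}^N$), and suppose that for each $n\in\mathbb{N}$, $\nabla g_n$ vanishes on $\mathrm{supp}\,\alpha^s$. Let $\mu\in\mathbf{K}^p(\alpha;\mathrm{div})$ be arbitrary,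 where $\mathbf{K}^p(\alpha;\mathrm{div})=\{\sigma\in\mathrm{M}^p(\Omega;\mathrm{div}):|\sigma|\le\alpha\}$, and suppose that $$\||\nabla g_n|F^\alpha\|_{L^p(\Omega)}\to0.$$ Then there exists a sequence $\{\mu_n\}$ in $\mathrm{M}^p(\Omega;\mathrm{div})$ such that $\mu_n\in\mathbf{K}^p(\alpha_n;\mathrm{div})$ for all $n\in\mathbb{N}$ and $\mu_n\to\mu$ in $\mathrm{M}^p(\Omega;\mathrm{div})$ as $n\to\infty$. (iii) Suppose $\partial\Omega$ is not empty and let $\Gamma\subset\partial\Omega$. If in (i) and (ii) one assumes in addition that $g_n\in\mathbf{C}_b^1(\overline{\Omega})$ for all $n$, then their respective results hold true when $\mathrm{DM}(\Omega)$ is exchanged by $\mathrm{DM}_\Gamma(\Omega)$ (in particular in the definition of $K_0$), and $\mathrm{M}^p(\Omega;\mathrm{div})$ by $\mathrm{M}^p_\Gamma(\Omega;\mathrm{div})$, i.e. $\mathbf{K}^p(\cdot\,;\mathrm{div})$ by $\mathbf{K}^p_\Gamma(\cdot\,;\mathrm{div})=\{\sigma\in\mathrm{M}^p_\Gamma(\Omega;\mathrm{div}):|\sigma|\le\cdot\,\}$.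
   Context: $\Omega$ is an open subset of $\mathbb{R}^N$. $\mathrm{M}(\Omega)$ and $\mathrm{M}(\Omega)^N$ are the spaces of (finite) real-valued, respectively $\mathbb{R}^N$-valued, Borel measures on $\Omega$; $\mathrm{M}^+(\Omega)\subset\mathrm{M}(\Omega)$ is the set of non-negative ones. $|\mu|$ is the total variation measure (Euclidean norm), $\|\mu\|_{\mathrm{M}(\Omega)^N}=|\mu|(\Omega)$, and strong convergence is convergence in this norm. $\mu\le\sigma$ means $\sigma-\mu\in\mathrm{M}^+(\Omega)$. For $\phi=(\phi_i)$, $\int_\Omega\phi\cdot d\mu=\sum_i\int_\Omega\phi_i\,d\mu_i$. The support of a measure on $\Omega$ is the smallest relatively closed $C\subset\Omega$ whose complement in $\Omega$ has zero total variation. In the Lebesgue decomposition, $g_n$ denotes the Radon-Nikodym density of the $\alpha$-absolutely continuous part of $\alpha_n$ (assumed to have the stated regular representative). $\mathrm{DM}(\Omega)$ is the set of $\mu\in\mathrm{M}(\Omega)^N$ for which there is $\sigma\in\mathrm{M}(\Omega)$ with $\int_\Omega\nabla\phi\cdot d\mu=-\int_\Omega\phi\,d\sigma$ for all $\phi\in C_c^\infty(\Omega)$; then $\mathrm{div}\,\mu:=\sigma$, and $\|\mu\|_{\mathrm{DM}(\Omega)}=\|\mu\|_{\mathrm{M}(\Omega)^N}+\|\mathrm{div}\,\mu\|_{\mathrm{M}(\Omega)}$. For $1\le p\le\infty$, $\mathrm{M}^p(\Omega;\mathrm{div})$ is the set of $\mu\in\mathrm{M}(\Omega)^N$ for which there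 is $h\in L^p(\Omega)$ with $\int_\Omega\nabla\phi\cdot d\mu=-\int_\Omega\phi h\,dx$ for all $\phi\in C_c^\infty(\Omega)$; then $\mathrm{div}\,\mu:=h$, and $\|\mu\|_{\mathrm{M}^p(\Omega;\mathrm{div})}=\|\mu\|_{\mathrm{M}(\Omega)^N}+\|\mathrm{div}\,\mu\|_{L^p(\Omega)}$. $C_b^1(\Omega)$ is the space of bounded functions in $C^1(\Omega)$ with bounded partial derivatives, and $\mathbf{C}_b^1(\overline{\Omega})=C_b^1(\Omega)\cap C(\overline{\Omega})$ is the subspace of those that extend continuously to $\overline{\Omega}$. The normal trace is $\mathrm{N}(\phi,\mu)=\int_\Omega\nabla\phi\cdot d\mu+\int_\Omega\phi\,d(\mathrm{div}\,\mu)$ (where $d(\mathrm{div}\,\mu)$ is $\mathrm{div}\,\mu\,dx$ if $\mu\in\mathrm{M}^p(\Omega;\mathrm{div})$). For non-empty $\Gamma\subset\partial\Omega$, $\mathrm{DM}_\Gamma(\Omega)$ (resp. $\mathrm{M}^p_\Gamma(\Omega;\mathrm{div})$) is the set of $\mu\in\mathrm{DM}(\Omega)$ (resp. $\mathrm{M}^p(\Omega;\mathrm{div})$) with $\mathrm{N}(\phi,\mu)=0$ for all $\phi\in\mathbf{C}_b^1(\overline{\Omega})$ such that $\phi=0$ on $\overline{\partial\Omega\setminus\Gamma}$; these carry the norms of $\mathrm{DM}(\Omega)$, $\mathrm{M}^p(\Omega;\mathrm{div})$. For $\Gamma=\emptyset$, $\mathrm{DM}_\Gamma(\Omega)=\mathrm{DM}(\Omega)$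 and $\mathrm{M}^p_\Gamma(\Omega;\mathrm{div})=\mathrm{M}^p(\Omega;\mathrm{div})$. *)

theory Defs
  imports "HOL-Analysis.Analysis" "HOL-Probability.Essential_Supremum"
begin

text \<open>
  Throughout, R^N is an arbitrary Euclidean space \<open>'a\<close>, and \<open>\<Omega>\<close> is an open subset of it.
  Functions on \<open>\<Omega>\<close> are total functions on \<open>'a\<close>; their values outside \<open>\<Omega>\<close>
  (outside \<open>closure \<Omega>\<close> for functions continuous up to the boundary) are irrelevant.
\<close>

section \<open>Function spaces\<close>

definition grad :: "('a::euclidean_space \<Rightarrow> real) \<Rightarrow> 'a \<Rightarrow> 'a" where
  "grad f x = (\<Sum>i\<in>Basis. frechet_derivative f (at x) i *\<^sub>R i)"

fun Ck :: "nat \<Rightarrow> 'a::euclidean_space set \<Rightarrow> ('a \<Rightarrow> real) set" where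
  "Ck 0 \<Omega> = {f. continuous_on \<Omega> f}"
| "Ck (Suc k) \<Omega> = {f. (\<forall>x\<in>\<Omega>. f differentiable (at x)) \<and>
                      (\<forall>i\<in>Basis. (\<lambda>x. frechet_derivative f (at x) i) \<in> Ck k \<Omega>)}"

text \<open>Smooth functions with compact support in \<open>\<Omega>\<close>.\<close>

definition Cc_infty :: "'a::euclidean_space set \<Rightarrow> ('a \<Rightarrow> real) set" where
  "Cc_infty \<Omega> = {\<phi>. (\<forall>k. \<phi> \<in> Ck k \<Omega>) \<and>
                 compact (closure {x \<in> \<Omega>. \<phi> x \<noteq> 0}) \<and> closure {x \<in> \<Omega>. \<phi> x \<noteq> 0} \<subseteq> \<Omega>}"

definition Cb1 :: "'a::euclidean_space set \<Rightarrow> ('a \<Rightarrow> real) set" where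
  "Cb1 \<Omega> = {\<phi> \<in> Ck 1 \<Omega>. bounded (\<phi> ` \<Omega>) \<and>
              (\<forall>i\<in>Basis. bounded ((\<lambda>x. frechet_derivative \<phi> (at x) i) ` \<Omega>))}"

text \<open>A member of this space carries, as its values on \<open>frontier \<Omega>\<close>, those of its continuous
  extension to \<open>closure \<Omega>\<close>.\<close>

definition Cb1_closure :: "'a::euclidean_space set \<Rightarrow> ('a \<Rightarrow> real) set" where
  "Cb1_closure \<Omega> = {\<phi> \<in> Cb1 \<Omega>. continuous_on (closure \<Omega>) \<phi>}"

definition Lp_norm :: "'a measure \<Rightarrow> ennreal \<Rightarrow> ('a \<Rightarrow> real) \<Rightarrow> ennreal" where
  "Lp_norm M p f =
     (if p = \<infinity> then esssup M (\<lambda>x. ennreal \<bar>f x\<bar>)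
      else let I = (\<integral>\<^sup>+x. ennreal (\<bar>f x\<bar> powr enn2real p) \<partial>M)
           in if I = \<infinity> then \<infinity> else ennreal (enn2real I powr (1 / enn2real p)))"

definition Lp :: "'a measure \<Rightarrow> ennreal \<Rightarrow> ('a \<Rightarrow> real) set" where
  "Lp M p = {f \<in> borel_measurable M. Lp_norm M p f < \<infinity>}"

text \<open>Lebesgue measure on the Borel sets of \<open>\<Omega>\<close>. Using Borel rather than Lebesgue measurable
  representatives of elements of L^p is no restriction.\<close>

abbreviation leb :: "'a::euclidean_space set \<Rightarrow> 'a measure" where
  "leb \<Omega> \<equiv> restrict_space lborel \<Omega>"

section \<open>Real and vector valued finite Borel measures\<close>

abbreviation Bor :: "'a::euclidean_space set \<Rightarrow> 'a set set" where
  "Bor \<Omega> \<equiv> sets (restrict_space borel \<Omega>)"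

text \<open>Countably additive set functions on the Borel sets of \<open>\<Omega>\<close>, real valued for \<open>'b = real\<close> and
  R^N-valued for \<open>'b = 'a\<close>. Being set to \<open>0\<close> off the Borel sets makes equality of measures equality
  of functions. A finite non-negative library measure \<open>\<alpha>\<close> corresponds to the set function
  \<open>measure \<alpha>\<close>.\<close>

definition bmeas :: "'a::euclidean_space set \<Rightarrow> ('a set \<Rightarrow> 'b::euclidean_space) set" where
  "bmeas \<Omega> = {\<mu>. (\<forall>A. range A \<subseteq> Bor \<Omega> \<longrightarrow> disjoint_family A \<longrightarrow>
                       (\<lambda>i::nat. \<mu> (A i)) sums \<mu> (\<Union>i. A i)) \<and>
                  (\<forall>B. B \<notin> Bor \<Omega> \<longrightarrow> \<mu> B = 0)}"

definition pos_bmeas :: "'a::euclidean_space set \<Rightarrow> 'a measure set" where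
  "pos_bmeas \<Omega> = {\<alpha>. sets \<alpha> = Bor \<Omega> \<and> finite_measure \<alpha>}"

definition total_variation ::
    "'a::euclidean_space set \<Rightarrow> ('a set \<Rightarrow> 'b::euclidean_space) \<Rightarrow> 'a set \<Rightarrow> ennreal" where
  "total_variation \<Omega> \<mu> B =
     (SUP A\<in>{A. range A \<subseteq> Bor \<Omega> \<and> disjoint_family A \<and> (\<Union>i. A i) = B}.
        \<Sum>i::nat. ennreal (norm (\<mu> (A i))))"

definition M_norm :: "'a::euclidean_space set \<Rightarrow> ('a set \<Rightarrow> 'b::euclidean_space) \<Rightarrow> ennreal" where
  "M_norm \<Omega> \<mu> = total_variation \<Omega> \<mu> \<Omega>"

text \<open>The relation \<open>|\<mu>| \<le> \<alpha>\<close>.\<close>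

definition variation_le ::
    "'a::euclidean_space set \<Rightarrow> ('a set \<Rightarrow> 'b::euclidean_space) \<Rightarrow> 'a measure \<Rightarrow> bool" where
  "variation_le \<Omega> \<mu> \<alpha> \<longleftrightarrow> (\<forall>B\<in>Bor \<Omega>. total_variation \<Omega> \<mu> B \<le> emeasure \<alpha> B)"

text \<open>The positive part in the Jordan decomposition of a signed measure; the negative part of \<open>\<nu>\<close>
  is the positive part of \<open>-\<nu>\<close>.\<close>

definition pos_variation :: "'a::euclidean_space set \<Rightarrow> ('a set \<Rightarrow> real) \<Rightarrow> 'a measure" where
  "pos_variation \<Omega> \<nu> =
     measure_of \<Omega> (Bor \<Omega>) (\<lambda>A. SUP B\<in>{B \<in> Bor \<Omega>. B \<subseteq> A}. ennreal (\<nu> B))"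

definition signed_integral ::
    "'a::euclidean_space set \<Rightarrow> ('a set \<Rightarrow> real) \<Rightarrow> ('a \<Rightarrow> real) \<Rightarrow> real" where
  "signed_integral \<Omega> \<nu> f =
     (\<integral>x. f x \<partial>pos_variation \<Omega> \<nu>) - (\<integral>x. f x \<partial>pos_variation \<Omega> (\<lambda>A. - \<nu> A))"

definition vector_integral ::
    "'a::euclidean_space set \<Rightarrow> ('a set \<Rightarrow> 'a) \<Rightarrow> ('a \<Rightarrow> 'a) \<Rightarrow> real" where
  "vector_integral \<Omega> \<mu> \<Phi> =
     (\<Sum>i\<in>Basis. signed_integral \<Omega> (\<lambda>A. \<mu> A \<bullet> i) (\<lambda>x. \<Phi> x \<bullet> i))"

definition mutually_singular :: "'a measure \<Rightarrow> 'a measure \<Rightarrow> bool" where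
  "mutually_singular M N \<longleftrightarrow>
     (\<exists>S\<in>sets M \<inter> sets N. emeasure M S = 0 \<and> emeasure N (space N - S) = 0)"

text \<open>\<open>\<alpha> = f \<tau> + \<alpha>s\<close> with \<open>\<alpha>s\<close> singular to \<open>\<tau>\<close>. The density \<open>f\<close> is real valued; that it is
  non-negative \<open>\<tau>\<close>-almost everywhere follows from the identity.\<close>

definition lebesgue_decomposition ::
    "'a::euclidean_space set \<Rightarrow> 'a measure \<Rightarrow> 'a measure \<Rightarrow> ('a \<Rightarrow> real) \<Rightarrow> 'a measure \<Rightarrow> bool" where
  "lebesgue_decomposition \<Omega> \<alpha> \<tau> f \<alpha>s \<longleftrightarrow>
     \<alpha>s \<in> pos_bmeas \<Omega> \<and> integrable \<tau> f \<and>
     (\<forall>A\<in>Bor \<Omega>. measure \<alpha> A = (\<integral>x\<in>A. f x \<partial>\<tau>) + measure \<alpha>s A) \<and>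
     mutually_singular \<alpha>s \<tau>"

definition msupp :: "'a::euclidean_space set \<Rightarrow> 'a measure \<Rightarrow> 'a set" where
  "msupp \<Omega> \<alpha> = \<Inter>{C. closedin (top_of_set \<Omega>) C \<and> emeasure \<alpha> (\<Omega> - C) = 0}"

section \<open>Divergence measure fields\<close>

definition has_div_measure ::
    "'a::euclidean_space set \<Rightarrow> ('a set \<Rightarrow> 'a) \<Rightarrow> ('a set \<Rightarrow> real) \<Rightarrow> bool" where
  "has_div_measure \<Omega> \<mu> \<sigma> \<longleftrightarrow>
     \<sigma> \<in> bmeas \<Omega> \<and> (\<forall>\<phi>\<in>Cc_infty \<Omega>. vector_integral \<Omega> \<mu> (grad \<phi>) = - signed_integral \<Omega> \<sigma> \<phi>)"

definition DM :: "'a::euclidean_space set \<Rightarrow> ('a set \<Rightarrow> 'a) set" where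
  "DM \<Omega> = {\<mu> \<in> bmeas \<Omega>. \<exists>\<sigma>. has_div_measure \<Omega> \<mu> \<sigma>}"

definition div_measure :: "'a::euclidean_space set \<Rightarrow> ('a set \<Rightarrow> 'a) \<Rightarrow> 'a set \<Rightarrow> real" where
  "div_measure \<Omega> \<mu> = (THE \<sigma>. has_div_measure \<Omega> \<mu> \<sigma>)"

definition DM_norm :: "'a::euclidean_space set \<Rightarrow> ('a set \<Rightarrow> 'a) \<Rightarrow> ennreal" where
  "DM_norm \<Omega> \<mu> = M_norm \<Omega> \<mu> + M_norm \<Omega> (div_measure \<Omega> \<mu>)"

definition has_div_Lp ::
    "ennreal \<Rightarrow> 'a::euclidean_space set \<Rightarrow> ('a set \<Rightarrow> 'a) \<Rightarrow> ('a \<Rightarrow> real) \<Rightarrow> bool" where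
  "has_div_Lp p \<Omega> \<mu> h \<longleftrightarrow>
     h \<in> Lp (leb \<Omega>) p \<and>
     (\<forall>\<phi>\<in>Cc_infty \<Omega>. vector_integral \<Omega> \<mu> (grad \<phi>) = - (\<integral>x. \<phi> x * h x \<partial>leb \<Omega>))"

definition Mp :: "ennreal \<Rightarrow> 'a::euclidean_space set \<Rightarrow> ('a set \<Rightarrow> 'a) set" where
  "Mp p \<Omega> = {\<mu> \<in> bmeas \<Omega>. \<exists>h. has_div_Lp p \<Omega> \<mu> h}"

text \<open>The divergence is unique only up to null sets, so a representative is chosen.\<close>

definition div_Lp :: "ennreal \<Rightarrow> 'a::euclidean_space set \<Rightarrow> ('a set \<Rightarrow> 'a) \<Rightarrow> 'a \<Rightarrow> real" where
  "div_Lp p \<Omega> \<mu> = (SOME h. has_div_Lp p \<Omega> \<mu> h)"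

definition Mp_norm :: "ennreal \<Rightarrow> 'a::euclidean_space set \<Rightarrow> ('a set \<Rightarrow> 'a) \<Rightarrow> ennreal" where
  "Mp_norm p \<Omega> \<mu> = M_norm \<Omega> \<mu> + Lp_norm (leb \<Omega>) p (div_Lp p \<Omega> \<mu>)"

section \<open>Vanishing normal trace on a part of the boundary\<close>

definition normal_trace_DM ::
    "'a::euclidean_space set \<Rightarrow> ('a \<Rightarrow> real) \<Rightarrow> ('a set \<Rightarrow> 'a) \<Rightarrow> real" where
  "normal_trace_DM \<Omega> \<phi> \<mu> =
     vector_integral \<Omega> \<mu> (grad \<phi>) + signed_integral \<Omega> (div_measure \<Omega> \<mu>) \<phi>"

definition normal_trace_Mp ::
    "ennreal \<Rightarrow> 'a::euclidean_space set \<Rightarrow> ('a \<Rightarrow> real) \<Rightarrow> ('a set \<Rightarrow> 'a) \<Rightarrow> real" where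
  "normal_trace_Mp p \<Omega> \<phi> \<mu> =
     vector_integral \<Omega> \<mu> (grad \<phi>) + (\<integral>x. \<phi> x * div_Lp p \<Omega> \<mu> x \<partial>leb \<Omega>)"

definition trace_tests :: "'a::euclidean_space set \<Rightarrow> 'a set \<Rightarrow> ('a \<Rightarrow> real) set" where
  "trace_tests \<Omega> \<Gamma> = {\<phi> \<in> Cb1_closure \<Omega>. \<forall>x\<in>closure (frontier \<Omega> - \<Gamma>). \<phi> x = 0}"

definition DM_Gamma :: "'a::euclidean_space set \<Rightarrow> 'a set \<Rightarrow> ('a set \<Rightarrow> 'a) set" where
  "DM_Gamma \<Omega> \<Gamma> =
     (if \<Gamma> = {} then DM \<Omega>
      else {\<mu> \<in> DM \<Omega>. \<forall>\<phi>\<in>trace_tests \<Omega> \<Gamma>. normal_trace_DM \<Omega> \<phi> \<mu> = 0})"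

text \<open>If \<open>\<Omega>\<close> has infinite Lebesgue measure and \<open>p > 1\<close>, the integral of \<open>\<phi> div \<mu>\<close> need not exist
  for a bounded \<open>\<phi>\<close>. A vanishing normal trace is understood to include its existence; without the
  integrability clause the library would silently give a non-existing integral the value \<open>0\<close>.\<close>

definition Mp_Gamma :: "ennreal \<Rightarrow> 'a::euclidean_space set \<Rightarrow> 'a set \<Rightarrow> ('a set \<Rightarrow> 'a) set" where
  "Mp_Gamma p \<Omega> \<Gamma> =
     (if \<Gamma> = {} then Mp p \<Omega>
      else {\<mu> \<in> Mp p \<Omega>. \<forall>\<phi>\<in>trace_tests \<Omega> \<Gamma>.
              integrable (leb \<Omega>) (\<lambda>x. \<phi> x * div_Lp p \<Omega> \<mu> x) \<and>
              normal_trace_Mp p \<Omega> \<phi> \<mu> = 0})"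

section \<open>The constraint sets\<close>

definition K0 :: "'a::euclidean_space set \<Rightarrow> 'a measure \<Rightarrow> ('a set \<Rightarrow> 'a) set" where
  "K0 \<Omega> \<alpha> = {\<sigma> \<in> DM \<Omega>. variation_le \<Omega> \<sigma> \<alpha>}"

definition K0_Gamma :: "'a::euclidean_space set \<Rightarrow> 'a set \<Rightarrow> 'a measure \<Rightarrow> ('a set \<Rightarrow> 'a) set" where
  "K0_Gamma \<Omega> \<Gamma> \<alpha> = {\<sigma> \<in> DM_Gamma \<Omega> \<Gamma>. variation_le \<Omega> \<sigma> \<alpha>}"

definition Kp :: "ennreal \<Rightarrow> 'a::euclidean_space set \<Rightarrow> 'a measure \<Rightarrow> ('a set \<Rightarrow> 'a) set" where
  "Kp p \<Omega> \<alpha> = {\<sigma> \<in> Mp p \<Omega>. variation_le \<Omega> \<sigma> \<alpha>}"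

definition Kp_Gamma ::
    "ennreal \<Rightarrow> 'a::euclidean_space set \<Rightarrow> 'a set \<Rightarrow> 'a measure \<Rightarrow> ('a set \<Rightarrow> 'a) set" where
  "Kp_Gamma p \<Omega> \<Gamma> \<alpha> = {\<sigma> \<in> Mp_Gamma p \<Omega> \<Gamma>. variation_le \<Omega> \<sigma> \<alpha>}"

end

theory Submission
  imports Defs
begin

text \<open>
  Since \<open>|\<mu>| \<le> \<alpha>\<close>, the measure \<open>\<mu>\<close> has a density \<open>m\<close> with \<open>|m| \<le> 1\<close> with respect to \<open>\<alpha>\<close>, and the
  approximating sequence is \<open>\<mu>\<^sub>n = g\<^sub>n \<mu>\<close>: its variation is at most \<open>g\<^sub>n \<alpha> \<le> \<alpha>\<^sub>n\<close>, and the product rule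
  \<open>div (g \<mu>) = g div \<mu> + \<nabla>g \<cdot> \<mu>\<close>, applied with \<open>g = g\<^sub>n\<close> and with \<open>g = g\<^sub>n - 1\<close>, gives membership and
  convergence. The product rule amounts to testing the divergence identity of \<open>\<mu>\<close> with \<open>g \<phi>\<close>,
  which is only of class \<open>C^1\<close>, so that identity is first extended to such test functions by
  mollification. In the case of an \<open>L^p\<close> divergence, \<open>\<nabla>g\<close> vanishes on the support of the singular
  part of \<open>\<alpha>\<close>, so that \<open>\<nabla>g \<cdot> \<mu>\<close> has the density \<open>F \<nabla>g \<cdot> m\<close> with respect to Lebesgue measure. For
  vanishing normal traces, multiplication by \<open>g\<close> maps the space of test functions into itself.
\<close>

section \<open>Smooth functions and mollification\<close>

text \<open>Integrals against signed set functions are defined through Jordan decompositions, where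
  a product rule cannot be computed directly. All measures are therefore written as densities with
  respect to positive measures, which turns identities into ordinary integrals and estimates into
  pointwise ones. For a measure divergence the reference measure \<open>\<tau>\<close> has to
  dominate both \<open>div \<mu>\<close> and \<open>\<alpha>\<close>, because
  \<open>g div \<mu> + \<nabla>g \<cdot> \<mu>\<close> mixes the two. For an \<open>L^p\<close>
  divergence it is Lebesgue measure, which need not dominate \<open>\<alpha>\<close>; the term
  \<open>\<nabla>g \<cdot> \<mu>\<close> is then a function only because \<open>\<nabla>g\<close>
  kills the singular part. In both settings a divergence is known only through its action on test
  functions, so one fundamental lemma of the calculus of variations, for sigma-finite measures,
  identifies it. The \<open>L^p\<close> estimates merely have to tend to zero, so a crude constant
  stands in for Minkowski's inequality. An empty \<open>\<Gamma>\<close> imposes no trace condition,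
  so the statements without boundary are instances of those with boundary.\<close>

lemma Ck_UNIV_subset: "f \<in> Ck k UNIV \<Longrightarrow> f \<in> Ck k \<Omega>"
  by (induction k arbitrary: f) (auto intro: continuous_on_subset)

lemma Ck_Suc_UNIV_I:
  assumes "\<And>x. (f has_derivative f' x) (at x)" and "\<And>i. i \<in> Basis \<Longrightarrow> (\<lambda>x. f' x i) \<in> Ck k UNIV"
  shows "f \<in> Ck (Suc k) UNIV"
proof -
  have "frechet_derivative f (at x) = f' x" for x
    using frechet_derivative_at[OF assms(1)[of x]] by simp
  then show ?thesis
    using assms by (auto simp: differentiable_def)
qed

lemma Ck_Suc_has_derivative:
  assumes "f \<in> Ck (Suc k) \<Omega>" "x \<in> \<Omega>"
  shows "(f has_derivative frechet_derivative f (at x)) (at x)"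
  using assms by (auto simp: frechet_derivative_works)

lemma Ck_SucD: "f \<in> Ck (Suc k) \<Omega> \<Longrightarrow> f \<in> Ck k \<Omega>"
proof (induction k arbitrary: f)
  case 0
  then have "\<forall>x\<in>\<Omega>. isCont f x"
    by (auto intro: differentiable_imp_continuous_within)
  then show ?case by (auto intro: continuous_at_imp_continuous_on)
next
  case (Suc k)
  \<comment> \<open>Only the outer successor is unfolded: the partial derivatives must remain in
    \<open>Ck (Suc k)\<close> for the induction hypothesis to apply to them.\<close>
  have "f \<in> Ck (Suc (Suc k)) \<Omega> \<longleftrightarrow> (\<forall>x\<in>\<Omega>. f differentiable (at x)) \<and>
     (\<forall>i\<in>Basis. (\<lambda>x. frechet_derivative f (at x) i) \<in> Ck (Suc k) \<Omega>)"
    by (subst Ck.simps) simp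
  with Suc show ?case by simp
qed

lemma Ck_continuous_on: "f \<in> Ck k \<Omega> \<Longrightarrow> continuous_on \<Omega> f"
  by (induction k) (use Ck_SucD in auto)

lemma Ck_const: "(\<lambda>x. c) \<in> Ck k UNIV"
proof (induction k arbitrary: c)
  case (Suc k)
  show ?case by (rule Ck_Suc_UNIV_I[where f'="\<lambda>_ _. 0"]) (use Suc in auto)
qed simp

lemma Ck_add: "f \<in> Ck k UNIV \<Longrightarrow> g \<in> Ck k UNIV \<Longrightarrow> (\<lambda>x. f x + g x) \<in> Ck k UNIV"
proof (induction k arbitrary: f g)
  case 0
  then show ?case by (auto intro: continuous_intros)
next
  case (Suc k)
  show ?case
  proof (rule Ck_Suc_UNIV_I)
    show "((\<lambda>x. f x + g x) has_derivative
        (\<lambda>v. frechet_derivative f (at x) v + frechet_derivative g (at x) v)) (at x)" for x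
      using Suc.prems by (intro has_derivative_add Ck_Suc_has_derivative) auto
  qed (use Suc in auto)
qed

text \<open>The derivative of a product contains the undifferentiated factors, which are needed one
  class lower; \<open>Ck_SucD\<close> supplies that.\<close>

lemma Ck_mult: "f \<in> Ck k UNIV \<Longrightarrow> g \<in> Ck k UNIV \<Longrightarrow> (\<lambda>x. f x * g x) \<in> Ck k UNIV"
proof (induction k arbitrary: f g)
  case 0
  then show ?case by (auto intro: continuous_intros)
next
  case (Suc k)
  show ?case
  proof (rule Ck_Suc_UNIV_I)
    show "((\<lambda>x. f x * g x) has_derivative
        (\<lambda>v. f x * frechet_derivative g (at x) v + frechet_derivative f (at x) v * g x)) (at x)" for x
      using Suc.prems by (intro has_derivative_mult Ck_Suc_has_derivative) auto
  qed (use Suc.prems Suc.prems[THEN Ck_SucD] in \<open>auto intro!: Ck_add Suc.IH\<close>)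
qed

lemma Ck_prod:
  assumes "finite I" "\<And>i. i \<in> I \<Longrightarrow> f i \<in> Ck k UNIV"
  shows "(\<lambda>x. \<Prod>i\<in>I. f i x) \<in> Ck k UNIV"
  using assms by (induction I rule: finite_induct) (auto intro: Ck_const Ck_mult)

section \<open>Smooth bump functions on boxes\<close>

text \<open>The functions \<open>exp (- c / t) / t ^ m\<close>, extended by zero, span a space that is closed under
  differentiation.\<close>

definition flat_exp :: "nat \<Rightarrow> real \<Rightarrow> real \<Rightarrow> real" where
  "flat_exp m c t = (if t > 0 then exp (- (c / t)) / t ^ m else 0)"

text \<open>With \<open>y = c / t\<close> the function is \<open>c^(-m) * y^m * exp (-y)\<close>,
  and \<open>y\<close> tends to infinity as \<open>t\<close> decreases to 0.\<close>

lemma flat_exp_tendsto_0: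
  assumes "c > 0"
  shows "(flat_exp m c \<longlongrightarrow> 0) (at_right 0)"
proof -
  have "filterlim (\<lambda>t::real. c * inverse t) at_top (at_right 0)"
    by (rule filterlim_tendsto_pos_mult_at_top[OF tendsto_const assms filterlim_inverse_at_top_right])
  from filterlim_compose[OF tendsto_power_div_exp_0 this]
  have "((\<lambda>t::real. (1 / c ^ m) * ((c * inverse t) ^ m / exp (c * inverse t))) \<longlongrightarrow> (1 / c ^ m) * 0) (at_right 0)"
    by (intro tendsto_mult tendsto_const)
  then have "((\<lambda>t::real. (1 / c ^ m) * ((c * inverse t) ^ m / exp (c * inverse t))) \<longlongrightarrow> 0) (at_right 0)"
    by simp
  then show ?thesis
    by (rule Lim_transform_eventually)
      (use assms in \<open>auto simp: eventually_at_right_less flat_exp_def field_simps exp_minus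
        eventually_at_filter\<close>)
qed

lemma flat_exp_derivative:
  assumes "c > 0"
  shows "(flat_exp m c has_real_derivative c * flat_exp (m + 2) c t - m * flat_exp (m + 1) c t) (at t)"
proof -
  consider "t > 0" | "t < 0" | "t = 0" by linarith
  then show ?thesis
  proof cases
    case 1
    \<comment> \<open>The power rule produces a truncated exponent; for \<open>m = 0\<close> the
      factor \<open>real m\<close> makes both sides vanish.\<close>
    have *: "real m * t ^ (m - Suc 0) = real m * t ^ m / t"
      using 1 by (cases m) auto
    have "((\<lambda>t. exp (- (c / t)) / t ^ m) has_real_derivative
        c * flat_exp (m + 2) c t - m * flat_exp (m + 1) c t) (at t)"
      using 1 by (auto intro!: derivative_eq_intros simp: flat_exp_def divide_simps *)
         (auto simp: algebra_simps power2_eq_square)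
    then show ?thesis
      by (rule DERIV_cong_ev[OF refl _ refl, THEN iffD1, rotated])
         (use eventually_nhds_in_open[of "{0<..}" t] 1 in \<open>auto elim!: eventually_mono simp: flat_exp_def\<close>)
  next
    case 2
    have "((\<lambda>t. 0) has_real_derivative 0) (at t)" by simp
    then have "(flat_exp m c has_real_derivative 0) (at t)"
      by (rule DERIV_cong_ev[OF refl _ refl, THEN iffD1, rotated])
         (use eventually_nhds_in_open[of "{..<0}" t] 2 in \<open>auto elim!: eventually_mono simp: flat_exp_def\<close>)
    then show ?thesis using 2 by (simp add: flat_exp_def)
  next
    case 3
    \<comment> \<open>The difference quotient of \<open>flat_exp m c\<close> at 0 is exactly
      \<open>flat_exp (m + 1) c h\<close>, so differentiability at 0 is again the limit statement
      for the family.\<close>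
    have "((\<lambda>h. flat_exp (m + 1) c h) \<longlongrightarrow> 0) (at 0)"
    proof (rule filterlim_split_at_real)
      show "(flat_exp (m + 1) c \<longlongrightarrow> 0) (at_right 0)" by (rule flat_exp_tendsto_0[OF assms])
      show "(flat_exp (m + 1) c \<longlongrightarrow> 0) (at_left 0)"
        by (rule Lim_transform_eventually[OF tendsto_const])
           (auto simp: flat_exp_def eventually_at_filter)
    qed
    then have "(flat_exp m c has_real_derivative 0) (at 0)"
      unfolding has_field_derivative_iff
      by (rule Lim_transform_eventually)
         (auto simp: flat_exp_def eventually_at_filter)
    then show ?thesis using 3 by (simp add: flat_exp_def)
  qed
qed

text \<open>The family is closed under differentiation up to linear combinations, so the induction
  on \<open>k\<close> runs with \<open>m\<close> arbitrary. The affine argument is the signed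
  distance to a face of a box when \<open>v\<close> is plus or minus a basis vector.\<close>

lemma flat_exp_Ck:
  assumes "c > 0"
  shows "(\<lambda>x. flat_exp m c (x \<bullet> v + r)) \<in> Ck k UNIV"
proof (induction k arbitrary: m)
  case 0
  have "continuous_on UNIV (flat_exp m c)"
    using DERIV_continuous_on[OF flat_exp_derivative[OF assms]] 
    by (metis DERIV_isCont assms continuous_at_imp_continuous_on flat_exp_derivative)
  then have "continuous_on UNIV (\<lambda>x. flat_exp m c (x \<bullet> v + r))"
    by (rule continuous_on_compose2) (auto intro!: continuous_intros)
  then show ?case by simp
next
  case (Suc k)
  let ?d = "\<lambda>x. c * flat_exp (m + 2) c (x \<bullet> v + r) + - real m * flat_exp (m + 1) c (x \<bullet> v + r)"
  show ?case
  proof (rule Ck_Suc_UNIV_I)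
    fix x
    have "(flat_exp m c has_derivative (*) (?d x)) (at (x \<bullet> v + r))"
      using flat_exp_derivative[OF assms, of m "x \<bullet> v + r"]
      by (simp add: has_field_derivative_def)
    have "((\<lambda>x. x \<bullet> v + r) has_derivative (\<lambda>y. y \<bullet> v)) (at x)"
      by (auto intro!: derivative_eq_intros)
    from has_derivative_compose[OF this \<open>(flat_exp m c has_derivative (*) (?d x)) (at (x \<bullet> v + r))\<close>]
    show "((\<lambda>x. flat_exp m c (x \<bullet> v + r)) has_derivative (\<lambda>y. ?d x * (y \<bullet> v))) (at x)" .
  next
    fix i :: 'a
    show "(\<lambda>x. ?d x * (i \<bullet> v)) \<in> Ck k UNIV"
      by (intro Ck_mult Ck_add Ck_const Suc.IH)
  qed
qed

text \<open>Each coordinate contributes two factors, one switching on at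
  \<open>a \<bullet> i\<close> and one switching off at \<open>b \<bullet> i\<close>. The parameter
  \<open>c\<close> controls the steepness: a fixed \<open>c\<close> gives a mollifier profile, while
  \<open>c\<close> tending to 0 gives the indicator of the open box.\<close>

definition box_bump :: "real \<Rightarrow> 'a::euclidean_space \<Rightarrow> 'a \<Rightarrow> 'a \<Rightarrow> real" where
  "box_bump c a b x =
     (\<Prod>i\<in>Basis. flat_exp 0 c (x \<bullet> i + - (a \<bullet> i)) * flat_exp 0 c (x \<bullet> (- i) + b \<bullet> i))"

lemma box_bump_Ck: "c > 0 \<Longrightarrow> box_bump c a b \<in> Ck k UNIV"
  unfolding box_bump_def by (intro Ck_prod Ck_mult flat_exp_Ck) auto

lemma box_bump_bounds:
  assumes "c > 0" shows "0 \<le> box_bump c a b x" "box_bump c a b x \<le> 1"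
  unfolding box_bump_def using assms
  by (auto simp: flat_exp_def intro!: prod_nonneg prod_le_1 mult_nonneg_nonneg mult_le_one)

lemma box_bump_pos_iff: "box_bump c a b x \<noteq> 0 \<longleftrightarrow> x \<in> box a b"
  by (auto simp: box_bump_def mem_box flat_exp_def prod_zero_iff)

lemma box_bump_tendsto_indicator:
  fixes a b x :: "'a::euclidean_space"
  shows "(\<lambda>k. box_bump (inverse (real (Suc k))) a b x) \<longlonglongrightarrow> indicator (box a b) x"
proof (cases "x \<in> box a b")
  case True
  have *: "(\<lambda>k. flat_exp 0 (inverse (real (Suc k))) t) \<longlonglongrightarrow> 1" if "t > 0" for t
  proof -
    have "(\<lambda>k. exp (- (inverse (real (Suc k)) / t))) \<longlonglongrightarrow> exp (- (0 / t))"
      by (intro tendsto_intros LIMSEQ_inverse_real_of_nat) (use that in auto)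
    then show ?thesis using that by (simp add: flat_exp_def)
  qed
  have "(\<lambda>k. box_bump (inverse (real (Suc k))) a b x) \<longlonglongrightarrow> (\<Prod>i\<in>(Basis::'a set). 1 * 1)"
    unfolding box_bump_def
  proof (rule tendsto_prod)
    fix i :: 'a assume "i \<in> Basis"
    then show "(\<lambda>k. flat_exp 0 (inverse (real (Suc k))) (x \<bullet> i + - (a \<bullet> i)) *
        flat_exp 0 (inverse (real (Suc k))) (x \<bullet> (- i) + b \<bullet> i)) \<longlonglongrightarrow> 1 * 1"
      using True by (intro tendsto_mult *) (auto simp: mem_box)
  qed
  then show ?thesis using True by simp
next
  case False
  then show ?thesis using box_bump_pos_iff[of _ a b x] by auto
qed

lemma Cc_inftyI:
  assumes "\<And>k. f \<in> Ck k UNIV" "compact K" "K \<subseteq> \<Omega>" "\<And>x. x \<in> \<Omega> \<Longrightarrow> f x \<noteq> 0 \<Longrightarrow> x \<in> K"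
  shows "f \<in> Cc_infty \<Omega>"
proof -
  have "closure {x \<in> \<Omega>. f x \<noteq> 0} \<subseteq> K"
    using assms by (intro closure_minimal compact_imp_closed) auto
  moreover from this have "compact (closure {x \<in> \<Omega>. f x \<noteq> 0})"
    using compact_Int_closed[OF assms(2), of "closure {x \<in> \<Omega>. f x \<noteq> 0}"]
    by (simp add: Int_absorb1 )
  ultimately show ?thesis
    using assms by (auto simp: Cc_infty_def intro: Ck_UNIV_subset)
qed

lemma box_bump_Cc_infty:
  assumes "c > 0" "cbox a b \<subseteq> \<Omega>" shows "box_bump c a b \<in> Cc_infty \<Omega>"
  by (rule Cc_inftyI[where K="cbox a b"])
     (use assms box_subset_cbox[of a b] in \<open>auto simp: box_bump_pos_iff intro!: box_bump_Ck\<close>)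

section \<open>Gradients and functions of class C^1\<close>

lemma grad_inner: "f differentiable (at x) \<Longrightarrow> i \<in> Basis \<Longrightarrow> grad f x \<bullet> i = frechet_derivative f (at x) i"
  by (simp add: grad_def inner_sum_left_Basis)

lemma grad_eqI:
  assumes "(f has_derivative (\<lambda>v. v \<bullet> d)) (at x)"
  shows "grad f x = d"
  using frechet_derivative_at[OF assms, symmetric] 
  by (simp add: grad_def euclidean_representation inner_commute[of _ d])

lemma has_derivative_grad:
  assumes "f differentiable (at x)"
  shows "(f has_derivative (\<lambda>v. v \<bullet> grad f x)) (at x)"
proof -
  have f: "(f has_derivative frechet_derivative f (at x)) (at x)"
    using assms by (simp add: frechet_derivative_works)
  then have "linear (frechet_derivative f (at x))"
    by (rule has_derivative_linear)
  then have "frechet_derivative f (at x) v = v \<bullet> grad f x" for v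
    using linear_sum[of "frechet_derivative f (at x)" "\<lambda>i. (v \<bullet> i) *\<^sub>R i" Basis]
    by (simp add: grad_def inner_sum_right linear_cmul euclidean_representation mult.commute)
  then have "frechet_derivative f (at x) = (\<lambda>v. v \<bullet> grad f x)" by auto
  then show ?thesis using f by simp
qed

lemma Ck1_iff: "f \<in> Ck 1 \<Omega> \<longleftrightarrow> (\<forall>x\<in>\<Omega>. f differentiable (at x)) \<and> continuous_on \<Omega> (grad f)"
proof -
  have "continuous_on \<Omega> (grad f) \<longleftrightarrow> (\<forall>i\<in>Basis. continuous_on \<Omega> (\<lambda>x. grad f x \<bullet> i))"
    by (rule continuous_on_componentwise)
  then show ?thesis by (simp add: grad_def)
qed

lemma Ck1D:
  assumes "f \<in> Ck 1 \<Omega>"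
  shows "x \<in> \<Omega> \<Longrightarrow> f differentiable (at x)" "continuous_on \<Omega> (grad f)" "continuous_on \<Omega> f"
    "i \<in> Basis \<Longrightarrow> continuous_on \<Omega> (\<lambda>x. frechet_derivative f (at x) i)"
  using assms Ck_continuous_on[OF assms] assms[unfolded Ck1_iff] by auto

section \<open>Convolution and its derivatives\<close>

text \<open>This is differentiation under the integral over a compact box, with the derivative
  falling on the C^1 factor alone. It is used in two roles: with a smooth kernel as
  \<open>\<kappa>\<close> to obtain smoothness, and with the function to be mollified as
  \<open>\<kappa>\<close> to compute the gradient.\<close>

lemma convolution_has_derivative:
  fixes \<kappa> :: "'a::euclidean_space \<Rightarrow> real"
  assumes \<kappa>: "\<kappa> \<in> Ck 1 UNIV" and w: "continuous_on (cbox c d) w"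
  shows "((\<lambda>x. integral (cbox c d) (\<lambda>z. \<kappa> (x - z) * w z)) has_derivative
    (\<lambda>v. integral (cbox c d) (\<lambda>z. frechet_derivative \<kappa> (at (x - z)) v * w z))) (at x)"
proof -
  \<comment> \<open>The Leibniz rule asks for a jointly continuous derivative with values in the
    bounded linear maps; in finite dimension its continuity can be checked on basis vectors.\<close>
  define D where "D x z = Blinfun (\<lambda>v. frechet_derivative \<kappa> (at (x - z)) v * w z)" for x z
  have \<kappa>': "(\<kappa> has_derivative frechet_derivative \<kappa> (at x)) (at x)" for x
    using Ck1D(1)[OF \<kappa>] by (simp add: frechet_derivative_works)
  have D: "blinfun_apply (D x z) = (\<lambda>v. frechet_derivative \<kappa> (at (x - z)) v * w z)" for x z
    unfolding D_def
    by (rule bounded_linear_Blinfun_apply)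
      (intro bounded_linear_mult_const has_derivative_bounded_linear[OF \<kappa>'])
  have cont: "continuous_on (UNIV \<times> cbox c d) (\<lambda>(x, z). D x z)"
  proof (rule continuous_on_blinfun_componentwise)
    fix i :: 'a assume "i \<in> Basis"
    then have "continuous_on UNIV (\<lambda>x. frechet_derivative \<kappa> (at x) i)"
      using Ck1D[OF \<kappa>] by blast
    then have "continuous_on (UNIV \<times> cbox c d) (\<lambda>p. frechet_derivative \<kappa> (at (fst p - snd p)) i)"
      by (rule continuous_on_compose2) (auto intro!: continuous_intros)
    moreover have "continuous_on (UNIV \<times> cbox c d) (\<lambda>p. w (snd p))"
      by (rule continuous_on_compose2[OF w]) (auto intro!: continuous_intros)
    ultimately show "continuous_on (UNIV \<times> cbox c d) (\<lambda>p. (case p of (x, z) \<Rightarrow> D x z) i)"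
      by (auto simp: D case_prod_beta intro!: continuous_intros)
  qed
  have \<kappa>_cont: "continuous_on UNIV \<kappa>"
    using Ck1D(3)[OF \<kappa>] .
  have "((\<lambda>x. integral (cbox c d) (\<lambda>z. \<kappa> (x - z) * w z)) has_derivative
    integral (cbox c d) (D x)) (at x within UNIV)"
  proof (rule leibniz_rule[OF _ _ cont])
    fix x z
    have "((\<lambda>x. \<kappa> (x - z)) has_derivative frechet_derivative \<kappa> (at (x - z))) (at x)"
      by (rule has_derivative_compose[of "\<lambda>x. x - z" "\<lambda>v. v" x UNIV, OF _ \<kappa>'])
         (auto intro!: derivative_eq_intros)
    then show "((\<lambda>x. \<kappa> (x - z) * w z) has_derivative blinfun_apply (D x z)) (at x)"
      unfolding D by (rule has_derivative_mult_left)
  next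
    show "(\<lambda>z. \<kappa> (x - z) * w z) integrable_on cbox c d" for x
      by (intro integrable_continuous continuous_on_mult w continuous_on_compose2[OF \<kappa>_cont])
         (auto intro!: continuous_intros)
  qed auto
  moreover have "D x integrable_on cbox c d"
    using continuous_on_compose2[OF cont continuous_on_Pair[OF continuous_on_const continuous_on_id],
        of x "cbox c d"]
    by (intro integrable_continuous) auto
  then have "blinfun_apply (integral (cbox c d) (D x)) =
      (\<lambda>v. integral (cbox c d) (\<lambda>z. frechet_derivative \<kappa> (at (x - z)) v * w z))"
    by (intro ext) (simp add: blinfun_apply_integral D)
  ultimately show ?thesis by simp
qed

text \<open>Every derivative is again a convolution with the same \<open>w\<close>, its kernel being
  a derivative of \<open>\<kappa>\<close>. The induction therefore generalises over the kernel,
  which must be smooth of all orders.\<close>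

lemma convolution_Ck:
  fixes \<kappa> :: "'a::euclidean_space \<Rightarrow> real"
  assumes "\<And>j. \<kappa> \<in> Ck j UNIV" and w: "continuous_on (cbox c d) w"
  shows "(\<lambda>x. integral (cbox c d) (\<lambda>z. \<kappa> (x - z) * w z)) \<in> Ck k UNIV"
  using assms(1)
proof (induction k arbitrary: \<kappa>)
  case 0
  then show ?case
    using convolution_has_derivative[OF 0 w]
    by (auto intro!: continuous_at_imp_continuous_on has_derivative_continuous)
next
  case (Suc k)
  have *: "(\<lambda>y. frechet_derivative \<kappa> (at y) i) \<in> Ck j UNIV" if "i \<in> Basis" for i j
    using Suc.prems[of "Suc j"] that by simp
  show ?case
    by (rule Ck_Suc_UNIV_I[OF convolution_has_derivative[OF Suc.prems w]]) (rule Suc.IH[OF *])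
qed

lemma integral_cbox_eq_lborel:
  fixes f :: "'a::euclidean_space \<Rightarrow> real"
  assumes "continuous_on UNIV f" "\<And>x. f x \<noteq> 0 \<Longrightarrow> x \<in> cbox c d"
  shows "integral (cbox c d) f = (\<integral>x. f x \<partial>lborel)"
proof -
  have "set_integrable lborel (cbox c d) f"
    unfolding set_integrable_def
    by (rule borel_integrable_compact) (use assms in \<open>auto intro: continuous_on_subset\<close>)
  from set_borel_integral_eq_integral(2)[OF this]
  have "integral (cbox c d) f = (LINT x : cbox c d | lborel. f x)" by simp
  also have "\<dots> = (\<integral>x. f x \<partial>lborel)"
    unfolding set_lebesgue_integral_def
    by (rule Bochner_Integration.integral_cong) (use assms(2) in \<open>auto simp: indicator_def\<close>)
  finally show ?thesis .
qed

lemma lborel_integral_reflect: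
  fixes f :: "'a::euclidean_space \<Rightarrow> real"
  assumes [measurable]: "f \<in> borel_measurable borel"
  shows "(\<integral>y. f (x - y) \<partial>lborel) = (\<integral>y. f y \<partial>lborel)"
proof -
  have "(lborel :: 'a measure) = distr lborel borel (\<lambda>y. x + (-1) *\<^sub>R y)"
    using lborel_affine[of "-1" x] by (simp add: density_1 one_ennreal_def[symmetric])
  then have "(\<integral>y. f y \<partial>lborel) = (\<integral>y. f y \<partial>distr lborel borel (\<lambda>y. x + (-1) *\<^sub>R y))"
    by simp
  also have "\<dots> = (\<integral>y. f (x + (-1) *\<^sub>R y) \<partial>lborel)"
    by (rule integral_distr) auto
  finally show ?thesis by simp
qed

text \<open>The substitution of \<open>x - z\<close> for \<open>z\<close> is made over the whole
  space, where Lebesgue measure is invariant under reflection; the compact supports allow passing to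
  and from integrals over boxes.\<close>

lemma convolution_commute:
  fixes f g :: "'a::euclidean_space \<Rightarrow> real"
  assumes f: "continuous_on UNIV f" "\<And>x. f x \<noteq> 0 \<Longrightarrow> x \<in> cbox a b"
    and g: "continuous_on UNIV g" "\<And>x. g x \<noteq> 0 \<Longrightarrow> x \<in> cbox c d"
  shows "integral (cbox c d) (\<lambda>z. f (x - z) * g z) = integral (cbox a b) (\<lambda>y. g (x - y) * f y)"
proof -
  have *: "continuous_on UNIV (\<lambda>z. f (x - z) * g z)" "continuous_on UNIV (\<lambda>z. g (x - z) * f z)"
    by (auto intro!: continuous_intros continuous_on_compose2[OF f(1)] continuous_on_compose2[OF g(1)])
  have "integral (cbox c d) (\<lambda>z. f (x - z) * g z) = (\<integral>z. f (x - z) * g z \<partial>lborel)"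
    using g(2) by (intro integral_cbox_eq_lborel *) auto
  also have "\<dots> = (\<integral>z. f (x - (x - z)) * g (x - z) \<partial>lborel)"
    by (rule lborel_integral_reflect[symmetric]) (intro borel_measurable_continuous_onI *)
  also have "\<dots> = integral (cbox a b) (\<lambda>y. g (x - y) * f y)"
    using f(2) by (subst integral_cbox_eq_lborel[OF *(2)]) (auto simp: mult.commute)
  finally show ?thesis .
qed

section \<open>Mollifiers and smooth approximation of C^1 functions\<close>

lemma mollifier_exists:
  assumes "\<delta> > 0"
  obtains \<rho> :: "'a::euclidean_space \<Rightarrow> real" where "\<And>k. \<rho> \<in> Ck k UNIV" "\<And>x. \<rho> x \<ge> 0"
    "\<And>x. \<rho> x \<noteq> 0 \<Longrightarrow> x \<in> cbox (- (\<delta> *\<^sub>R One)) (\<delta> *\<^sub>R One)"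
    "integral (cbox (- (\<delta> *\<^sub>R One)) (\<delta> *\<^sub>R One)) \<rho> = 1"
proof -
  define a b :: 'a where "a = - (\<delta> *\<^sub>R One)" and "b = \<delta> *\<^sub>R One"
  let ?f = "box_bump 1 a b"
  have 0: "0 \<in> box a b"
    using assms by (auto simp: mem_box a_def b_def)
  have cont: "continuous_on (cbox a b) ?f"
    using Ck_continuous_on[OF box_bump_Ck[of 1 a b 0]] by (auto intro: continuous_on_subset)
  then have int: "?f integrable_on cbox a b"
    by (rule integrable_continuous)
  \<comment> \<open>A continuous non-negative function with zero integral vanishes on the box, but
    the bump is non-zero at its centre 0.\<close>
  have "integral (cbox a b) ?f \<noteq> 0"
  proof
    assume "integral (cbox a b) ?f = 0"
    then have "(?f has_integral 0) (cbox a b)"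
      using integrable_integral[OF int] by simp
    from has_integral_0_cbox_imp_0[OF cont _ this, of 0] 0 box_bump_bounds(1)[of 1 a b]
    show False
      using box_bump_pos_iff[of 1 a b 0] box_subset_cbox[of a b] by auto
  qed
  moreover have "integral (cbox a b) ?f \<ge> 0"
    by (rule Henstock_Kurzweil_Integration.integral_nonneg[OF int]) (simp add: box_bump_bounds)
  ultimately have pos: "integral (cbox a b) ?f > 0" by simp
  let ?\<rho> = "\<lambda>x. inverse (integral (cbox a b) ?f) * ?f x"
  show thesis
  proof (rule that[of ?\<rho>])
    show "?\<rho> \<in> Ck k UNIV" for k by (intro Ck_mult Ck_const box_bump_Ck) simp
    show "?\<rho> x \<ge> 0" for x using pos box_bump_bounds(1)[of 1 a b x] by simp
    show "?\<rho> x \<noteq> 0 \<Longrightarrow> x \<in> cbox (- (\<delta> *\<^sub>R One)) (\<delta> *\<^sub>R One)" for x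
      using box_bump_pos_iff[of 1 a b x] box_subset_cbox[of a b] by (auto simp: a_def b_def)
    show "integral (cbox (- (\<delta> *\<^sub>R One)) (\<delta> *\<^sub>R One)) ?\<rho> = 1"
      using pos by (simp add: a_def b_def)
  qed
qed

text \<open>A weighted mean of values lying within \<open>e\<close> of \<open>L\<close> lies within
  \<open>e\<close> of \<open>L\<close>. Taking \<open>L = 0\<close> gives uniform bounds on
  mollified functions, and \<open>L = v x\<close> gives their pointwise convergence.\<close>

lemma average_close:
  fixes v :: "'a::euclidean_space \<Rightarrow> real"
  assumes v: "continuous_on UNIV v" and \<rho>: "continuous_on UNIV \<rho>" "\<And>x. \<rho> x \<ge> 0"
    and int: "integral (cbox a b) \<rho> = 1"
    and close: "\<And>y. y \<in> cbox a b \<Longrightarrow> \<bar>v (x - y) - L\<bar> \<le> e"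
  shows "\<bar>integral (cbox a b) (\<lambda>y. v (x - y) * \<rho> y) - L\<bar> \<le> e"
proof -
  have c: "continuous_on (cbox a b) \<rho>" "continuous_on (cbox a b) (\<lambda>y. v (x - y))"
    by (auto intro!: continuous_on_subset[OF \<rho>(1)] continuous_on_compose2[OF v] continuous_intros)
  have "integral (cbox a b) (\<lambda>y. v (x - y) * \<rho> y) - L
      = integral (cbox a b) (\<lambda>y. v (x - y) * \<rho> y) - integral (cbox a b) (\<lambda>y. L * \<rho> y)"
    using int by simp
  also have "\<dots> = integral (cbox a b) (\<lambda>y. v (x - y) * \<rho> y - L * \<rho> y)"
    by (intro Henstock_Kurzweil_Integration.integral_diff[symmetric] integrable_continuous continuous_intros c)
  finally have eq: "integral (cbox a b) (\<lambda>y. v (x - y) * \<rho> y) - L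
      = integral (cbox a b) (\<lambda>y. v (x - y) * \<rho> y - L * \<rho> y)" .
  have "norm (integral (cbox a b) (\<lambda>y. v (x - y) * \<rho> y - L * \<rho> y)) \<le> integral (cbox a b) (\<lambda>y. e * \<rho> y)"
  proof (rule integral_norm_bound_integral)
    fix y assume "y \<in> cbox a b"
    then show "norm (v (x - y) * \<rho> y - L * \<rho> y) \<le> e * \<rho> y"
      using close[of y] \<rho>(2)[of y] mult_right_mono[of "\<bar>v (x - y) - L\<bar>" e "\<rho> y"]
      by (simp add: left_diff_distrib[symmetric] abs_mult)
  qed (intro integrable_continuous continuous_intros c)+
  then show ?thesis using int by (simp add: eq)
qed

lemma averages_tendsto:
  fixes v :: "'a::euclidean_space \<Rightarrow> real"
  assumes v: "continuous_on UNIV v" and \<rho>: "\<And>n. continuous_on UNIV (\<rho> n)" "\<And>n x. \<rho> n x \<ge> 0"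
    and int: "\<And>n. integral (cbox (a n) (b n)) (\<rho> n) = 1"
    and small: "\<And>n y. y \<in> cbox (a n) (b n) \<Longrightarrow> norm y \<le> r n" and r: "r \<longlonglongrightarrow> 0"
  shows "(\<lambda>n. integral (cbox (a n) (b n)) (\<lambda>y. v (x - y) * \<rho> n y)) \<longlonglongrightarrow> v x"
proof (rule metric_LIMSEQ_I)
  fix e :: real assume "e > 0"
  have "isCont v x" using v by (simp add: continuous_on_eq_continuous_at)
  then obtain d where d: "d > 0" "\<And>x'. dist x' x < d \<Longrightarrow> dist (v x') (v x) < e / 2"
    using \<open>e > 0\<close> unfolding continuous_at_eps_delta by (metis half_gt_zero)
  obtain N where N: "\<And>n. n \<ge> N \<Longrightarrow> r n < d"
    using order_tendstoD(2)[OF r \<open>d > 0\<close>] by (auto simp: eventually_sequentially)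
  have "dist (integral (cbox (a n) (b n)) (\<lambda>y. v (x - y) * \<rho> n y)) (v x) < e" if "n \<ge> N" for n
  proof -
    have "\<bar>integral (cbox (a n) (b n)) (\<lambda>y. v (x - y) * \<rho> n y) - v x\<bar> \<le> e / 2"
    proof (rule average_close[OF v \<rho> int])
      fix y assume "y \<in> cbox (a n) (b n)"
      then have "dist (x - y) x < d"
        using small[of y n] N[OF that] by (simp add: dist_norm)
      then show "\<bar>v (x - y) - v x\<bar> \<le> e / 2"
        using d(2)[of "x - y"] by (simp add: dist_real_def)
    qed
    then show ?thesis using \<open>e > 0\<close> by (simp add: dist_real_def)
  qed
  then show "\<exists>N. \<forall>n\<ge>N. dist (integral (cbox (a n) (b n)) (\<lambda>y. v (x - y) * \<rho> n y)) (v x) < e"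
    by blast
qed

lemma compact_support_bounded:
  fixes f :: "'a::euclidean_space \<Rightarrow> 'b::real_normed_vector"
  assumes "continuous_on \<Omega> f" "compact K" "K \<subseteq> \<Omega>" "\<And>x. x \<in> \<Omega> \<Longrightarrow> x \<notin> K \<Longrightarrow> f x = 0"
  obtains B where "B \<ge> 0" "\<And>x. x \<in> \<Omega> \<Longrightarrow> norm (f x) \<le> B"
proof -
  obtain B where "\<And>x. x \<in> K \<Longrightarrow> norm (f x) \<le> B"
    using compact_imp_bounded[OF compact_continuous_image[OF continuous_on_subset[OF assms(1,3)] assms(2)]]
    by (auto simp: bounded_iff)
  then have "norm (f x) \<le> max B 0" if "x \<in> \<Omega>" for x
    using assms(4)[OF that] by (cases "x \<in> K") (auto simp: le_max_iff_disj)
  then show thesis using that[of "max B 0"] by auto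
qed

lemma grad_zero_off_support:
  assumes "open \<Omega>" "closed K" "\<And>x. x \<in> \<Omega> \<Longrightarrow> x \<notin> K \<Longrightarrow> u x = 0" "x \<in> \<Omega>" "x \<notin> K"
  shows "grad u x = 0"
proof (rule grad_eqI)
  have "((\<lambda>_. 0) has_derivative (\<lambda>v. v \<bullet> 0)) (at x)" by simp
  then show "(u has_derivative (\<lambda>v. v \<bullet> 0)) (at x)"
    by (rule has_derivative_transform_within_open[where s="\<Omega> - K"]) (use assms in auto)
qed

text \<open>What is extracted from mollification is precisely what dominated convergence asks for:
  pointwise convergence of functions and gradients, one uniform bound, and one compact set carrying
  all supports.\<close>

lemma C1_smooth_approx:
  fixes u :: "'a::euclidean_space \<Rightarrow> real"
  assumes "open \<Omega>" "compact K" "K \<subseteq> \<Omega>" and u: "u \<in> Ck 1 UNIV" "\<And>x. x \<notin> K \<Longrightarrow> u x = 0"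
  obtains \<phi> K' B where "compact K'" "K' \<subseteq> \<Omega>" "\<And>n. \<phi> n \<in> Cc_infty \<Omega>"
    "\<And>n x. x \<notin> K' \<Longrightarrow> \<phi> n x = 0"
    "\<And>n x. \<bar>\<phi> n x\<bar> \<le> B" "\<And>n x. norm (grad (\<phi> n) x) \<le> B"
    "\<And>x. (\<lambda>n. \<phi> n x) \<longlonglongrightarrow> u x" "\<And>x. (\<lambda>n. grad (\<phi> n) x) \<longlonglongrightarrow> grad u x"
proof -
  obtain \<epsilon> where \<epsilon>: "\<epsilon> > 0" "(\<Union>x\<in>K. cball x \<epsilon>) \<subseteq> \<Omega>"
    using compact_subset_open_imp_cball_epsilon_subset[OF assms(2,1,3)] .
  \<comment> \<open>The dimension in the denominator compensates for estimating the Euclidean norm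
    by the sum of the coordinates, so that the cube of half side \<open>\<delta> n\<close> lies in
    the ball of radius \<open>\<epsilon> / (n + 1)\<close>.\<close>
  define \<delta> where "\<delta> n = \<epsilon> * inverse (real (Suc n)) / DIM('a)" for n
  have \<delta>_pos: "\<delta> n > 0" for n using \<epsilon> by (simp add: \<delta>_def)
  define b where "b n = \<delta> n *\<^sub>R (One::'a)" for n
  have small: "norm y \<le> \<epsilon> * inverse (real (Suc n))" if "y \<in> cbox (- b n) (b n)" for y n
  proof -
    have "norm y \<le> (\<Sum>i\<in>Basis. \<bar>y \<bullet> i\<bar>)" by (rule norm_le_l1)
    also have "\<dots> \<le> (\<Sum>i\<in>(Basis::'a set). \<delta> n)"
      using that by (intro sum_mono) (auto simp: b_def mem_box abs_le_iff)
    finally show ?thesis by (simp add: \<delta>_def)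
  qed
  have "\<exists>\<rho>. (\<forall>k. \<rho> \<in> Ck k UNIV) \<and> (\<forall>x. \<rho> x \<ge> 0) \<and> (\<forall>x. \<rho> x \<noteq> 0 \<longrightarrow> x \<in> cbox (- b n) (b n)) \<and>
      integral (cbox (- b n) (b n)) \<rho> = 1" for n
    using mollifier_exists[OF \<delta>_pos[of n], where 'a='a] unfolding b_def by metis
  then obtain \<rho> where \<rho>: "\<And>n k. \<rho> n \<in> Ck k UNIV" "\<And>n x. \<rho> n x \<ge> 0"
      "\<And>n x. \<rho> n x \<noteq> 0 \<Longrightarrow> x \<in> cbox (- b n) (b n)" "\<And>n. integral (cbox (- b n) (b n)) (\<rho> n) = 1"
    by metis
  have \<rho>_cont: "continuous_on UNIV (\<rho> n)" for n
    by (rule Ck_continuous_on[OF \<rho>(1)[of n 0]])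
  obtain c where c: "K \<subseteq> cbox (-c) c"
    using bounded_subset_cbox_symmetric[OF compact_imp_bounded[OF assms(2)]] .
  have u_cont: "continuous_on UNIV u" by (rule Ck1D(3)[OF u(1)])
  define \<phi> where "\<phi> n x = integral (cbox (- b n) (b n)) (\<lambda>y. u (x - y) * \<rho> n y)" for n x
  \<comment> \<open>Both forms of the convolution are used: here the derivatives fall on the
    mollifier, which gives smoothness; in the form of \<open>\<phi>_def\<close> they fall on
    \<open>u\<close>, which gives bounds and convergence of the gradient.\<close>
  have \<phi>_eq: "\<phi> n = (\<lambda>x. integral (cbox (-c) c) (\<lambda>z. \<rho> n (x - z) * u z))" for n
    unfolding \<phi>_def
    by (intro ext convolution_commute[symmetric] \<rho>_cont \<rho>(3) u_cont) (use u(2) c in blast)+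
  have \<phi>_smooth: "\<phi> n \<in> Ck k UNIV" for n k
    unfolding \<phi>_eq by (intro convolution_Ck \<rho> continuous_on_subset[OF u_cont]) auto
  \<comment> \<open>The closed \<open>\<epsilon>\<close>-neighbourhood of \<open>K\<close> contains
    the support of every \<open>\<phi> n\<close>, because all mollifiers live in the ball of radius
    \<open>\<epsilon>\<close>.\<close>
  define K' where "K' = {x + y |x y. x \<in> K \<and> y \<in> cball 0 \<epsilon>}"
  have K': "compact K'" unfolding K'_def by (intro compact_sums assms compact_cball)
  have K'_sub: "K' \<subseteq> \<Omega>"
  proof
    fix z assume "z \<in> K'"
    then obtain x y where "x \<in> K" "norm y \<le> \<epsilon>" "z = x + y" by (auto simp: K'_def)
    moreover from this have "x + y \<in> cball x \<epsilon>" by (simp add: dist_norm)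
    ultimately show "z \<in> \<Omega>" using \<epsilon>(2) by blast
  qed
  have \<phi>_supp: "\<phi> n x = 0" if "x \<notin> K'" for n x
  proof -
    have "u (x - y) * \<rho> n y = 0" for y
    proof (cases "\<rho> n y = 0")
      case False
      then have "norm y \<le> \<epsilon> * inverse (real (Suc n))" using small \<rho>(3) by blast
      also have "\<dots> \<le> \<epsilon> * 1" using \<epsilon>(1) by (intro mult_left_mono) (auto simp: field_simps)
      finally have "y \<in> cball 0 \<epsilon>" by simp
      then have "x - y \<notin> K" using that unfolding K'_def by force
      then show ?thesis using u(2) by simp
    qed simp
    then show ?thesis by (simp only: \<phi>_def integral_0)
  qed
  have \<phi>_der: "frechet_derivative (\<phi> n) (at x) i =
      integral (cbox (- b n) (b n)) (\<lambda>y. frechet_derivative u (at (x - y)) i * \<rho> n y)" for n x i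
  proof -
    have "(\<phi> n has_derivative (\<lambda>v. integral (cbox (- b n) (b n))
        (\<lambda>y. frechet_derivative u (at (x - y)) v * \<rho> n y))) (at x)"
      unfolding \<phi>_def[abs_def]
      by (rule convolution_has_derivative[OF u(1) continuous_on_subset[OF \<rho>_cont subset_UNIV]])
    from fun_cong[OF frechet_derivative_at[OF this], of i] show ?thesis by simp
  qed
  obtain B0 where B0: "B0 \<ge> 0" "\<And>x. norm (u x) \<le> B0"
    using compact_support_bounded[OF u_cont assms(2) subset_UNIV u(2)] by auto
  have du_cont: "continuous_on UNIV (\<lambda>x. frechet_derivative u (at x) i)" if "i \<in> Basis" for i
    using Ck1D(4)[OF u(1) that] .
  have "\<exists>B\<ge>0. \<forall>x. norm (frechet_derivative u (at x) i) \<le> B" if "i \<in> Basis" for i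
  proof -
    have "frechet_derivative u (at x) i = 0" if "x \<notin> K" for x
      using grad_zero_off_support[OF open_UNIV compact_imp_closed[OF assms(2)] u(2) _ that]
        grad_inner[OF Ck1D(1)[OF u(1)] \<open>i \<in> Basis\<close>, of x] by simp
    from compact_support_bounded[OF du_cont[OF that] assms(2) subset_UNIV this]
    show ?thesis by auto
  qed
  then obtain B1 where B1: "\<And>i. i \<in> Basis \<Longrightarrow> B1 i \<ge> 0"
      "\<And>i x. i \<in> Basis \<Longrightarrow> norm (frechet_derivative u (at x) i) \<le> B1 i"
    by metis
  have \<phi>_diff: "\<phi> n differentiable (at x)" for n x
    using Ck1D(1)[OF \<phi>_smooth] by simp
  have u_diff: "u differentiable (at x)" for x
    using Ck1D(1)[OF u(1)] by simp
  have r: "(\<lambda>n. \<epsilon> * inverse (real (Suc n))) \<longlonglongrightarrow> 0"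
    using tendsto_mult[OF tendsto_const[of \<epsilon>] LIMSEQ_inverse_real_of_nat] by simp
  have bd0: "\<bar>\<phi> n x\<bar> \<le> B0" for n x
    using average_close[OF u_cont \<rho>_cont[of n] \<rho>(2) \<rho>(4), of x 0 B0] B0(2) by (simp add: \<phi>_def)
  have bd1: "norm (grad (\<phi> n) x) \<le> (\<Sum>i\<in>Basis. B1 i)" for n x
  proof -
    have "norm (grad (\<phi> n) x) \<le> (\<Sum>i\<in>Basis. \<bar>grad (\<phi> n) x \<bullet> i\<bar>)" by (rule norm_le_l1)
    also have "\<dots> \<le> (\<Sum>i\<in>Basis. B1 i)"
    proof (rule sum_mono)
      fix i :: 'a assume i: "i \<in> Basis"
      show "\<bar>grad (\<phi> n) x \<bullet> i\<bar> \<le> B1 i"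
        using average_close[OF du_cont[OF i] \<rho>_cont[of n] \<rho>(2) \<rho>(4), of x 0 "B1 i"] B1(2)[OF i]
        by (simp add: grad_inner[OF \<phi>_diff i] \<phi>_der)
    qed
    finally show ?thesis .
  qed
  show thesis
  proof (rule that[of K' \<phi> "max B0 (\<Sum>i\<in>Basis. B1 i)"])
    show "\<phi> n \<in> Cc_infty \<Omega>" for n
      by (rule Cc_inftyI[OF \<phi>_smooth K' K'_sub]) (use \<phi>_supp in blast)
    show "(\<lambda>n. \<phi> n x) \<longlonglongrightarrow> u x" for x
      unfolding \<phi>_def by (rule averages_tendsto[OF u_cont \<rho>_cont \<rho>(2) \<rho>(4) small r])
    show "(\<lambda>n. grad (\<phi> n) x) \<longlonglongrightarrow> grad u x" for x
    proof (rule tendsto_componentwise_iff[THEN iffD2], rule ballI)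
      fix i :: 'a assume i: "i \<in> Basis"
      show "(\<lambda>n. grad (\<phi> n) x \<bullet> i) \<longlonglongrightarrow> grad u x \<bullet> i"
        unfolding grad_inner[OF \<phi>_diff i] grad_inner[OF u_diff i] \<phi>_der
        by (rule averages_tendsto[OF du_cont[OF i] \<rho>_cont \<rho>(2) \<rho>(4) small r])
    qed
  qed (use K' K'_sub \<phi>_supp bd0 bd1 in \<open>auto simp: le_max_iff_disj\<close>)
qed

section \<open>Measures with densities\<close>

definition dens ::
    "'a::euclidean_space set \<Rightarrow> 'a measure \<Rightarrow> ('a \<Rightarrow> 'b::euclidean_space) \<Rightarrow> 'a set \<Rightarrow> 'b" where
  "dens \<Omega> \<tau> f A = (if A \<in> Bor \<Omega> then LINT x:A|\<tau>. f x else 0)"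

lemma space_eq_of_sets_Bor: "sets \<tau> = Bor \<Omega> \<Longrightarrow> space \<tau> = \<Omega>"
  by (drule sets_eq_imp_space_eq) (simp add: space_restrict_space)

lemma Bor_iff: "open \<Omega> \<Longrightarrow> A \<in> Bor \<Omega> \<longleftrightarrow> A \<in> sets borel \<and> A \<subseteq> \<Omega>"
  by (subst sets_restrict_space_iff) auto

lemma Bor_top [simp]: "\<Omega> \<in> Bor \<Omega>"
  using sets.top[of "restrict_space borel \<Omega>"] by (simp add: space_restrict_space)

lemma Bor_subset: "A \<in> Bor \<Omega> \<Longrightarrow> A \<subseteq> \<Omega>"
  using sets.sets_into_space[of A "restrict_space borel \<Omega>"] by (simp add: space_restrict_space)

lemma measurable_of_continuous_on:
  assumes "sets \<tau> = Bor \<Omega>" "continuous_on \<Omega> f"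
  shows "f \<in> borel_measurable \<tau>"
  using borel_measurable_continuous_on_restrict[OF assms(2)]
  by (simp add: measurable_cong_sets[OF assms(1) refl])

lemma bmeas_sums:
  "\<mu> \<in> bmeas \<Omega> \<Longrightarrow> range A \<subseteq> Bor \<Omega> \<Longrightarrow> disjoint_family A \<Longrightarrow> (\<lambda>i::nat. \<mu> (A i)) sums \<mu> (\<Union>i. A i)"
  by (simp add: bmeas_def)

lemma bmeas_off: "\<mu> \<in> bmeas \<Omega> \<Longrightarrow> B \<notin> Bor \<Omega> \<Longrightarrow> \<mu> B = 0"
  by (simp add: bmeas_def)

text \<open>Countable additivity on a constant sequence of empty sets makes the constant
  \<open>\<mu> {}\<close> summable, hence zero.\<close>

lemma bmeas_empty: assumes "\<mu> \<in> bmeas \<Omega>" shows "\<mu> {} = 0"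
proof -
  have "(\<lambda>i::nat. \<mu> {}) sums \<mu> (\<Union>i::nat. {})"
    by (rule bmeas_sums[OF assms]) (auto simp: disjoint_family_on_def)
  then have "(\<lambda>i::nat. \<mu> {}) \<longlonglongrightarrow> 0"
    by (intro summable_LIMSEQ_zero sums_summable)
  then show ?thesis by (simp add: LIMSEQ_const_iff)
qed

lemma bmeas_Un:
  assumes "\<mu> \<in> bmeas \<Omega>" "A \<in> Bor \<Omega>" "B \<in> Bor \<Omega>" "A \<inter> B = {}"
  shows "\<mu> (A \<union> B) = \<mu> A + \<mu> B"
proof -
  have "(\<lambda>i. \<mu> (binaryset A B i)) sums \<mu> (\<Union>i. binaryset A B i)"
    by (rule bmeas_sums[OF assms(1)])
      (use assms in \<open>auto simp: binaryset_def disjoint_family_on_def\<close>)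
  moreover have "(\<lambda>i. \<mu> (binaryset A B i)) sums (\<mu> A + \<mu> B)"
    by (rule binaryset_sums) (rule bmeas_empty[OF assms(1)])
  ultimately show ?thesis
    by (simp add: UN_binaryset_eq sums_iff)
qed

lemma bmeas_Diff:
  assumes "\<mu> \<in> bmeas \<Omega>" "A \<in> Bor \<Omega>" "B \<in> Bor \<Omega>" "B \<subseteq> A"
  shows "\<mu> (A - B) = \<mu> A - \<mu> B"
  using bmeas_Un[OF assms(1) assms(3), of "A - B"] assms
  by (simp add: Un_absorb1 sets.Diff)

lemma bmeas_scaleR_add:
  assumes "\<mu> \<in> bmeas \<Omega>" "\<nu> \<in> bmeas \<Omega>"
  shows "(\<lambda>A. c *\<^sub>R \<mu> A + d *\<^sub>R \<nu> A) \<in> bmeas \<Omega>"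
  using assms unfolding bmeas_def by (auto intro!: sums_add sums_scaleR_right)

lemma bmeas_inner:
  assumes "\<mu> \<in> bmeas \<Omega>"
  shows "(\<lambda>A. \<mu> A \<bullet> i) \<in> bmeas \<Omega>"
  using assms unfolding bmeas_def
  by (auto intro!: bounded_linear.sums[OF bounded_linear_inner_left])

text \<open>Finite additivity of the integral, together with its continuity along increasing unions,
  gives convergence of the partial sums.\<close>

lemma dens_bmeas:
  fixes f :: "'a::euclidean_space \<Rightarrow> 'b::euclidean_space"
  assumes s: "sets \<tau> = Bor \<Omega>" and f: "integrable \<tau> f"
  shows "dens \<Omega> \<tau> f \<in> bmeas \<Omega>"
proof -
  have "(\<lambda>i. dens \<Omega> \<tau> f (A i)) sums dens \<Omega> \<tau> f (\<Union>i. A i)"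
    if A: "range A \<subseteq> Bor \<Omega>" "disjoint_family A" for A :: "nat \<Rightarrow> 'a set"
  proof -
    have A': "A i \<in> sets \<tau>" "A i \<in> Bor \<Omega>" for i using A s by auto
    have U: "(\<Union>i. A i) \<in> Bor \<Omega>" using A by (intro sets.countable_UN) auto
    have "incseq (\<lambda>n. \<Union>i<n. A i)"
      by (intro monoI UN_mono) auto
    then have "(\<lambda>n. LINT x:(\<Union>i<n. A i)|\<tau>. f x) \<longlonglongrightarrow> (LINT x:(\<Union>n. \<Union>i<n. A i)|\<tau>. f x)"
      by (rule set_integral_cont_up[rotated])
        (use A' U s f in \<open>auto simp: set_integrable_def intro!: integrable_mult_indicator sets.countable_UN sets.finite_UN\<close>)
    moreover have "(LINT x:(\<Union>i<n. A i)|\<tau>. f x) = (\<Sum>i<n. LINT x:A i|\<tau>. f x)" for n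
    proof (rule set_integral_finite_Union)
      show "disjoint_family_on A {..<n}" using A(2) by (rule disjoint_family_on_mono[rotated]) simp
      show "set_integrable \<tau> (A i) f" for i
        unfolding set_integrable_def by (rule integrable_mult_indicator[OF A'(1) f])
    qed (use A' in auto)
    moreover have "(\<Union>n. \<Union>i<n. A i) = (\<Union>i. A i)" by auto
    ultimately show ?thesis
      using U A' by (simp add: dens_def sums_def)
  qed
  then show ?thesis by (auto simp: bmeas_def dens_def)
qed

lemma dens_inner:
  assumes s: "sets \<tau> = Bor \<Omega>" and f: "integrable \<tau> f"
  shows "dens \<Omega> \<tau> f A \<bullet> i = dens \<Omega> \<tau> (\<lambda>x. f x \<bullet> i) A"
  using integral_inner_left[OF integrable_mult_indicator[of A \<tau> f], of i] assms
  by (auto simp: dens_def set_lebesgue_integral_def)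

lemma dens_uminus: "- dens \<Omega> \<tau> f A = dens \<Omega> \<tau> (\<lambda>x. - f x) A"
  by (auto simp: dens_def set_lebesgue_integral_def)

lemma dens_diff:
  assumes s: "sets \<tau> = Bor \<Omega>" and "integrable \<tau> f" "integrable \<tau> h"
  shows "dens \<Omega> \<tau> f A - dens \<Omega> \<tau> h A = dens \<Omega> \<tau> (\<lambda>x. f x - h x) A"
  using assms by (auto simp: dens_def set_integral_diff set_integrable_def integrable_mult_indicator)

section \<open>Integration against signed and vector measures with a density\<close>

text \<open>The set where \<open>f > 0\<close> gives an explicit Hahn decomposition, so the positive
  part of \<open>f \<tau>\<close> has density equal to the positive part of \<open>f\<close>. The
  conversion \<open>ennreal\<close> takes this positive part by sending negative values to
  0.\<close>

lemma pos_variation_dens: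
  fixes f :: "'a::euclidean_space \<Rightarrow> real"
  assumes s: "sets \<tau> = Bor \<Omega>" and f: "integrable \<tau> f"
  shows "pos_variation \<Omega> (dens \<Omega> \<tau> f) = density \<tau> (\<lambda>x. ennreal (f x))"
proof -
  have [measurable]: "f \<in> borel_measurable \<tau>" using f by simp
  have *: "(SUP B\<in>{B \<in> Bor \<Omega>. B \<subseteq> A}. ennreal (dens \<Omega> \<tau> f B)) = emeasure (density \<tau> (\<lambda>x. ennreal (f x))) A"
    if A: "A \<in> Bor \<Omega>" for A
  proof -
    let ?N = "\<integral>\<^sup>+x. ennreal (f x) * indicator A x \<partial>\<tau>"
    let ?S = "SUP B\<in>{B \<in> Bor \<Omega>. B \<subseteq> A}. ennreal (dens \<Omega> \<tau> f B)"
    have As: "A \<in> sets \<tau>" using A s by simp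
    have em: "emeasure (density \<tau> (\<lambda>x. ennreal (f x))) A = (\<integral>\<^sup>+x. ennreal (f x) * indicator A x \<partial>\<tau>)"
      using As by (intro emeasure_density) auto
    show ?thesis unfolding em
    proof (rule antisym)
      show "?S \<le> ?N"
      proof (rule SUP_least, clarify)
        fix B assume B: "B \<in> Bor \<Omega>" "B \<subseteq> A"
        have i: "integrable \<tau> (\<lambda>x. max 0 (indicator B x * f x))"
          using integrable_max[OF integrable_zero integrable_mult_indicator[of B \<tau> f]] B s f by simp
        have "dens \<Omega> \<tau> f B \<le> (\<integral>x. max 0 (indicator B x * f x) \<partial>\<tau>)"
          using B s f integrable_mult_indicator[of B \<tau> f] i unfolding dens_def set_lebesgue_integral_def
          by (auto intro!: integral_mono)
        then have "ennreal (dens \<Omega> \<tau> f B) \<le> ennreal (\<integral>x. max 0 (indicator B x * f x) \<partial>\<tau>)"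
          by (rule ennreal_leI)
        also have "\<dots> = (\<integral>\<^sup>+x. ennreal (max 0 (indicator B x * f x)) \<partial>\<tau>)"
          by (rule nn_integral_eq_integral[symmetric, OF i]) auto
        also have "\<dots> \<le> ?N"
          using B(2) by (intro nn_integral_mono) (auto simp: indicator_def max_def)
        finally show "ennreal (dens \<Omega> \<tau> f B) \<le> ?N" .
      qed
    next
      \<comment> \<open>On this subset of \<open>A\<close> the supremum defining the positive
        variation is attained.\<close>
      define B where "B = {x \<in> space \<tau>. f x > 0} \<inter> A"
      have Bs: "B \<in> sets \<tau>" unfolding B_def using As by measurable
      have i: "integrable \<tau> (\<lambda>x. indicator B x * f x)"
        using integrable_mult_indicator[OF Bs f] by simp
      have "?N = (\<integral>\<^sup>+x. ennreal (indicator B x * f x) \<partial>\<tau>)"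
        by (rule nn_integral_cong) (auto simp: B_def indicator_def ennreal_neg)
      also have "\<dots> = ennreal (\<integral>x. indicator B x * f x \<partial>\<tau>)"
        by (rule nn_integral_eq_integral[OF i]) (auto simp: B_def indicator_def)
      also have "\<dots> = ennreal (dens \<Omega> \<tau> f B)"
        using Bs s by (simp add: dens_def set_lebesgue_integral_def)
      also have "\<dots> \<le> ?S"
        using Bs s by (intro SUP_upper) (auto simp: B_def)
      finally show "?N \<le> ?S" .
    qed
  qed
  let ?D = "density \<tau> (\<lambda>x. ennreal (f x))"
  have sp: "space ?D = \<Omega>" "sets ?D = Bor \<Omega>" using s space_eq_of_sets_Bor[OF s] by auto
  have "sigma_sets \<Omega> (Bor \<Omega>) = Bor \<Omega>"
    using sets.sigma_sets_eq[of ?D] sp by simp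
  then have "measure_of \<Omega> (Bor \<Omega>) (\<lambda>A. SUP B\<in>{B \<in> Bor \<Omega>. B \<subseteq> A}. ennreal (dens \<Omega> \<tau> f B))
      = measure_of \<Omega> (Bor \<Omega>) (emeasure ?D)"
    using Bor_subset[of _ \<Omega>] * by (intro measure_of_eq) auto
  also have "\<dots> = ?D"
    using measure_of_of_measure[of ?D] sp by simp
  finally show ?thesis unfolding pos_variation_def .
qed

text \<open>The Jordan parts of \<open>f \<tau>\<close> are the measures with the positive parts of
  \<open>f\<close> and \<open>- f\<close> as densities. Integrability of \<open>\<phi> * f\<close>
  makes both integrals genuine, so their difference recombines pointwise.\<close>

lemma signed_integral_dens:
  fixes f :: "'a::euclidean_space \<Rightarrow> real"
  assumes s: "sets \<tau> = Bor \<Omega>" and f: "integrable \<tau> f"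
    and \<phi>: "\<phi> \<in> borel_measurable \<tau>" and i: "integrable \<tau> (\<lambda>x. \<phi> x * f x)"
  shows "signed_integral \<Omega> (dens \<Omega> \<tau> f) \<phi> = (\<integral>x. \<phi> x * f x \<partial>\<tau>)"
proof -
  have [measurable]: "f \<in> borel_measurable \<tau>" "\<phi> \<in> borel_measurable \<tau>" using f \<phi> by auto
  have pv: "(\<integral>x. \<phi> x \<partial>pos_variation \<Omega> (dens \<Omega> \<tau> h)) = (\<integral>x. max 0 (h x) * \<phi> x \<partial>\<tau>)"
    if h: "integrable \<tau> h" for h :: "'a \<Rightarrow> real"
  proof -
    have [measurable]: "h \<in> borel_measurable \<tau>" using h by simp
    have "density \<tau> (\<lambda>x. ennreal (h x)) = density \<tau> (\<lambda>x. ennreal (max 0 (h x)))"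
      by (rule arg_cong[where f="density \<tau>"]) (auto simp: max_def ennreal_neg)
    then show ?thesis
      unfolding pos_variation_dens[OF s h]
      by (simp, subst integral_density) auto
  qed
  have part: "norm (max 0 t * p) \<le> norm (p * t)" for t p :: real
    unfolding norm_mult mult.commute[of "norm p"] by (rule mult_right_mono) auto
  have ip: "integrable \<tau> (\<lambda>x. max 0 (f x) * \<phi> x)"
    by (rule Bochner_Integration.integrable_bound[OF i _ AE_I2[OF part]]) simp
  have im: "integrable \<tau> (\<lambda>x. max 0 (- f x) * \<phi> x)"
    using part[of "- f _" "\<phi> _"]
    by (intro Bochner_Integration.integrable_bound[OF i] AE_I2) auto
  have "signed_integral \<Omega> (dens \<Omega> \<tau> f) \<phi>
      = (\<integral>x. max 0 (f x) * \<phi> x \<partial>\<tau>) - (\<integral>x. max 0 (- f x) * \<phi> x \<partial>\<tau>)"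
    unfolding signed_integral_def dens_uminus using f by (simp add: pv)
  also have "\<dots> = (\<integral>x. max 0 (f x) * \<phi> x - max 0 (- f x) * \<phi> x \<partial>\<tau>)"
    using ip im by simp
  also have "\<dots> = (\<integral>x. \<phi> x * f x \<partial>\<tau>)"
    by (rule Bochner_Integration.integral_cong) (auto simp: max_def)
  finally show ?thesis .
qed

lemma integrable_bounded_mult:
  fixes f :: "'a \<Rightarrow> real" and \<phi> :: "'a \<Rightarrow> real"
  assumes "integrable M f" "\<phi> \<in> borel_measurable M" "\<And>x. x \<in> space M \<Longrightarrow> \<bar>\<phi> x\<bar> \<le> B"
  shows "integrable M (\<lambda>x. \<phi> x * f x)"
proof (rule Bochner_Integration.integrable_bound)
  show "integrable M (\<lambda>x. B * f x)" using assms by simp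
  show "AE x in M. norm (\<phi> x * f x) \<le> norm (B * f x)"
  proof (rule AE_I2)
    fix x assume "x \<in> space M"
    then have "\<bar>\<phi> x\<bar> \<le> \<bar>B\<bar>" using assms(3)[of x] by simp
    then show "norm (\<phi> x * f x) \<le> norm (B * f x)" by (simp add: abs_mult mult_right_mono)
  qed
qed (use assms in auto)

lemma integrable_bounded_inner:
  fixes f \<Phi> :: "'a \<Rightarrow> 'b::euclidean_space"
  assumes "integrable M f" "\<Phi> \<in> borel_measurable M" "\<And>x. x \<in> space M \<Longrightarrow> norm (\<Phi> x) \<le> B"
  shows "integrable M (\<lambda>x. \<Phi> x \<bullet> f x)"
proof (rule Bochner_Integration.integrable_bound)
  show "integrable M (\<lambda>x. B * norm (f x))" using assms by simp
  show "AE x in M. norm (\<Phi> x \<bullet> f x) \<le> norm (B * norm (f x))"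
  proof (rule AE_I2)
    fix x assume "x \<in> space M"
    then have "norm (\<Phi> x) \<le> \<bar>B\<bar>" using assms(3)[of x] by simp
    then show "norm (\<Phi> x \<bullet> f x) \<le> norm (B * norm (f x))"
      using order_trans[OF Cauchy_Schwarz_ineq2 mult_right_mono[of "norm (\<Phi> x)" "\<bar>B\<bar>" "norm (f x)"]]
      by (simp add: abs_mult)
  qed
qed (use assms in auto)

lemma vector_integral_dens:
  fixes m :: "'a::euclidean_space \<Rightarrow> 'a"
  assumes s: "sets \<tau> = Bor \<Omega>" and m: "integrable \<tau> m"
    and \<Phi>: "\<Phi> \<in> borel_measurable \<tau>" "\<And>x. x \<in> \<Omega> \<Longrightarrow> norm (\<Phi> x) \<le> B"
  shows "vector_integral \<Omega> (dens \<Omega> \<tau> m) \<Phi> = (\<integral>x. \<Phi> x \<bullet> m x \<partial>\<tau>)"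
proof -
  have i: "integrable \<tau> (\<lambda>x. (\<Phi> x \<bullet> i) * (m x \<bullet> i))" if "i \<in> Basis" for i
  proof (rule integrable_bounded_mult)
    fix x assume "x \<in> space \<tau>"
    then show "\<bar>\<Phi> x \<bullet> i\<bar> \<le> B"
      using \<Phi>(2)[of x] Basis_le_norm[OF that, of "\<Phi> x"] space_eq_of_sets_Bor[OF s] by simp
  qed (use m \<Phi> in auto)
  have "vector_integral \<Omega> (dens \<Omega> \<tau> m) \<Phi> = (\<Sum>i\<in>Basis. \<integral>x. (\<Phi> x \<bullet> i) * (m x \<bullet> i) \<partial>\<tau>)"
    unfolding vector_integral_def dens_inner[OF s m]
    using m \<Phi> i by (intro sum.cong refl signed_integral_dens[OF s]) auto
  also have "\<dots> = (\<integral>x. \<Phi> x \<bullet> m x \<partial>\<tau>)"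
    unfolding euclidean_inner[of "\<Phi> _" "m _"]
    by (rule Bochner_Integration.integral_sum[symmetric]) (rule i)
  finally show ?thesis .
qed

section \<open>Radon-Nikodym densities of dominated set functions\<close>

lemma bmeas_nonneg_measure:
  fixes \<nu> :: "'a::euclidean_space set \<Rightarrow> real"
  assumes \<nu>: "\<nu> \<in> bmeas \<Omega>" and nonneg: "\<And>A. A \<in> Bor \<Omega> \<Longrightarrow> \<nu> A \<ge> 0"
  obtains \<tau> where "sets \<tau> = Bor \<Omega>" "finite_measure \<tau>" "\<And>A. A \<in> Bor \<Omega> \<Longrightarrow> measure \<tau> A = \<nu> A"
    "\<And>A. A \<in> Bor \<Omega> \<Longrightarrow> emeasure \<tau> A = ennreal (\<nu> A)"
proof -
  let ?B = "restrict_space borel \<Omega>"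
  define \<tau> where "\<tau> = measure_of (space ?B) (sets ?B) (\<lambda>A. ennreal (\<nu> A))"
  have s: "sets \<tau> = Bor \<Omega>" unfolding \<tau>_def by simp
  have em: "emeasure \<tau> A = ennreal (\<nu> A)" if A: "A \<in> Bor \<Omega>" for A
    unfolding \<tau>_def
  proof (rule emeasure_measure_of_sigma[OF sets.sigma_algebra_axioms _ _ A])
    show "positive (sets ?B) (\<lambda>A. ennreal (\<nu> A))"
      using bmeas_empty[OF \<nu>] by (simp add: positive_def)
    show "countably_additive (sets ?B) (\<lambda>A. ennreal (\<nu> A))"
    proof (rule countably_additiveI)
      fix A :: "nat \<Rightarrow> 'a set" assume A: "range A \<subseteq> Bor \<Omega>" "disjoint_family A" "(\<Union>i. A i) \<in> Bor \<Omega>"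
      have "(\<lambda>i. \<nu> (A i)) sums \<nu> (\<Union>i. A i)" by (rule bmeas_sums[OF \<nu> A(1,2)])
      moreover have "\<nu> (A i) \<ge> 0" for i using A nonneg by auto
      ultimately show "(\<Sum>i. ennreal (\<nu> (A i))) = ennreal (\<nu> (\<Union>i. A i))"
        by (intro suminf_ennreal_eq)
    qed
  qed
  show thesis
  proof (rule that[OF s])
    show "finite_measure \<tau>"
      by (rule finite_measureI) (simp add: space_eq_of_sets_Bor[OF s] em)
  qed (use em nonneg in \<open>auto simp: measure_def\<close>)
qed

lemma measure_bmeas:
  assumes s: "sets \<alpha> = Bor \<Omega>" and fin: "finite_measure \<alpha>"
  shows "measure \<alpha> \<in> bmeas \<Omega>"
  unfolding bmeas_def mem_Collect_eq s[symmetric]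
  by (intro conjI allI impI finite_measure.finite_measure_UNION[OF fin] measure_notin_sets)

text \<open>The domination makes \<open>\<nu> + \<alpha>\<close> non-negative and absolutely
  continuous, so the Radon-Nikodym theorem for positive measures applies to it, and a signed version
  is obtained by subtraction.\<close>

lemma dominated_dens:
  fixes \<nu> :: "'a::euclidean_space set \<Rightarrow> real"
  assumes \<nu>: "\<nu> \<in> bmeas \<Omega>" and s: "sets \<alpha> = Bor \<Omega>" and fin: "finite_measure \<alpha>"
    and dom: "\<And>A. A \<in> Bor \<Omega> \<Longrightarrow> \<bar>\<nu> A\<bar> \<le> measure \<alpha> A"
  obtains f where "integrable \<alpha> f" "\<nu> = dens \<Omega> \<alpha> f"
proof -
  interpret finite_measure \<alpha> by (rule fin)
  have "(\<lambda>A. 1 *\<^sub>R \<nu> A + 1 *\<^sub>R measure \<alpha> A) \<in> bmeas \<Omega>"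
    by (rule bmeas_scaleR_add[OF \<nu> measure_bmeas[OF s fin]])
  then have sum: "(\<lambda>A. \<nu> A + measure \<alpha> A) \<in> bmeas \<Omega>" by simp
  have sum_nonneg: "\<nu> A + measure \<alpha> A \<ge> 0" if "A \<in> Bor \<Omega>" for A
    using dom[OF that] by linarith
  obtain \<rho> where \<rho>: "sets \<rho> = Bor \<Omega>" "finite_measure \<rho>"
      "\<And>A. A \<in> Bor \<Omega> \<Longrightarrow> measure \<rho> A = \<nu> A + measure \<alpha> A"
      "\<And>A. A \<in> Bor \<Omega> \<Longrightarrow> emeasure \<rho> A = ennreal (\<nu> A + measure \<alpha> A)"
    by (rule bmeas_nonneg_measure[OF sum sum_nonneg]) (assumption | rule that)+
  have "absolutely_continuous \<alpha> \<rho>"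
    unfolding absolutely_continuous_def
  proof
    fix A assume "A \<in> null_sets \<alpha>"
    then show "A \<in> null_sets \<rho>"
      using dom[of A] s \<rho> by (auto simp: null_sets_def measure_def)
  qed
  then obtain h where h: "h \<in> borel_measurable \<alpha>" "density \<alpha> h = \<rho>"
    using Radon_Nikodym \<rho>(1) s by metis
  define f where "f x = enn2real (h x)" for x
  have fm[measurable]: "f \<in> borel_measurable \<alpha>" unfolding f_def using h(1) by measurable
  have nn: "(\<integral>\<^sup>+x. h x \<partial>\<alpha>) < \<infinity>"
  proof -
    have "(\<integral>\<^sup>+x. h x \<partial>\<alpha>) = emeasure \<rho> (space \<alpha>)"
      using h(1) by (subst h(2)[symmetric], subst emeasure_density) (auto intro!: nn_integral_cong)
    also have "\<dots> < \<infinity>"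
      using finite_measure.emeasure_finite[OF \<rho>(2)] by (simp add: top.not_eq_extremum)
    finally show ?thesis .
  qed
  then have hfin: "AE x in \<alpha>. h x = ennreal (f x)"
    using nn_integral_PInf_AE[OF h(1)] unfolding f_def by (auto simp: less_top)
  have fi: "integrable \<alpha> f"
  proof (rule integrableI_bounded[OF fm])
    have "(\<integral>\<^sup>+x. ennreal (norm (f x)) \<partial>\<alpha>) = (\<integral>\<^sup>+x. h x \<partial>\<alpha>)"
      by (rule nn_integral_cong_AE) (use hfin in \<open>auto simp: f_def\<close>)
    then show "(\<integral>\<^sup>+x. ennreal (norm (f x)) \<partial>\<alpha>) < \<infinity>" using nn by simp
  qed
  have f_meas: "(LINT x:A|\<alpha>. f x) = measure \<rho> A" if A: "A \<in> Bor \<Omega>" for A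
  proof -
    have As: "A \<in> sets \<alpha>" using A s by simp
    have "emeasure \<rho> A = (\<integral>\<^sup>+x. ennreal (indicator A x * f x) \<partial>\<alpha>)"
      using As h(1) hfin
      by (subst h(2)[symmetric], subst emeasure_density)
        (auto intro!: nn_integral_cong_AE simp: indicator_def)
    also have "\<dots> = ennreal (LINT x:A|\<alpha>. f x)"
      using integrable_mult_indicator[OF As fi] unfolding set_lebesgue_integral_def
      by (subst nn_integral_eq_integral[symmetric]) (auto simp: f_def)
    finally show ?thesis
      by (simp add: measure_def set_lebesgue_integral_def f_def)
  qed
  \<comment> \<open>Here \<open>f\<close> is the density of \<open>\<nu> + \<alpha>\<close>, and the
    subtracted 1 is the density of \<open>\<alpha>\<close> with respect to itself.\<close>
  have "\<nu> = dens \<Omega> \<alpha> (\<lambda>x. f x - 1)"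
  proof
    fix A
    show "\<nu> A = dens \<Omega> \<alpha> (\<lambda>x. f x - 1) A"
    proof (cases "A \<in> Bor \<Omega>")
      case True
      then have As: "A \<in> sets \<alpha>" using s by simp
      have "(LINT x:A|\<alpha>. f x - 1) = (LINT x:A|\<alpha>. f x) - (LINT x:A|\<alpha>. 1)"
        using integrable_mult_indicator[OF As fi] integrable_mult_indicator[OF As integrable_const[of "1::real"]]
        by (intro set_integral_diff) (auto simp: set_integrable_def)
      also have "\<dots> = \<nu> A"
        using \<rho>(3)[OF True] f_meas[OF True] As by (simp add: set_lebesgue_integral_def)
      finally show ?thesis using True by (simp add: dens_def)
    qed (use bmeas_off[OF \<nu>] in \<open>simp add: dens_def\<close>)
  qed
  then show thesis by (rule that[rotated]) (use fi in simp)
qed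

text \<open>The density is assembled from its coordinates, but coordinatewise bounds would not give
  the sharp Euclidean bound 1. That bound comes from averaging: all means of \<open>m\<close> over
  sets of positive measure lie in the closed unit ball, hence so does \<open>m\<close> almost
  everywhere.\<close>

lemma dominated_dens_vector:
  fixes \<mu> :: "'a::euclidean_space set \<Rightarrow> 'b::euclidean_space"
  assumes \<mu>: "\<mu> \<in> bmeas \<Omega>" and s: "sets \<alpha> = Bor \<Omega>" and fin: "finite_measure \<alpha>"
    and dom: "\<And>A. A \<in> Bor \<Omega> \<Longrightarrow> norm (\<mu> A) \<le> measure \<alpha> A"
  obtains m where "integrable \<alpha> m" "\<And>x. norm (m x) \<le> 1" "\<mu> = dens \<Omega> \<alpha> m"
proof -
  interpret finite_measure \<alpha> by (rule fin)
  have "\<exists>f. integrable \<alpha> f \<and> (\<lambda>A. \<mu> A \<bullet> i) = dens \<Omega> \<alpha> f" if "i \<in> Basis" for i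
  proof -
    have "\<bar>\<mu> A \<bullet> i\<bar> \<le> measure \<alpha> A" if "A \<in> Bor \<Omega>" for A
      using Basis_le_norm[OF \<open>i \<in> Basis\<close>, of "\<mu> A"] dom[OF that] by simp
    from dominated_dens[OF bmeas_inner[OF \<mu>] s fin this] show ?thesis by metis
  qed
  then obtain f where f: "\<And>i. i \<in> Basis \<Longrightarrow> integrable \<alpha> (f i)"
      "\<And>i. i \<in> Basis \<Longrightarrow> (\<lambda>A. \<mu> A \<bullet> i) = dens \<Omega> \<alpha> (f i)" by metis
  define m where "m x = (\<Sum>i\<in>Basis. f i x *\<^sub>R i)" for x
  have mi: "integrable \<alpha> m" unfolding m_def using f(1) by auto
  have \<mu>_eq: "\<mu> A = dens \<Omega> \<alpha> m A" for A
  proof (rule euclidean_eqI)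
    fix i :: 'b assume i: "i \<in> Basis"
    have "dens \<Omega> \<alpha> m A \<bullet> i = dens \<Omega> \<alpha> (f i) A"
      unfolding dens_inner[OF s mi] m_def using i by (simp add: inner_sum_left_Basis)
    then show "\<mu> A \<bullet> i = dens \<Omega> \<alpha> m A \<bullet> i" using fun_cong[OF f(2)[OF i], of A] by simp
  qed
  have "AE x in \<alpha>. m x \<in> cball 0 1"
  proof (rule averaging_theorem[OF mi closed_cball])
    fix A assume A: "A \<in> sets \<alpha>" "measure \<alpha> A > 0"
    then have "norm (set_lebesgue_integral \<alpha> A m) \<le> measure \<alpha> A"
      using dom[of A] \<mu>_eq[of A] s by (simp add: dens_def)
    then show "(1 / measure \<alpha> A) *\<^sub>R set_lebesgue_integral \<alpha> A m \<in> cball 0 1"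
      using A by (simp add: field_simps)
  qed
  then have ae: "AE x in \<alpha>. norm (m x) \<le> 1" by (auto simp: )
  \<comment> \<open>Redefinition on a null set turns the almost everywhere bound into one at every
    point, which spares exceptional sets later.\<close>
  define m' where "m' x = (if norm (m x) \<le> 1 then m x else 0)" for x
  have [measurable]: "m \<in> borel_measurable \<alpha>" using mi by simp
  have [measurable]: "m' \<in> borel_measurable \<alpha>" unfolding m'_def by measurable
  have mm: "AE x in \<alpha>. m x = m' x" using ae by (auto simp: m'_def)
  show thesis
  proof (rule that[of m'])
    show "integrable \<alpha> m'" by (rule Bochner_Integration.integrable_cong_AE_imp[OF mi _ mm]) simp
    show "norm (m' x) \<le> 1" for x by (simp add: m'_def)
    show "\<mu> = dens \<Omega> \<alpha> m'"
    proof
      fix A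
      have "(LINT x:A|\<alpha>. m x) = (LINT x:A|\<alpha>. m' x)" if "A \<in> sets \<alpha>"
        unfolding set_lebesgue_integral_def
        by (rule integral_cong_AE) (use that mm in auto)
      then show "\<mu> A = dens \<Omega> \<alpha> m' A" using s by (simp add: \<mu>_eq dens_def)
    qed
  qed
qed

section \<open>Total variation estimates\<close>

lemma norm_le_total_variation:
  assumes "\<mu> \<in> bmeas \<Omega>" "B \<in> Bor \<Omega>"
  shows "ennreal (norm (\<mu> B)) \<le> total_variation \<Omega> \<mu> B"
proof -
  have "ennreal (norm (\<mu> B)) = (\<Sum>i. ennreal (norm (\<mu> (binaryset B {} i))))"
    using bmeas_empty[OF assms(1)]
    by (subst suminf_binaryset_eq[where f="\<lambda>A. ennreal (norm (\<mu> A))"]) auto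
  also have "\<dots> \<le> total_variation \<Omega> \<mu> B"
    unfolding total_variation_def
    by (rule SUP_upper)
      (use assms in \<open>auto simp: UN_binaryset_eq binaryset_def disjoint_family_on_def\<close>)
  finally show ?thesis .
qed

text \<open>Summing the bound over any countable partition costs nothing because
  \<open>\<kappa>\<close> is additive. Variation estimates thereby reduce to estimates on single
  sets.\<close>

lemma total_variation_le:
  assumes s: "sets \<kappa> = Bor \<Omega>" and le: "\<And>A. A \<in> Bor \<Omega> \<Longrightarrow> ennreal (norm (\<mu> A)) \<le> emeasure \<kappa> A"
  shows "total_variation \<Omega> \<mu> B \<le> emeasure \<kappa> B"
  unfolding total_variation_def
proof (rule SUP_least, clarify)
  fix A :: "nat \<Rightarrow> 'a set" assume A: "range A \<subseteq> Bor \<Omega>" "disjoint_family A"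
  have "(\<Sum>i. ennreal (norm (\<mu> (A i)))) \<le> (\<Sum>i. emeasure \<kappa> (A i))"
    by (intro suminf_le le) (use A in auto)
  also have "\<dots> = emeasure \<kappa> (\<Union>i. A i)"
    using A s by (intro suminf_emeasure) auto
  finally show "(\<Sum>i. ennreal (norm (\<mu> (A i)))) \<le> emeasure \<kappa> (\<Union>i. A i)" .
qed

lemma norm_dens_le:
  assumes s: "sets \<tau> = Bor \<Omega>" and f: "integrable \<tau> f" and A: "A \<in> Bor \<Omega>"
  shows "ennreal (norm (dens \<Omega> \<tau> f A)) \<le> (\<integral>\<^sup>+x. ennreal (norm (f x)) * indicator A x \<partial>\<tau>)"
proof -
  have "ennreal (norm (dens \<Omega> \<tau> f A)) \<le> (\<integral>\<^sup>+x. ennreal (norm (indicator A x *\<^sub>R f x)) \<partial>\<tau>)"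
    using A integral_norm_bound_ennreal[OF integrable_mult_indicator[OF _ f, of A]] s
    unfolding dens_def set_lebesgue_integral_def by simp
  also have "\<dots> = (\<integral>\<^sup>+x. ennreal (norm (f x)) * indicator A x \<partial>\<tau>)"
    by (rule nn_integral_cong) (auto simp: indicator_def)
  finally show ?thesis .
qed

lemma M_norm_dens_le:
  assumes s: "sets \<tau> = Bor \<Omega>" and f: "integrable \<tau> f"
  shows "M_norm \<Omega> (dens \<Omega> \<tau> f) \<le> ennreal (\<integral>x. norm (f x) \<partial>\<tau>)"
proof -
  let ?\<kappa> = "density \<tau> (\<lambda>x. ennreal (norm (f x)))"
  have fm: "f \<in> borel_measurable \<tau>" using f by simp
  have "total_variation \<Omega> (dens \<Omega> \<tau> f) \<Omega> \<le> emeasure ?\<kappa> \<Omega>"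
  proof (rule total_variation_le)
    fix A assume A: "A \<in> Bor \<Omega>"
    then have "emeasure ?\<kappa> A = (\<integral>\<^sup>+x. ennreal (norm (f x)) * indicator A x \<partial>\<tau>)"
      using fm s by (subst emeasure_density) auto
    then show "ennreal (norm (dens \<Omega> \<tau> f A)) \<le> emeasure ?\<kappa> A"
      using norm_dens_le[OF s f A] by simp
  qed (use s in simp)
  also have "\<dots> = (\<integral>\<^sup>+x. ennreal (norm (f x)) \<partial>\<tau>)"
    using fm s space_eq_of_sets_Bor[OF s]
    by (subst emeasure_density) (auto intro!: nn_integral_cong)
  also have "\<dots> = ennreal (\<integral>x. norm (f x) \<partial>\<tau>)"
    using f by (intro nn_integral_eq_integral) auto
  finally show ?thesis unfolding M_norm_def .
qed

text \<open>If \<open>\<nu>\<close> were unbounded, one could split off disjoint sets with \<open>|\<nu>| \<ge> 1\<close> indefinitely,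
  and \<open>\<nu>\<close> would not be summable over them.\<close>

lemma bmeas_bounded:
  fixes \<nu> :: "'a::euclidean_space set \<Rightarrow> real"
  assumes "\<nu> \<in> bmeas \<Omega>"
  shows "\<exists>K. \<forall>A\<in>Bor \<Omega>. \<bar>\<nu> A\<bar> \<le> K"
proof (rule ccontr)
  define bdd where "bdd E \<longleftrightarrow> (\<exists>K. \<forall>A\<in>Bor \<Omega>. A \<subseteq> E \<longrightarrow> \<bar>\<nu> A\<bar> \<le> K)" for E
  assume "\<not> ?thesis"
  then have 0: "\<not> bdd \<Omega>"
    unfolding bdd_def using Bor_subset by metis
  have step: "\<exists>A. A \<in> Bor \<Omega> \<and> A \<subseteq> E \<and> \<not> bdd A \<and> \<bar>\<nu> (E - A)\<bar> \<ge> 1"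
    if E: "E \<in> Bor \<Omega>" "\<not> bdd E" for E
  proof -
    \<comment> \<open>The margin \<open>1 + \<bar>\<nu> E\<bar>\<close> makes
      \<open>\<bar>\<nu>\<bar>\<close> at least 1 on both \<open>A\<close> and \<open>E - A\<close>,
      so whichever of the two is kept as the unbounded piece, the discarded one has the required
      size.\<close>
    obtain A where A: "A \<in> Bor \<Omega>" "A \<subseteq> E" "\<bar>\<nu> A\<bar> > 1 + \<bar>\<nu> E\<bar>"
      using E(2) unfolding bdd_def by (metis not_le)
    have EA: "E - A \<in> Bor \<Omega>" using E A by (rule_tac sets.Diff) auto
    have eq: "\<nu> (E - A) = \<nu> E - \<nu> A" by (rule bmeas_Diff[OF assms E(1) A(1,2)])
    have "bdd E" if b: "bdd A" "bdd (E - A)"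
    proof -
      obtain K1 K2 where K: "\<And>C. C \<in> Bor \<Omega> \<Longrightarrow> C \<subseteq> A \<Longrightarrow> \<bar>\<nu> C\<bar> \<le> K1"
          "\<And>C. C \<in> Bor \<Omega> \<Longrightarrow> C \<subseteq> E - A \<Longrightarrow> \<bar>\<nu> C\<bar> \<le> K2"
        using b unfolding bdd_def by metis
      have "\<bar>\<nu> C\<bar> \<le> K1 + K2" if C: "C \<in> Bor \<Omega>" "C \<subseteq> E" for C
      proof -
        have "C \<inter> A \<in> Bor \<Omega>" "C - A \<in> Bor \<Omega>"
          using C A by (auto intro: sets.Int sets.Diff)
        moreover from this have "\<nu> C = \<nu> (C \<inter> A) + \<nu> (C - A)"
          using bmeas_Un[OF assms, of "C \<inter> A" "C - A"] by (simp add: Int_Diff_Un Int_Diff_disjoint)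
        ultimately show ?thesis using K(1)[of "C \<inter> A"] K(2)[of "C - A"] C(2) by fastforce
      qed
      then show ?thesis unfolding bdd_def by blast
    qed
    then consider "\<not> bdd A" | "\<not> bdd (E - A)" using E(2) by blast
    then show ?thesis
    proof cases
      case 1
      then show ?thesis using A eq by (intro exI[of _ A]) linarith
    next
      case 2
      have "E - (E - A) = A" using A(2) by blast
      then show ?thesis using 2 EA A(3) by (intro exI[of _ "E - A"]) auto
    qed
  qed
  define P where "P n E \<longleftrightarrow> E \<in> Bor \<Omega> \<and> \<not> bdd E" for n :: nat and E
  define Q where "Q n E A \<longleftrightarrow> A \<subseteq> E \<and> \<bar>\<nu> (E - A)\<bar> \<ge> 1" for n :: nat and E A
  obtain E where E: "\<And>n. P n (E n)" "\<And>n. Q n (E n) (E (Suc n))"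
    using dependent_nat_choice[of P Q] 0 step unfolding P_def Q_def by (metis Bor_top)
  have dec: "decseq E" using E(2) by (intro decseq_SucI) (auto simp: Q_def)
  have "(\<lambda>n. \<nu> (E n - E (Suc n))) sums \<nu> (\<Union>n. E n - E (Suc n))"
  proof (rule bmeas_sums[OF assms])
    show "range (\<lambda>n. E n - E (Suc n)) \<subseteq> Bor \<Omega>"
      using E(1) unfolding P_def by (auto intro: sets.Diff)
    show "disjoint_family (\<lambda>n. E n - E (Suc n))"
      unfolding disjoint_family_on_def
    proof (intro ballI impI)
      fix m n :: nat assume "m \<noteq> n"
      then show "(E m - E (Suc m)) \<inter> (E n - E (Suc n)) = {}"
        using decseqD[OF dec, of "Suc m" n] decseqD[OF dec, of "Suc n" m] by (cases m n rule: linorder_cases) auto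
    qed
  qed
  then have "(\<lambda>n. \<nu> (E n - E (Suc n))) \<longlonglongrightarrow> 0"
    by (intro summable_LIMSEQ_zero sums_summable)
  then have "eventually (\<lambda>n. \<bar>\<nu> (E n - E (Suc n))\<bar> < 1) sequentially"
    by (auto dest: tendstoD[of _ 0 sequentially 1])
  then obtain n where "\<bar>\<nu> (E n - E (Suc n))\<bar> < 1"
    unfolding eventually_sequentially by blast
  with E(2)[of n] show False by (simp add: Q_def)
qed

section \<open>Domination of a signed measure by a finite positive one\<close>

text \<open>The supremum \<open>P\<close> of \<open>\<nu>\<close> over subsets is the positive
  variation, finite by boundedness. Joining subsets of disjoint sets gives superadditivity, and
  cutting a subset of the union along the pieces gives the reverse inequality, so \<open>P\<close>
  is countably additive.\<close>

lemma bmeas_dominated: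
  fixes \<nu> :: "'a::euclidean_space set \<Rightarrow> real"
  assumes \<nu>: "\<nu> \<in> bmeas \<Omega>"
  obtains \<tau> where "sets \<tau> = Bor \<Omega>" "finite_measure \<tau>" "\<And>A. A \<in> Bor \<Omega> \<Longrightarrow> \<bar>\<nu> A\<bar> \<le> measure \<tau> A"
proof -
  obtain K where K: "\<And>A. A \<in> Bor \<Omega> \<Longrightarrow> \<bar>\<nu> A\<bar> \<le> K"
    using bmeas_bounded[OF \<nu>] by blast
  define S where "S A = {\<nu> B | B. B \<in> Bor \<Omega> \<and> B \<subseteq> A}" for A
  define P where "P A = (if A \<in> Bor \<Omega> then Sup (S A) else 0)" for A
  have bdd: "bdd_above (S A)" for A
    unfolding S_def bdd_above_def using K by (fastforce simp: abs_le_iff)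
  have upper: "\<nu> B \<le> P A" if "B \<in> Bor \<Omega>" "B \<subseteq> A" "A \<in> Bor \<Omega>" for A B
    using that cSup_upper[OF _ bdd, of "\<nu> B" A] by (auto simp: P_def S_def)
  have least: "P A \<le> c" if "A \<in> Bor \<Omega>" "\<And>B. B \<in> Bor \<Omega> \<Longrightarrow> B \<subseteq> A \<Longrightarrow> \<nu> B \<le> c" for A c
    using that cSup_least[of "S A" c] by (auto simp: P_def S_def)
  have P_nonneg: "0 \<le> P A" if "A \<in> Bor \<Omega>" for A
    using upper[of "{}" A] that bmeas_empty[OF \<nu>] by simp
  have super: "P A + P B \<le> P (A \<union> B)" if AB: "A \<in> Bor \<Omega>" "B \<in> Bor \<Omega>" "A \<inter> B = {}" for A B
  proof -
    have "P A \<le> P (A \<union> B) - P B"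
    proof (rule least[OF AB(1)])
      fix C assume C: "C \<in> Bor \<Omega>" "C \<subseteq> A"
      have "P B \<le> P (A \<union> B) - \<nu> C"
      proof (rule least[OF AB(2)])
        fix D assume D: "D \<in> Bor \<Omega>" "D \<subseteq> B"
        have "\<nu> C + \<nu> D = \<nu> (C \<union> D)"
          using C D AB by (intro bmeas_Un[OF \<nu>, symmetric]) auto
        also have "\<dots> \<le> P (A \<union> B)"
          using C D AB by (intro upper) auto
        finally show "\<nu> D \<le> P (A \<union> B) - \<nu> C" by simp
      qed
      then show "\<nu> C \<le> P (A \<union> B) - P B" by simp
    qed
    then show ?thesis by simp
  qed
  have mono: "P A \<le> P B" if "A \<in> Bor \<Omega>" "B \<in> Bor \<Omega>" "A \<subseteq> B" for A B
    using that by (intro least upper) auto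
  have "P \<in> bmeas \<Omega>"
    unfolding bmeas_def mem_Collect_eq
  proof (intro conjI allI impI)
    fix A :: "nat \<Rightarrow> 'a set" assume A: "range A \<subseteq> Bor \<Omega>" "disjoint_family A"
    have A': "A i \<in> Bor \<Omega>" for i using A by auto
    have U: "(\<Union>i. A i) \<in> Bor \<Omega>" using A by (intro sets.countable_UN) auto
    have Un: "(\<Union>i<n. A i) \<in> Bor \<Omega>" for n using A' by (intro sets.finite_UN) auto
    have fin: "(\<Sum>i<n. P (A i)) \<le> P (\<Union>i<n. A i)" for n
    proof (induction n)
      case 0
      then show ?case using P_nonneg[of "{}"] by simp
    next
      case (Suc n)
      have "(\<Sum>i<Suc n. P (A i)) \<le> P (\<Union>i<n. A i) + P (A n)" using Suc by simp
      also have "\<dots> \<le> P ((\<Union>i<n. A i) \<union> A n)"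
      proof (intro super Un A')
        have "A i \<inter> A n = {}" if "i < n" for i
          using A(2) that by (auto simp: disjoint_family_on_def)
        then show "(\<Union>i<n. A i) \<inter> A n = {}" by blast
      qed
      also have "(\<Union>i<n. A i) \<union> A n = (\<Union>i<Suc n. A i)" by (auto simp: less_Suc_eq)
      finally show ?case .
    qed
    have fin': "(\<Sum>i<n. P (A i)) \<le> P (\<Union>i. A i)" for n
      by (rule order_trans[OF fin mono[OF Un U]]) auto
    have summ: "summable (\<lambda>i. P (A i))"
      by (rule summableI_nonneg_bounded[OF P_nonneg[OF A'] fin'])
    have "(\<Sum>i. P (A i)) \<le> P (\<Union>i. A i)"
      by (rule suminf_le_const[OF summ fin'])
    moreover have "P (\<Union>i. A i) \<le> (\<Sum>i. P (A i))"
    proof (rule least[OF U])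
      fix B assume B: "B \<in> Bor \<Omega>" "B \<subseteq> (\<Union>i. A i)"
      have BA: "B \<inter> A i \<in> Bor \<Omega>" for i using B A' by (intro sets.Int) auto
      have "(\<lambda>i. \<nu> (B \<inter> A i)) sums \<nu> (\<Union>i. B \<inter> A i)"
        using BA A(2) by (intro bmeas_sums[OF \<nu>]) (auto simp: disjoint_family_on_def)
      moreover have "(\<Union>i. B \<inter> A i) = B" using B by auto
      ultimately have s: "(\<lambda>i. \<nu> (B \<inter> A i)) sums \<nu> B" by simp
      then have "\<nu> B = (\<Sum>i. \<nu> (B \<inter> A i))" by (rule sums_unique)
      also have "\<dots> \<le> (\<Sum>i. P (A i))"
        using BA A' by (intro suminf_le[OF _ sums_summable[OF s] summ] upper) auto
      finally show "\<nu> B \<le> (\<Sum>i. P (A i))" .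
    qed
    ultimately show "(\<lambda>i. P (A i)) sums P (\<Union>i. A i)"
      using summ by (simp add: sums_iff)
  qed (simp add: P_def)
  \<comment> \<open>As \<open>P - \<nu>\<close> is the negative variation,
    \<open>2 P - \<nu> = P + (P - \<nu>)\<close> is the total variation.\<close>
  from bmeas_scaleR_add[OF this \<nu>, of 2 "-1"]
  have \<kappa>: "(\<lambda>A. 2 * P A - \<nu> A) \<in> bmeas \<Omega>" by simp
  have abs: "\<bar>\<nu> A\<bar> \<le> 2 * P A - \<nu> A" if "A \<in> Bor \<Omega>" for A
    using upper[of A A] P_nonneg[of A] that by (simp add: abs_le_iff)
  have nonneg: "0 \<le> 2 * P A - \<nu> A" if "A \<in> Bor \<Omega>" for A
    using order_trans[OF abs_ge_zero abs[OF that]] .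
  obtain \<tau> where "sets \<tau> = Bor \<Omega>" "finite_measure \<tau>"
      "\<And>A. A \<in> Bor \<Omega> \<Longrightarrow> measure \<tau> A = 2 * P A - \<nu> A"
    by (rule bmeas_nonneg_measure[OF \<kappa> nonneg]) (assumption | rule that)+
  with abs show thesis by (intro that[of \<tau>]) simp_all
qed

section \<open>The product rule\<close>

lemma open_Union_boxes:
  fixes S :: "'a::euclidean_space set"
  assumes "open S"
  obtains F where "countable F" "F \<subseteq> {box a b | a b. cbox a b \<subseteq> S}" "\<Union>F = S"
proof -
  let ?F = "{box a b | a b. cbox a b \<subseteq> S}"
  have "\<Union>?F = S"
  proof
    show "\<Union>?F \<subseteq> S" using box_subset_cbox by blast
    show "S \<subseteq> \<Union>?F"
    proof
      fix x assume "x \<in> S"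
      then obtain a b where "cbox a b \<subseteq> S" "x \<in> box a b"
        using open_contains_cbox[OF assms] by metis
      then show "x \<in> \<Union>?F" by blast
    qed
  qed
  moreover obtain F where "F \<subseteq> ?F" "countable F" "\<Union>F = \<Union>?F"
    by (rule Lindelof[of ?F]) (blast intro: open_box)+
  ultimately show thesis using that[of F] by simp
qed

text \<open>The boxes are required to have their closure in \<open>\<Omega>\<close> so that their
  bump functions are admissible tests on \<open>\<Omega>\<close>; by Lindelof such boxes still
  generate all open subsets.\<close>

lemma Bor_sigma_boxes:
  fixes \<Omega> :: "'a::euclidean_space set"
  assumes "open \<Omega>"
  shows "Bor \<Omega> = sigma_sets \<Omega> {box a b | a b. cbox a b \<subseteq> \<Omega>}" (is "_ = sigma_sets \<Omega> ?E")
proof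
  have "sigma_sets (space (restrict_space borel \<Omega>)) ?E \<subseteq> Bor \<Omega>"
    using Bor_iff[OF assms] box_subset_cbox by (intro sets.sigma_sets_subset) fastforce
  then show "sigma_sets \<Omega> ?E \<subseteq> Bor \<Omega>" by (simp add: space_restrict_space)
next
  show "Bor \<Omega> \<subseteq> sigma_sets \<Omega> ?E"
  proof
    fix B assume "B \<in> Bor \<Omega>"
    then have B: "B \<in> sigma_sets UNIV {S. open S}" "B \<subseteq> \<Omega>"
      using Bor_iff[OF assms] by (auto simp: borel_def)
    from B(1) have "B \<inter> \<Omega> \<in> sigma_sets \<Omega> ?E"
    proof induction
      case (Basic S)
      then have "open (S \<inter> \<Omega>)" using assms by auto
      then obtain F where F: "countable F" "F \<subseteq> {box a b | a b. cbox a b \<subseteq> S \<inter> \<Omega>}" "\<Union>F = S \<inter> \<Omega>"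
        by (rule open_Union_boxes)
      have "\<Union>F \<in> sigma_sets \<Omega> ?E"
        by (rule sigma_sets_UNION[OF F(1)]) (use F(2) in blast)
      then show ?case using F(3) by simp
    next
      case Empty
      then show ?case by (simp add: sigma_sets.Empty)
    next
      case (Compl S)
      then have "\<Omega> - S \<inter> \<Omega> \<in> sigma_sets \<Omega> ?E" by (intro sigma_sets.Compl)
      moreover have "\<Omega> - S \<inter> \<Omega> = (UNIV - S) \<inter> \<Omega>" by blast
      ultimately show ?case by simp
    next
      case (Union A)
      then have "(\<Union>i. A i \<inter> \<Omega>) \<in> sigma_sets \<Omega> ?E" by (intro sigma_sets.Union)
      then show ?case by simp
    qed
    then show "B \<in> sigma_sets \<Omega> ?E" using B(2) by (simp add: Int_absorb2)
  qed
qed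

lemma Cc_infty_Ck: "\<phi> \<in> Cc_infty \<Omega> \<Longrightarrow> \<phi> \<in> Ck k \<Omega>"
  by (simp add: Cc_infty_def)

lemma Cc_infty_support:
  assumes "\<phi> \<in> Cc_infty \<Omega>"
  obtains K where "compact K" "K \<subseteq> \<Omega>" "\<And>x. x \<in> \<Omega> \<Longrightarrow> x \<notin> K \<Longrightarrow> \<phi> x = 0"
proof (rule that[of "closure {x \<in> \<Omega>. \<phi> x \<noteq> 0}"])
  fix x assume "x \<in> \<Omega>" "x \<notin> closure {x \<in> \<Omega>. \<phi> x \<noteq> 0}"
  then show "\<phi> x = 0" using closure_subset[of "{x \<in> \<Omega>. \<phi> x \<noteq> 0}"] by blast
qed (use assms in \<open>auto simp: Cc_infty_def\<close>)

lemma locally_integrable_mult: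
  fixes f :: "'a::euclidean_space \<Rightarrow> real"
  assumes s: "sets \<tau> = Bor \<Omega>"
    and f: "\<And>K. compact K \<Longrightarrow> K \<subseteq> \<Omega> \<Longrightarrow> integrable \<tau> (\<lambda>x. indicator K x * f x)"
    and \<phi>: "continuous_on \<Omega> \<phi>" "compact K" "K \<subseteq> \<Omega>" "\<And>x. x \<in> \<Omega> \<Longrightarrow> x \<notin> K \<Longrightarrow> \<phi> x = 0"
  shows "integrable \<tau> (\<lambda>x. \<phi> x * f x)"
proof -
  obtain B where B: "\<And>x. x \<in> \<Omega> \<Longrightarrow> norm (\<phi> x) \<le> B"
    using compact_support_bounded[OF \<phi>] by metis
  have "integrable \<tau> (\<lambda>x. \<phi> x * (indicator K x * f x))"
    by (rule integrable_bounded_mult[OF f[OF \<phi>(2,3)] measurable_of_continuous_on[OF s \<phi>(1)], of B])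
      (use B space_eq_of_sets_Bor[OF s] in auto)
  then show ?thesis
    by (rule Bochner_Integration.integrable_cong[THEN iffD1, OF refl, rotated])
      (use \<phi>(4) space_eq_of_sets_Bor[OF s] in \<open>auto simp: indicator_def\<close>)
qed

text \<open>Bumps converge to indicators of boxes, dominated by \<open>\<bar>f\<bar>\<close> on the
  closed box, so \<open>f\<close> has integral 0 over every generating box. The positive and
  negative parts of \<open>f\<close> then define the same measure. Sigma-finiteness and local
  integrability suffice, which covers both a finite reference measure and Lebesgue measure with an
  \<open>L^p\<close> function.\<close>

lemma AE_zero_of_tests:
  fixes f :: "'a::euclidean_space \<Rightarrow> real"
  assumes op: "open \<Omega>" and s: "sets \<tau> = Bor \<Omega>" and sf: "sigma_finite_measure \<tau>"
    and fm[measurable]: "f \<in> borel_measurable \<tau>"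
    and f: "\<And>K. compact K \<Longrightarrow> K \<subseteq> \<Omega> \<Longrightarrow> integrable \<tau> (\<lambda>x. indicator K x * f x)"
    and zero: "\<And>\<phi>. \<phi> \<in> Cc_infty \<Omega> \<Longrightarrow> (\<integral>x. \<phi> x * f x \<partial>\<tau>) = 0"
  shows "AE x in \<tau>. f x = 0"
proof -
  let ?E = "{box a b | a b. cbox a b \<subseteq> \<Omega>}"
  have box_sets: "box a b \<in> sets \<tau>" if "cbox a b \<subseteq> \<Omega>" for a b
    using that box_subset_cbox[of a b] s Bor_iff[OF op] by auto
  have box_int: "integrable \<tau> (\<lambda>x. indicator (box a b) x * f x)"
      and box_zero: "(\<integral>x. indicator (box a b) x * f x \<partial>\<tau>) = 0" if ab: "cbox a b \<subseteq> \<Omega>" for a b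
  proof -
    have [measurable]: "box a b \<in> sets \<tau>" by (rule box_sets[OF ab])
    have i: "integrable \<tau> (\<lambda>x. indicator (cbox a b) x * f x)"
      by (rule f[OF compact_cbox ab])
    show "integrable \<tau> (\<lambda>x. indicator (box a b) x * f x)"
      by (rule Bochner_Integration.integrable_bound[OF i])
        (use box_subset_cbox[of a b] in \<open>auto simp: indicator_def\<close>)
    let ?\<phi> = "\<lambda>k. box_bump (inverse (real (Suc k))) a b"
    have \<phi>: "?\<phi> k \<in> Cc_infty \<Omega>" for k by (rule box_bump_Cc_infty) (use ab in auto)
    have "(\<lambda>k. \<integral>x. ?\<phi> k x * f x \<partial>\<tau>) \<longlonglongrightarrow> (\<integral>x. indicator (box a b) x * f x \<partial>\<tau>)"
    proof (rule integral_dominated_convergence[where w="\<lambda>x. \<bar>indicator (cbox a b) x * f x\<bar>"])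
      show "AE x in \<tau>. (\<lambda>k. ?\<phi> k x * f x) \<longlonglongrightarrow> indicator (box a b) x * f x"
        by (intro AE_I2 tendsto_mult box_bump_tendsto_indicator tendsto_const)
      show "AE x in \<tau>. norm (?\<phi> k x * f x) \<le> \<bar>indicator (cbox a b) x * f x\<bar>" for k
      proof (rule AE_I2)
        fix x
        show "norm (?\<phi> k x * f x) \<le> \<bar>indicator (cbox a b) x * f x\<bar>"
        proof (cases "x \<in> box a b")
          case True
          then have "x \<in> cbox a b" using box_subset_cbox by blast
          then show ?thesis
            using box_bump_bounds[of "inverse (real (Suc k))" a b x]
            by (simp add: abs_mult mult_left_le_one_le)
        next
          case False
          then show ?thesis using box_bump_pos_iff[of _ a b x] by auto
        qed
      qed
      show "(\<lambda>x. ?\<phi> k x * f x) \<in> borel_measurable \<tau>" for k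
        using measurable_of_continuous_on[OF s Ck_continuous_on[OF Cc_infty_Ck[OF \<phi>[of k], of 0]]]
        by (intro borel_measurable_times fm)
    qed (use i in auto)
    then show "(\<integral>x. indicator (box a b) x * f x \<partial>\<tau>) = 0"
      unfolding zero[OF \<phi>] by (simp add: LIMSEQ_const_iff)
  qed
  have em: "emeasure (density \<tau> (\<lambda>x. ennreal (h x))) (box a b) = (\<integral>\<^sup>+x. ennreal (indicator (box a b) x * h x) \<partial>\<tau>)"
    if "cbox a b \<subseteq> \<Omega>" "h \<in> borel_measurable \<tau>" for a b h
    using that box_sets[OF that(1)]
    by (subst emeasure_density) (auto intro!: nn_integral_cong simp: indicator_def)
  have fin: "(\<integral>\<^sup>+x. ennreal (indicator (box a b) x * f x) \<partial>\<tau>) < \<infinity>"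
     "(\<integral>\<^sup>+x. ennreal (indicator (box a b) x * - f x) \<partial>\<tau>) < \<infinity>" if "cbox a b \<subseteq> \<Omega>" for a b
    using box_int[OF that] unfolding real_integrable_def by (auto simp: top.not_eq_extremum)
  obtain F where F: "countable F" "F \<subseteq> ?E" "\<Union>F = \<Omega>"
    using open_Union_boxes[OF op] .
  have "density \<tau> (\<lambda>x. ennreal (f x)) = density \<tau> (\<lambda>x. ennreal (- f x))"
  proof (rule measure_eqI_generator_eq_countable[of ?E \<Omega>])
    show "Int_stable ?E"
    proof (rule Int_stableI)
      fix X Y assume "X \<in> ?E" "Y \<in> ?E"
      then obtain a b c d where *: "X = box a b" "cbox a b \<subseteq> \<Omega>" "Y = box c d" by blast
      \<comment> \<open>The closed boxes with the same corners intersect in this closed box, so the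
        closure condition passes to intersections.\<close>
      have "cbox (\<Sum>i\<in>Basis. max (a\<bullet>i) (c\<bullet>i) *\<^sub>R i) (\<Sum>i\<in>Basis. min (b\<bullet>i) (d\<bullet>i) *\<^sub>R i) \<subseteq> \<Omega>"
        using *(2) unfolding Int_interval[symmetric] by blast
      then show "X \<inter> Y \<in> ?E" unfolding * box_Int_box by blast
    qed
    show "?E \<subseteq> Pow \<Omega>" using box_subset_cbox by blast
    fix X assume "X \<in> ?E"
    then obtain a b where X: "X = box a b" "cbox a b \<subseteq> \<Omega>" by blast
    show "emeasure (density \<tau> (\<lambda>x. ennreal (f x))) X = emeasure (density \<tau> (\<lambda>x. ennreal (- f x))) X"
    proof -
      \<comment> \<open>A zero integral says that the integrals of the two parts agree as reals;
        both being finite, they agree as extended reals.\<close>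
      have "enn2real (\<integral>\<^sup>+x. ennreal (indicator (box a b) x * f x) \<partial>\<tau>)
          = enn2real (\<integral>\<^sup>+x. ennreal (indicator (box a b) x * - f x) \<partial>\<tau>)"
        using box_zero[OF X(2)] unfolding real_lebesgue_integral_def[OF box_int[OF X(2)]] by simp
      then have "(\<integral>\<^sup>+x. ennreal (indicator (box a b) x * f x) \<partial>\<tau>)
          = (\<integral>\<^sup>+x. ennreal (indicator (box a b) x * - f x) \<partial>\<tau>)"
        using fin[OF X(2)] by (metis ennreal_enn2real infinity_ennreal_def)
      then show ?thesis
        unfolding X(1) em[OF X(2) fm] using em[OF X(2), of "\<lambda>x. - f x"] by simp
    qed
  next
    fix X assume "X \<in> F"
    then obtain a b where X: "X = box a b" "cbox a b \<subseteq> \<Omega>" using F(2) by blast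
    show "emeasure (density \<tau> (\<lambda>x. ennreal (f x))) X \<noteq> \<infinity>"
      using fin(1)[OF X(2)] em[OF X(2) fm] unfolding X(1) by (simp add: less_top)
  qed (use F Bor_sigma_boxes[OF op] s in auto)
  \<comment> \<open>Equality of the positive and negative parts forces both to vanish, since at each
    point at most one of them is non-zero.\<close>
  then have "AE x in \<tau>. ennreal (f x) = ennreal (- f x)"
    by (intro sigma_finite_measure.density_unique[OF sf]) auto
  then show ?thesis
  proof eventually_elim
    case (elim x)
    then show ?case
      by (cases "f x \<ge> 0") (auto simp: ennreal_neg ennreal_eq_0_iff)
  qed
qed

section \<open>Extension, products and bounds of C^1 functions\<close>

text \<open>Values of a test function outside \<open>\<Omega>\<close> are arbitrary, whereas
  convolution reads the function everywhere, so it is first replaced by its extension by zero. The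
  open sets \<open>\<Omega>\<close> and \<open>- K\<close> cover the space, and the extension is of
  class C^1 on each.\<close>

lemma zero_extension_Ck1:
  assumes op: "open \<Omega>" and \<phi>: "\<phi> \<in> Ck 1 \<Omega>" and K: "compact K" "K \<subseteq> \<Omega>"
    and supp: "\<And>x. x \<in> \<Omega> \<Longrightarrow> x \<notin> K \<Longrightarrow> \<phi> x = 0"
  shows "(\<lambda>x. if x \<in> \<Omega> then \<phi> x else 0) \<in> Ck 1 UNIV" (is "?u \<in> _")
    and "x \<in> \<Omega> \<Longrightarrow> grad (\<lambda>x. if x \<in> \<Omega> then \<phi> x else 0) x = grad \<phi> x"
proof -
  have in\<Omega>: "(?u has_derivative (\<lambda>v. v \<bullet> grad \<phi> x)) (at x)" if "x \<in> \<Omega>" for x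
    by (rule has_derivative_transform_within_open[OF has_derivative_grad[OF Ck1D(1)[OF \<phi> that]] op that]) simp
  have off: "(?u has_derivative (\<lambda>v. v \<bullet> 0)) (at x)" if "x \<notin> K" for x
  proof -
    have "((\<lambda>_. 0) has_derivative (\<lambda>v. v \<bullet> 0)) (at x)" by simp
    then show ?thesis
      by (rule has_derivative_transform_within_open[where s="- K"])
        (use compact_imp_closed[OF K(1)] supp that in auto)
  qed
  show grad_in: "grad ?u x = grad \<phi> x" if "x \<in> \<Omega>" for x
    by (rule grad_eqI[OF in\<Omega>[OF that]])
  have "continuous_on (\<Omega> \<union> - K) (grad ?u)"
  proof (rule continuous_on_open_Un[OF op])
    show "open (- K)" using compact_imp_closed[OF K(1)] by auto
    show "continuous_on \<Omega> (grad ?u)"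
      using Ck1D(2)[OF \<phi>] grad_in by (simp cong: continuous_on_cong)
    show "continuous_on (- K) (grad ?u)"
      by (rule continuous_on_eq[OF continuous_on_const[of _ 0]]) (simp add: grad_eqI[OF off])
  qed
  moreover have "\<Omega> \<union> - K = UNIV" using K(2) by blast
  moreover have "?u differentiable (at x)" for x
    using in\<Omega>[of x] off[of x] K(2) unfolding differentiable_def by blast
  ultimately show "?u \<in> Ck 1 UNIV" unfolding Ck1_iff by simp
qed

lemma grad_mult:
  assumes "f differentiable (at x)" "g differentiable (at x)"
  shows "grad (\<lambda>x. f x * g x) x = f x *\<^sub>R grad g x + g x *\<^sub>R grad f x"
proof (rule grad_eqI)
  show "((\<lambda>x. f x * g x) has_derivative (\<lambda>v. v \<bullet> (f x *\<^sub>R grad g x + g x *\<^sub>R grad f x))) (at x)"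
    by (rule has_derivative_eq_rhs[OF has_derivative_mult[OF has_derivative_grad[OF assms(1)] has_derivative_grad[OF assms(2)]]])
      (auto simp: inner_right_distrib)
qed

lemma Ck1_mult:
  assumes "f \<in> Ck 1 \<Omega>" "g \<in> Ck 1 \<Omega>"
  shows "(\<lambda>x. f x * g x) \<in> Ck 1 \<Omega>"
  unfolding Ck1_iff
proof
  note d = Ck1D(1)[OF assms(1)] Ck1D(1)[OF assms(2)]
  show "\<forall>x\<in>\<Omega>. (\<lambda>x. f x * g x) differentiable (at x)" using d by auto
  have "continuous_on \<Omega> (\<lambda>x. f x *\<^sub>R grad g x + g x *\<^sub>R grad f x)"
    using assms by (intro continuous_intros Ck1D)
  then show "continuous_on \<Omega> (grad (\<lambda>x. f x * g x))"
    using grad_mult[OF d] by (simp cong: continuous_on_cong)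
qed

lemma Cb1_bounded:
  assumes "f \<in> Cb1 \<Omega>"
  obtains B where "B \<ge> 0" "\<And>x. x \<in> \<Omega> \<Longrightarrow> \<bar>f x\<bar> \<le> B" "\<And>x. x \<in> \<Omega> \<Longrightarrow> norm (grad f x) \<le> B"
proof -
  have "\<exists>B. \<forall>x\<in>\<Omega>. \<bar>f x\<bar> \<le> B"
    using assms unfolding Cb1_def bounded_iff by auto
  then obtain B0 where B0: "\<And>x. x \<in> \<Omega> \<Longrightarrow> \<bar>f x\<bar> \<le> B0" by blast
  have "\<exists>B. \<forall>x\<in>\<Omega>. \<bar>frechet_derivative f (at x) i\<bar> \<le> B" if "i \<in> Basis" for i
    using assms that unfolding Cb1_def bounded_iff by auto
  then obtain b where b: "\<And>i x. i \<in> Basis \<Longrightarrow> x \<in> \<Omega> \<Longrightarrow> \<bar>frechet_derivative f (at x) i\<bar> \<le> b i"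
    by metis
  have f: "f \<in> Ck 1 \<Omega>" using assms by (simp add: Cb1_def)
  have "norm (grad f x) \<le> (\<Sum>i\<in>Basis. b i)" if "x \<in> \<Omega>" for x
  proof (rule order_trans[OF norm_le_l1 sum_mono])
    fix i :: 'a assume "i \<in> Basis"
    then show "\<bar>grad f x \<bullet> i\<bar> \<le> b i"
      using b that grad_inner[OF Ck1D(1)[OF f that]] by simp
  qed
  then show thesis
    using B0 by (intro that[of "max 0 (max B0 (\<Sum>i\<in>Basis. b i))"]) (simp_all add: le_max_iff_disj)
qed

lemma Cb1I:
  assumes "f \<in> Ck 1 \<Omega>" "\<And>x. x \<in> \<Omega> \<Longrightarrow> \<bar>f x\<bar> \<le> B" "\<And>x. x \<in> \<Omega> \<Longrightarrow> norm (grad f x) \<le> B"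
  shows "f \<in> Cb1 \<Omega>"
proof -
  have "\<bar>frechet_derivative f (at x) i\<bar> \<le> B" if "x \<in> \<Omega>" "i \<in> Basis" for x i
    using grad_inner[OF Ck1D(1)[OF assms(1) that(1)] that(2)] Basis_le_norm[OF that(2), of "grad f x"]
      assms(3)[OF that(1)] by simp
  then show ?thesis
    using assms(1,2) unfolding Cb1_def bounded_iff by (auto intro!: exI[of _ B])
qed

lemma Cb1_mult:
  assumes f: "f \<in> Cb1 \<Omega>" and g: "g \<in> Cb1 \<Omega>"
  shows "(\<lambda>x. f x * g x) \<in> Cb1 \<Omega>"
proof -
  obtain B where B: "B \<ge> 0" "\<And>x. x \<in> \<Omega> \<Longrightarrow> \<bar>f x\<bar> \<le> B" "\<And>x. x \<in> \<Omega> \<Longrightarrow> norm (grad f x) \<le> B"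
    using Cb1_bounded[OF f] by metis
  obtain C where C: "C \<ge> 0" "\<And>x. x \<in> \<Omega> \<Longrightarrow> \<bar>g x\<bar> \<le> C" "\<And>x. x \<in> \<Omega> \<Longrightarrow> norm (grad g x) \<le> C"
    using Cb1_bounded[OF g] by metis
  have fg: "f \<in> Ck 1 \<Omega>" "g \<in> Ck 1 \<Omega>" using f g by (auto simp: Cb1_def)
  show ?thesis
  proof (rule Cb1I[OF Ck1_mult[OF fg], of "B * C + C * B"])
    fix x assume x: "x \<in> \<Omega>"
    have "\<bar>f x * g x\<bar> \<le> B * C" using B C x by (simp add: abs_mult mult_mono)
    then show "\<bar>f x * g x\<bar> \<le> B * C + C * B" using B C by simp
    have "norm (grad (\<lambda>x. f x * g x) x) \<le> \<bar>f x\<bar> * norm (grad g x) + \<bar>g x\<bar> * norm (grad f x)"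
      unfolding grad_mult[OF Ck1D(1)[OF fg(1) x] Ck1D(1)[OF fg(2) x]]
      by (rule order_trans[OF norm_triangle_ineq]) simp
    also have "\<dots> \<le> B * C + C * B" using B C x by (intro add_mono mult_mono) auto
    finally show "norm (grad (\<lambda>x. f x * g x) x) \<le> B * C + C * B" .
  qed
qed

lemma trace_tests_mult:
  assumes "\<phi> \<in> trace_tests \<Omega> \<Gamma>" "g \<in> Cb1_closure \<Omega>"
  shows "(\<lambda>x. g x * \<phi> x) \<in> trace_tests \<Omega> \<Gamma>"
  using assms Cb1_mult[of g \<Omega> \<phi>]
  by (auto simp: trace_tests_def Cb1_closure_def intro!: continuous_on_mult)

section \<open>The divergence identity for C^1 test functions\<close>

text \<open>A common frame for both kinds of divergence: the field is \<open>m \<alpha>\<close> and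
  its divergence is \<open>s \<tau>\<close>. In the measure case \<open>\<tau>\<close> is finite and
  \<open>s\<close> integrable; in the \<open>L^p\<close> case \<open>\<tau>\<close> is Lebesgue
  measure, possibly infinite, and this is why \<open>s\<close> is only asked to be locally
  integrable.\<close>

locale div_field =
  fixes \<Omega> :: "'a::euclidean_space set" and \<alpha> :: "'a measure" and m :: "'a \<Rightarrow> 'a"
    and \<tau> :: "'a measure" and s :: "'a \<Rightarrow> real"
  assumes op: "open \<Omega>" and s\<alpha>: "sets \<alpha> = Bor \<Omega>" and fin\<alpha>: "finite_measure \<alpha>"
    and m_int: "integrable \<alpha> m" and m_le: "\<And>x. norm (m x) \<le> 1"
    and s\<tau>: "sets \<tau> = Bor \<Omega>" and sf: "sigma_finite_measure \<tau>"
    and s_meas: "s \<in> borel_measurable \<tau>"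
    and s_int: "\<And>K. compact K \<Longrightarrow> K \<subseteq> \<Omega> \<Longrightarrow> integrable \<tau> (\<lambda>x. indicator K x * s x)"
    and div_eq: "\<And>\<phi>. \<phi> \<in> Cc_infty \<Omega> \<Longrightarrow> (\<integral>x. grad \<phi> x \<bullet> m x \<partial>\<alpha>) = - (\<integral>x. \<phi> x * s x \<partial>\<tau>)"
begin

lemma space_\<alpha>: "space \<alpha> = \<Omega>" and space_\<tau>: "space \<tau> = \<Omega>"
  using space_eq_of_sets_Bor s\<alpha> s\<tau> by auto

lemma div_eq_C1_UNIV:
  assumes u: "u \<in> Ck 1 UNIV" and K: "compact K" "K \<subseteq> \<Omega>" and supp: "\<And>x. x \<notin> K \<Longrightarrow> u x = 0"
  shows "(\<integral>x. grad u x \<bullet> m x \<partial>\<alpha>) = - (\<integral>x. u x * s x \<partial>\<tau>)"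
proof -
  interpret finite_measure \<alpha> by (rule fin\<alpha>)
  obtain \<phi> K' B where K': "compact K'" "K' \<subseteq> \<Omega>" and \<phi>: "\<And>n. \<phi> n \<in> Cc_infty \<Omega>"
    "\<And>n x. x \<notin> K' \<Longrightarrow> \<phi> n x = 0" "\<And>n x. \<bar>\<phi> n x\<bar> \<le> B" "\<And>n x. norm (grad (\<phi> n) x) \<le> B"
    "\<And>x. (\<lambda>n. \<phi> n x) \<longlonglongrightarrow> u x" "\<And>x. (\<lambda>n. grad (\<phi> n) x) \<longlonglongrightarrow> grad u x"
    by (rule C1_smooth_approx[OF op K u supp]) (assumption | rule that)+
  have B: "B \<ge> 0" using \<phi>(3)[of undefined undefined] by linarith
  have u\<Omega>: "u \<in> Ck 1 \<Omega>" using u by (rule Ck_UNIV_subset)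
  have [measurable]: "m \<in> borel_measurable \<alpha>" "s \<in> borel_measurable \<tau>" using m_int s_meas by auto
  have [measurable]: "grad (\<phi> n) \<in> borel_measurable \<alpha>" "\<phi> n \<in> borel_measurable \<tau>" for n
    by (rule measurable_of_continuous_on[OF s\<alpha> Ck1D(2)[OF Cc_infty_Ck[OF \<phi>(1)]]])
      (rule measurable_of_continuous_on[OF s\<tau> Ck1D(3)[OF Cc_infty_Ck[OF \<phi>(1)]]])
  have [measurable]: "grad u \<in> borel_measurable \<alpha>" "u \<in> borel_measurable \<tau>"
    by (rule measurable_of_continuous_on[OF s\<alpha> Ck1D(2)[OF u\<Omega>]])
      (rule measurable_of_continuous_on[OF s\<tau> Ck1D(3)[OF u\<Omega>]])
  have "(\<lambda>n. \<integral>x. grad (\<phi> n) x \<bullet> m x \<partial>\<alpha>) \<longlonglongrightarrow> (\<integral>x. grad u x \<bullet> m x \<partial>\<alpha>)"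
  proof (rule integral_dominated_convergence[where w="\<lambda>_. B"])
    show "AE x in \<alpha>. norm (grad (\<phi> n) x \<bullet> m x) \<le> B" for n
    proof (rule AE_I2)
      fix x
      have "\<bar>grad (\<phi> n) x \<bullet> m x\<bar> \<le> norm (grad (\<phi> n) x) * norm (m x)"
        by (rule Cauchy_Schwarz_ineq2)
      also have "\<dots> \<le> B * 1" using \<phi>(4) m_le B by (intro mult_mono) auto
      finally show "norm (grad (\<phi> n) x \<bullet> m x) \<le> B" by simp
    qed
    show "AE x in \<alpha>. (\<lambda>n. grad (\<phi> n) x \<bullet> m x) \<longlonglongrightarrow> grad u x \<bullet> m x"
      by (intro AE_I2 tendsto_inner \<phi>(6) tendsto_const)
  qed auto
  moreover have "(\<lambda>n. \<integral>x. \<phi> n x * s x \<partial>\<tau>) \<longlonglongrightarrow> (\<integral>x. u x * s x \<partial>\<tau>)"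
  \<comment> \<open>The common compact support \<open>K'\<close> of the approximations is essential
    here: the majorant is integrable by local integrability of \<open>s\<close>.\<close>
  proof (rule integral_dominated_convergence[where w="\<lambda>x. B * \<bar>indicator K' x * s x\<bar>"])
    show "AE x in \<tau>. norm (\<phi> n x * s x) \<le> B * \<bar>indicator K' x * s x\<bar>" for n
    proof (rule AE_I2)
      fix x
      show "norm (\<phi> n x * s x) \<le> B * \<bar>indicator K' x * s x\<bar>"
        using \<phi>(2)[of x n] \<phi>(3)[of n x] by (cases "x \<in> K'") (auto simp: abs_mult mult_right_mono)
    qed
    show "AE x in \<tau>. (\<lambda>n. \<phi> n x * s x) \<longlonglongrightarrow> u x * s x"
      by (intro AE_I2 tendsto_mult \<phi>(5) tendsto_const)
    show "integrable \<tau> (\<lambda>x. B * \<bar>indicator K' x * s x\<bar>)"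
      using s_int[OF K'] by simp
  qed auto
  then have "(\<lambda>n. - (\<integral>x. \<phi> n x * s x \<partial>\<tau>)) \<longlonglongrightarrow> - (\<integral>x. u x * s x \<partial>\<tau>)"
    by (rule tendsto_minus)
  ultimately show ?thesis
    unfolding div_eq[OF \<phi>(1)] by (rule LIMSEQ_unique)
qed

lemma div_eq_C1:
  assumes \<phi>: "\<phi> \<in> Ck 1 \<Omega>" and K: "compact K" "K \<subseteq> \<Omega>"
    and supp: "\<And>x. x \<in> \<Omega> \<Longrightarrow> x \<notin> K \<Longrightarrow> \<phi> x = 0"
  shows "(\<integral>x. grad \<phi> x \<bullet> m x \<partial>\<alpha>) = - (\<integral>x. \<phi> x * s x \<partial>\<tau>)"
proof -
  let ?u = "\<lambda>x. if x \<in> \<Omega> then \<phi> x else 0"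
  have "(\<integral>x. grad ?u x \<bullet> m x \<partial>\<alpha>) = - (\<integral>x. ?u x * s x \<partial>\<tau>)"
    by (rule div_eq_C1_UNIV[OF zero_extension_Ck1(1)[OF op \<phi> K supp] K]) (use supp in auto)
  moreover have "(\<integral>x. grad ?u x \<bullet> m x \<partial>\<alpha>) = (\<integral>x. grad \<phi> x \<bullet> m x \<partial>\<alpha>)"
    using zero_extension_Ck1(2)[OF op \<phi> K supp]
    by (intro Bochner_Integration.integral_cong) (auto simp: space_\<alpha>)
  moreover have "(\<integral>x. ?u x * s x \<partial>\<tau>) = (\<integral>x. \<phi> x * s x \<partial>\<tau>)"
    by (intro Bochner_Integration.integral_cong) (auto simp: space_\<tau>)
  ultimately show ?thesis by simp
qed

lemma integrable_inner_m:
  assumes "\<Phi> \<in> borel_measurable \<alpha>" "\<And>x. x \<in> \<Omega> \<Longrightarrow> norm (\<Phi> x) \<le> B"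
  shows "integrable \<alpha> (\<lambda>x. \<Phi> x \<bullet> m x)"
  using integrable_bounded_inner[OF m_int assms(1)] assms(2) space_\<alpha> by metis

text \<open>The divergence identity is tested with \<open>g \<phi>\<close>, which is of class C^1
  with compact support in \<open>\<Omega>\<close>, and the gradient of the product is split into its
  two terms.\<close>

lemma div_mult_tests:
  assumes g: "g \<in> Ck 1 \<Omega>" and \<phi>: "\<phi> \<in> Cc_infty \<Omega>"
  shows "(\<integral>x. grad \<phi> x \<bullet> (g x *\<^sub>R m x) \<partial>\<alpha>)
    = - (\<integral>x. \<phi> x * (g x * s x) \<partial>\<tau>) - (\<integral>x. \<phi> x * (grad g x \<bullet> m x) \<partial>\<alpha>)"
proof -
  obtain K where K: "compact K" "K \<subseteq> \<Omega>" "\<And>x. x \<in> \<Omega> \<Longrightarrow> x \<notin> K \<Longrightarrow> \<phi> x = 0"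
    by (rule Cc_infty_support[OF \<phi>]) (assumption | rule that)+
  have \<phi>1: "\<phi> \<in> Ck 1 \<Omega>" by (rule Cc_infty_Ck[OF \<phi>])
  have grad0: "grad \<phi> x = 0" if "x \<in> \<Omega>" "x \<notin> K" for x
    using grad_zero_off_support[OF op compact_imp_closed[OF K(1)] K(3) that] .
  have c1: "continuous_on \<Omega> (\<lambda>x. g x *\<^sub>R grad \<phi> x)" and c2: "continuous_on \<Omega> (\<lambda>x. \<phi> x *\<^sub>R grad g x)"
    using g \<phi>1 by (auto intro!: continuous_intros Ck1D)
  \<comment> \<open>Both terms of the product rule are continuous and vanish off the compact set
    \<open>K\<close>, hence bounded and integrable against \<open>m\<close>, even when
    \<open>grad g\<close> is unbounded on \<open>\<Omega>\<close>.\<close>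
  obtain B1 where B1: "\<And>x. x \<in> \<Omega> \<Longrightarrow> norm (g x *\<^sub>R grad \<phi> x) \<le> B1"
    using compact_support_bounded[OF c1 K(1,2)] grad0 by (metis scaleR_zero_right)
  obtain B2 where B2: "\<And>x. x \<in> \<Omega> \<Longrightarrow> norm (\<phi> x *\<^sub>R grad g x) \<le> B2"
    using compact_support_bounded[OF c2 K(1,2)] K(3) by (metis scaleR_zero_left)
  have i1: "integrable \<alpha> (\<lambda>x. (g x *\<^sub>R grad \<phi> x) \<bullet> m x)"
    by (rule integrable_inner_m[OF measurable_of_continuous_on[OF s\<alpha> c1] B1])
  have i2: "integrable \<alpha> (\<lambda>x. (\<phi> x *\<^sub>R grad g x) \<bullet> m x)"
    by (rule integrable_inner_m[OF measurable_of_continuous_on[OF s\<alpha> c2] B2])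
  have "(\<integral>x. grad (\<lambda>x. g x * \<phi> x) x \<bullet> m x \<partial>\<alpha>) = - (\<integral>x. (g x * \<phi> x) * s x \<partial>\<tau>)"
    by (rule div_eq_C1[OF Ck1_mult[OF g \<phi>1] K(1,2)]) (use K(3) in auto)
  also have "(\<integral>x. grad (\<lambda>x. g x * \<phi> x) x \<bullet> m x \<partial>\<alpha>)
      = (\<integral>x. (g x *\<^sub>R grad \<phi> x) \<bullet> m x + (\<phi> x *\<^sub>R grad g x) \<bullet> m x \<partial>\<alpha>)"
    using grad_mult[OF Ck1D(1)[OF g] Ck1D(1)[OF \<phi>1]]
    by (intro Bochner_Integration.integral_cong) (auto simp: space_\<alpha> inner_left_distrib)
  also have "\<dots> = (\<integral>x. (g x *\<^sub>R grad \<phi> x) \<bullet> m x \<partial>\<alpha>) + (\<integral>x. (\<phi> x *\<^sub>R grad g x) \<bullet> m x \<partial>\<alpha>)"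
    by (rule Bochner_Integration.integral_add[OF i1 i2])
  finally show ?thesis by (simp add: ac_simps)
qed

end

section \<open>Fields whose divergence is a measure\<close>

lemma bmeas_dominated2:
  fixes \<nu>1 \<nu>2 :: "'a::euclidean_space set \<Rightarrow> real"
  assumes "\<nu>1 \<in> bmeas \<Omega>" "\<nu>2 \<in> bmeas \<Omega>"
  obtains \<tau> where "sets \<tau> = Bor \<Omega>" "finite_measure \<tau>"
    "\<And>A. A \<in> Bor \<Omega> \<Longrightarrow> \<bar>\<nu>1 A\<bar> \<le> measure \<tau> A" "\<And>A. A \<in> Bor \<Omega> \<Longrightarrow> \<bar>\<nu>2 A\<bar> \<le> measure \<tau> A"
proof -
  obtain \<tau>1 where 1: "sets \<tau>1 = Bor \<Omega>" "finite_measure \<tau>1" "\<And>A. A \<in> Bor \<Omega> \<Longrightarrow> \<bar>\<nu>1 A\<bar> \<le> measure \<tau>1 A"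
    by (rule bmeas_dominated[OF assms(1)]) (assumption | rule that)+
  obtain \<tau>2 where 2: "sets \<tau>2 = Bor \<Omega>" "finite_measure \<tau>2" "\<And>A. A \<in> Bor \<Omega> \<Longrightarrow> \<bar>\<nu>2 A\<bar> \<le> measure \<tau>2 A"
    by (rule bmeas_dominated[OF assms(2)]) (assumption | rule that)+
  have "(\<lambda>A. measure \<tau>1 A + measure \<tau>2 A) \<in> bmeas \<Omega>"
    using bmeas_scaleR_add[OF measure_bmeas[OF 1(1,2)] measure_bmeas[OF 2(1,2)], of 1 1] by simp
  then obtain \<tau> where \<tau>: "sets \<tau> = Bor \<Omega>" "finite_measure \<tau>"
      "\<And>A. A \<in> Bor \<Omega> \<Longrightarrow> measure \<tau> A = measure \<tau>1 A + measure \<tau>2 A"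
    by (rule bmeas_nonneg_measure) (simp, rule that, assumption+)
  have "\<bar>\<nu>1 A\<bar> \<le> measure \<tau> A" "\<bar>\<nu>2 A\<bar> \<le> measure \<tau> A" if "A \<in> Bor \<Omega>" for A
    using 1(3)[OF that] 2(3)[OF that] \<tau>(3)[OF that] measure_nonneg[of \<tau>1 A] measure_nonneg[of \<tau>2 A]
    by linarith+
  then show thesis by (rule that[OF \<tau>(1,2)])
qed

text \<open>The real density is not assumed non-negative: its integrals over all sets are measures
  of sets, which forces the sign almost everywhere and permits passing to extended
  integrals.\<close>

lemma density_of_measure_eq:
  fixes a :: "'a \<Rightarrow> real"
  assumes sf: "sigma_finite_measure \<tau>" and fin: "finite_measure \<alpha>" and s: "sets \<alpha> = sets \<tau>"
    and a: "integrable \<tau> a" and eq: "\<And>A. A \<in> sets \<tau> \<Longrightarrow> measure \<alpha> A = (LINT x:A|\<tau>. a x)"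
  shows "AE x in \<tau>. 0 \<le> a x" and "\<alpha> = density \<tau> (\<lambda>x. ennreal (a x))"
proof -
  interpret \<tau>: sigma_finite_measure \<tau> by (rule sf)
  interpret finite_measure \<alpha> by (rule fin)
  show nn: "AE x in \<tau>. 0 \<le> a x"
    using eq by (intro \<tau>.density_nonneg[OF a]) (metis measure_nonneg)
  show "\<alpha> = density \<tau> (\<lambda>x. ennreal (a x))"
  proof (rule measure_eqI)
    fix A assume "A \<in> sets \<alpha>"
    then have A: "A \<in> sets \<tau>" using s by simp
    have "emeasure \<alpha> A = ennreal (\<integral>x. indicator A x * a x \<partial>\<tau>)"
      using eq[OF A] by (simp add: emeasure_eq_measure set_lebesgue_integral_def)
    also have "\<dots> = (\<integral>\<^sup>+x. ennreal (indicator A x * a x) \<partial>\<tau>)"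
      using integrable_mult_indicator[OF A a] nn
      by (intro nn_integral_eq_integral[symmetric]) (auto simp: indicator_def)
    also have "\<dots> = emeasure (density \<tau> (\<lambda>x. ennreal (a x))) A"
      using A a by (subst emeasure_density) (auto intro!: nn_integral_cong simp: indicator_def)
    finally show "emeasure \<alpha> A = emeasure (density \<tau> (\<lambda>x. ennreal (a x))) A" .
  qed (use s in simp)
qed

lemma test_bounded:
  assumes "\<phi> \<in> Cc_infty \<Omega>" "open \<Omega>"
  obtains B where "\<And>x. x \<in> \<Omega> \<Longrightarrow> \<bar>\<phi> x\<bar> \<le> B" "\<And>x. x \<in> \<Omega> \<Longrightarrow> norm (grad \<phi> x) \<le> B"
proof -
  obtain K where K: "compact K" "K \<subseteq> \<Omega>" "\<And>x. x \<in> \<Omega> \<Longrightarrow> x \<notin> K \<Longrightarrow> \<phi> x = 0"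
    by (rule Cc_infty_support[OF assms(1)]) (assumption | rule that)+
  note \<phi>1 = Ck1D(2,3)[OF Cc_infty_Ck[OF assms(1)]]
  obtain B1 where B1: "\<And>x. x \<in> \<Omega> \<Longrightarrow> norm (\<phi> x) \<le> B1"
    using compact_support_bounded[OF \<phi>1(2) K] by metis
  obtain B2 where B2: "\<And>x. x \<in> \<Omega> \<Longrightarrow> norm (grad \<phi> x) \<le> B2"
    using compact_support_bounded[OF \<phi>1(1) K(1,2)
      grad_zero_off_support[OF assms(2) compact_imp_closed[OF K(1)] K(3)]] by metis
  show thesis
    by (rule that[of "max B1 B2"]) (use B1 B2 in \<open>auto simp: le_max_iff_disj\<close>)
qed

lemma signed_integral_dens_bounded:
  fixes f :: "'a::euclidean_space \<Rightarrow> real"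
  assumes s: "sets \<tau> = Bor \<Omega>" and f: "integrable \<tau> f"
    and \<phi>: "continuous_on \<Omega> \<phi>" "\<And>x. x \<in> \<Omega> \<Longrightarrow> \<bar>\<phi> x\<bar> \<le> B"
  shows "integrable \<tau> (\<lambda>x. \<phi> x * f x)"
    and "signed_integral \<Omega> (dens \<Omega> \<tau> f) \<phi> = (\<integral>x. \<phi> x * f x \<partial>\<tau>)"
proof -
  note m = measurable_of_continuous_on[OF s \<phi>(1)]
  show i: "integrable \<tau> (\<lambda>x. \<phi> x * f x)"
    by (rule integrable_bounded_mult[OF f m \<phi>(2)]) (simp add: space_eq_of_sets_Bor[OF s])
  show "signed_integral \<Omega> (dens \<Omega> \<tau> f) \<phi> = (\<integral>x. \<phi> x * f x \<partial>\<tau>)"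
    by (rule signed_integral_dens[OF s f m i])
qed

lemma signed_integral_dens_test:
  fixes f :: "'a::euclidean_space \<Rightarrow> real"
  assumes "open \<Omega>" and s: "sets \<tau> = Bor \<Omega>" and f: "integrable \<tau> f" and \<phi>: "\<phi> \<in> Cc_infty \<Omega>"
  shows "integrable \<tau> (\<lambda>x. \<phi> x * f x)"
    and "signed_integral \<Omega> (dens \<Omega> \<tau> f) \<phi> = (\<integral>x. \<phi> x * f x \<partial>\<tau>)"
proof -
  obtain B where B: "\<And>x. x \<in> \<Omega> \<Longrightarrow> \<bar>\<phi> x\<bar> \<le> B"
    by (rule test_bounded[OF \<phi> assms(1)]) (assumption | rule that)+
  note \<phi>c = Ck1D(3)[OF Cc_infty_Ck[OF \<phi>]]
  show "integrable \<tau> (\<lambda>x. \<phi> x * f x)"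
    and "signed_integral \<Omega> (dens \<Omega> \<tau> f) \<phi> = (\<integral>x. \<phi> x * f x \<partial>\<tau>)"
    by (rule signed_integral_dens_bounded[OF s f \<phi>c B]; assumption)+
qed

lemma vector_integral_dens_test:
  fixes m :: "'a::euclidean_space \<Rightarrow> 'a"
  assumes "open \<Omega>" and s: "sets \<tau> = Bor \<Omega>" and m: "integrable \<tau> m" and \<phi>: "\<phi> \<in> Cc_infty \<Omega>"
  shows "vector_integral \<Omega> (dens \<Omega> \<tau> m) (grad \<phi>) = (\<integral>x. grad \<phi> x \<bullet> m x \<partial>\<tau>)"
proof -
  obtain B where B: "\<And>x. x \<in> \<Omega> \<Longrightarrow> norm (grad \<phi> x) \<le> B"
    by (rule test_bounded[OF \<phi> assms(1)]) (assumption | rule that)+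
  show ?thesis
    by (rule vector_integral_dens[OF s m measurable_of_continuous_on[OF s Ck1D(2)[OF Cc_infty_Ck[OF \<phi>]]] B])
qed

section \<open>Uniqueness of the divergence and variation of scaled densities\<close>

text \<open>Relative to one measure dominating both candidates, the difference of their densities is
  annihilated by every test function. This makes the definite description in
  \<open>div_measure\<close> meaningful.\<close>

lemma has_div_measure_unique:
  assumes op: "open \<Omega>" and 1: "has_div_measure \<Omega> \<mu> \<sigma>1" and 2: "has_div_measure \<Omega> \<mu> \<sigma>2"
  shows "\<sigma>1 = \<sigma>2"
proof -
  have b: "\<sigma>1 \<in> bmeas \<Omega>" "\<sigma>2 \<in> bmeas \<Omega>" using 1 2 by (auto simp: has_div_measure_def)
  obtain \<tau> where s: "sets \<tau> = Bor \<Omega>" and fin: "finite_measure \<tau>"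
    and d1: "\<And>A. A \<in> Bor \<Omega> \<Longrightarrow> \<bar>\<sigma>1 A\<bar> \<le> measure \<tau> A" and d2: "\<And>A. A \<in> Bor \<Omega> \<Longrightarrow> \<bar>\<sigma>2 A\<bar> \<le> measure \<tau> A"
    by (rule bmeas_dominated2[OF b]) (assumption | rule that)+
  interpret finite_measure \<tau> by (rule fin)
  obtain f1 where f1: "integrable \<tau> f1" "\<sigma>1 = dens \<Omega> \<tau> f1"
    by (rule dominated_dens[OF b(1) s fin d1]) (assumption | rule that)+
  obtain f2 where f2: "integrable \<tau> f2" "\<sigma>2 = dens \<Omega> \<tau> f2"
    by (rule dominated_dens[OF b(2) s fin d2]) (assumption | rule that)+
  have f: "integrable \<tau> (\<lambda>x. f1 x - f2 x)" using f1 f2 by simp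
  have "AE x in \<tau>. f1 x - f2 x = 0"
  proof (rule AE_zero_of_tests[OF op s sigma_finite_measure_axioms])
    show "integrable \<tau> (\<lambda>x. indicator K x * (f1 x - f2 x))" if "compact K" "K \<subseteq> \<Omega>" for K
      using that integrable_mult_indicator[OF _ f, of K] s Bor_iff[OF op, of K] by (simp add: borel_compact)
    fix \<phi> assume \<phi>: "\<phi> \<in> Cc_infty \<Omega>"
    note t1 = signed_integral_dens_test[OF op s f1(1) \<phi>] and t2 = signed_integral_dens_test[OF op s f2(1) \<phi>]
    have "(\<integral>x. \<phi> x * f1 x \<partial>\<tau>) = (\<integral>x. \<phi> x * f2 x \<partial>\<tau>)"
      using 1 2 \<phi> unfolding has_div_measure_def t1(2)[symmetric] t2(2)[symmetric] f1(2) f2(2) by force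
    then show "(\<integral>x. \<phi> x * (f1 x - f2 x) \<partial>\<tau>) = 0"
      using Bochner_Integration.integral_diff[OF t1(1) t2(1)] by (simp add: right_diff_distrib)
  qed (use f in auto)
  then have ae: "AE x in \<tau>. f1 x = f2 x" by auto
  show ?thesis
  proof
    fix A
    have "(LINT x:A|\<tau>. f1 x) = (LINT x:A|\<tau>. f2 x)" if "A \<in> sets \<tau>"
      unfolding set_lebesgue_integral_def by (rule integral_cong_AE) (use that f1 f2 ae in auto)
    then show "\<sigma>1 A = \<sigma>2 A" using s by (simp add: f1(2) f2(2) dens_def)
  qed
qed

lemma div_measure_eqI:
  assumes "open \<Omega>" "has_div_measure \<Omega> \<mu> \<sigma>"
  shows "div_measure \<Omega> \<mu> = \<sigma>"
  unfolding div_measure_def using assms has_div_measure_unique[OF assms(1)] by blast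

lemma variation_le_imp_density:
  fixes \<mu> :: "'a::euclidean_space set \<Rightarrow> 'b::euclidean_space"
  assumes \<mu>: "\<mu> \<in> bmeas \<Omega>" and \<alpha>: "\<alpha> \<in> pos_bmeas \<Omega>" and le: "variation_le \<Omega> \<mu> \<alpha>"
  obtains m where "integrable \<alpha> m" "\<And>x. norm (m x) \<le> 1" "\<mu> = dens \<Omega> \<alpha> m"
proof -
  have s: "sets \<alpha> = Bor \<Omega>" and fin: "finite_measure \<alpha>" using \<alpha> by (auto simp: pos_bmeas_def)
  interpret finite_measure \<alpha> by (rule fin)
  have "norm (\<mu> A) \<le> measure \<alpha> A" if "A \<in> Bor \<Omega>" for A
  proof -
    have "ennreal (norm (\<mu> A)) \<le> emeasure \<alpha> A"
      using norm_le_total_variation[OF \<mu> that] le that unfolding variation_le_def by (meson order_trans)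
    then show ?thesis by (simp add: emeasure_eq_measure)
  qed
  then show thesis
    by (rule dominated_dens_vector[OF \<mu> s fin]) (assumption | rule that)+
qed

lemma
  fixes m :: "'a::euclidean_space \<Rightarrow> 'b::euclidean_space"
  assumes s: "sets \<alpha> = Bor \<Omega>" and fin: "finite_measure \<alpha>"
    and m: "integrable \<alpha> m" "\<And>x. norm (m x) \<le> 1"
    and g: "continuous_on \<Omega> g" "\<And>x. x \<in> \<Omega> \<Longrightarrow> \<bar>g x\<bar> \<le> B"
  shows integrable_scaled_density: "integrable \<alpha> (\<lambda>x. g x *\<^sub>R m x)"
    and M_norm_scaled_density_le:
      "M_norm \<Omega> (dens \<Omega> \<alpha> (\<lambda>x. g x *\<^sub>R m x)) \<le> ennreal (B * measure \<alpha> \<Omega>)"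
proof -
  interpret finite_measure \<alpha> by (rule fin)
  have le: "norm (g x *\<^sub>R m x) \<le> B" if "x \<in> space \<alpha>" for x
  proof -
    have "\<bar>g x\<bar> * norm (m x) \<le> B * 1"
      using g(2)[of x] m(2)[of x] that space_eq_of_sets_Bor[OF s] by (intro mult_mono) auto
    then show ?thesis by simp
  qed
  show i: "integrable \<alpha> (\<lambda>x. g x *\<^sub>R m x)"
    by (rule integrable_const_bound[OF AE_I2[OF le]])
      (use measurable_of_continuous_on[OF s g(1)] m(1) in auto)
  have "M_norm \<Omega> (dens \<Omega> \<alpha> (\<lambda>x. g x *\<^sub>R m x)) \<le> ennreal (\<integral>x. norm (g x *\<^sub>R m x) \<partial>\<alpha>)"
    by (rule M_norm_dens_le[OF s i])
  also have "(\<integral>x. norm (g x *\<^sub>R m x) \<partial>\<alpha>) \<le> (\<integral>x. B \<partial>\<alpha>)"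
    by (rule integral_mono[OF integrable_norm[OF i] _ le]) auto
  finally show "M_norm \<Omega> (dens \<Omega> \<alpha> (\<lambda>x. g x *\<^sub>R m x)) \<le> ennreal (B * measure \<alpha> \<Omega>)"
    by (simp add: space_eq_of_sets_Bor[OF s] mult.commute ennreal_leI)
qed

text \<open>Since \<open>\<bar>m\<bar> \<le> 1\<close>, the norm of the measure of \<open>A\<close>
  is at most the integral of \<open>g\<close> over \<open>A\<close>, once \<open>g \<ge> 0\<close>
  is known almost everywhere; that integral is the absolutely continuous part of
  \<open>\<alpha>' A\<close>.\<close>

lemma variation_le_scaled_density:
  fixes m :: "'a::euclidean_space \<Rightarrow> 'b::euclidean_space"
  assumes \<alpha>: "\<alpha> \<in> pos_bmeas \<Omega>" and \<alpha>': "\<alpha>' \<in> pos_bmeas \<Omega>"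
    and m: "integrable \<alpha> m" "\<And>x. norm (m x) \<le> 1"
    and i: "integrable \<alpha> (\<lambda>x. g x *\<^sub>R m x)"
    and dec: "lebesgue_decomposition \<Omega> \<alpha>' \<alpha> g \<alpha>s"
  shows "variation_le \<Omega> (dens \<Omega> \<alpha> (\<lambda>x. g x *\<^sub>R m x)) \<alpha>'"
  unfolding variation_le_def
proof
  fix C assume "C \<in> Bor \<Omega>"
  have s: "sets \<alpha> = Bor \<Omega>" "sets \<alpha>' = Bor \<Omega>" and fin: "finite_measure \<alpha>" "finite_measure \<alpha>'"
    using \<alpha> \<alpha>' by (auto simp: pos_bmeas_def)
  interpret finite_measure \<alpha> by (rule fin)
  interpret \<alpha>': finite_measure \<alpha>' by (rule fin)
  have gi: "integrable \<alpha> g"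
    and eq: "\<And>A. A \<in> Bor \<Omega> \<Longrightarrow> measure \<alpha>' A = (LINT x:A|\<alpha>. g x) + measure \<alpha>s A"
    and sing: "mutually_singular \<alpha>s \<alpha>"
    using dec by (auto simp: lebesgue_decomposition_def)
  obtain S where S: "S \<in> sets \<alpha>s" "S \<in> sets \<alpha>" "emeasure \<alpha>s S = 0" "emeasure \<alpha> (space \<alpha> - S) = 0"
    using sing by (auto simp: mutually_singular_def)
  \<comment> \<open>The sign of \<open>g\<close> is visible on the set \<open>S\<close>, which
    carries all of \<open>\<alpha>\<close> and nothing of the singular part: inside \<open>S\<close>
    the integrals of \<open>g\<close> are values of \<open>\<alpha>'\<close>.\<close>
  have g_nonneg: "AE x in \<alpha>. 0 \<le> g x"
  proof (rule density_nonneg[OF gi])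
    fix A assume A: "A \<in> sets \<alpha>"
    have "AE x in \<alpha>. x \<in> S"
      by (rule AE_I[of _ _ "space \<alpha> - S"]) (use S in auto)
    then have "(LINT x:A|\<alpha>. g x) = (LINT x:A \<inter> S|\<alpha>. g x)"
      unfolding set_lebesgue_integral_def
      using A S gi by (intro integral_cong_AE) (auto simp: indicator_def)
    also have "\<dots> = measure \<alpha>' (A \<inter> S) - measure \<alpha>s (A \<inter> S)"
      using eq[of "A \<inter> S"] A S s by auto
    also have "measure \<alpha>s (A \<inter> S) = 0"
      using emeasure_mono[of "A \<inter> S" S \<alpha>s] S by (simp add: measure_def)
    finally show "0 \<le> (LINT x:A|\<alpha>. g x)" by simp
  qed
  show "total_variation \<Omega> (dens \<Omega> \<alpha> (\<lambda>x. g x *\<^sub>R m x)) C \<le> emeasure \<alpha>' C"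
  proof (rule total_variation_le[OF s(2)])
    fix A assume A: "A \<in> Bor \<Omega>"
    then have As: "A \<in> sets \<alpha>" using s by simp
    have "norm (dens \<Omega> \<alpha> (\<lambda>x. g x *\<^sub>R m x) A) \<le> (\<integral>x. norm (indicator A x *\<^sub>R (g x *\<^sub>R m x)) \<partial>\<alpha>)"
      using A integral_norm_bound[of \<alpha> "\<lambda>x. indicator A x *\<^sub>R (g x *\<^sub>R m x)"]
      by (simp only: dens_def set_lebesgue_integral_def if_True)
    also have "\<dots> \<le> (\<integral>x. indicator A x *\<^sub>R g x \<partial>\<alpha>)"
    proof (rule integral_mono_AE)
      show "AE x in \<alpha>. norm (indicator A x *\<^sub>R (g x *\<^sub>R m x)) \<le> indicator A x *\<^sub>R g x"
        using g_nonneg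
      proof eventually_elim
        case (elim x)
        then show ?case using m(2)[of x] by (auto simp: indicator_def mult_left_le)
      qed
    next
      show "integrable \<alpha> (\<lambda>x. norm (indicator A x *\<^sub>R (g x *\<^sub>R m x)))"
        by (rule integrable_norm[OF integrable_mult_indicator[OF As i]])
      show "integrable \<alpha> (\<lambda>x. indicator A x *\<^sub>R g x)"
        by (rule integrable_mult_indicator[OF As gi])
    qed
    also have "\<dots> \<le> measure \<alpha>' A"
      using eq[OF A] by (simp add: set_lebesgue_integral_def)
    finally show "ennreal (norm (dens \<Omega> \<alpha> (\<lambda>x. g x *\<^sub>R m x) A)) \<le> emeasure \<alpha>' A"
      by (simp add: \<alpha>'.emeasure_eq_measure)
  qed
qed

context div_field begin

lemma measurable_\<alpha>_\<tau>: "f \<in> borel_measurable \<alpha> \<longleftrightarrow> f \<in> borel_measurable \<tau>"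
proof -
  have "sets \<alpha> = sets \<tau>" using s\<alpha> s\<tau> by simp
  from measurable_cong_sets[OF this refl] show ?thesis by blast
qed

lemma integrable_grad_m:
  assumes "g \<in> Ck 1 \<Omega>" "integrable \<alpha> (grad g)"
  shows "integrable \<alpha> (\<lambda>x. grad g x \<bullet> m x)"
    and "(\<integral>x. \<bar>grad g x \<bullet> m x\<bar> \<partial>\<alpha>) \<le> (\<integral>x. norm (grad g x) \<partial>\<alpha>)"
proof -
  have b: "\<bar>grad g x \<bullet> m x\<bar> \<le> norm (grad g x)" for x
    using order_trans[OF Cauchy_Schwarz_ineq2 mult_left_mono[OF m_le[of x] norm_ge_zero[of "grad g x"]]]
    by simp
  show i: "integrable \<alpha> (\<lambda>x. grad g x \<bullet> m x)"
    by (rule Bochner_Integration.integrable_bound[OF integrable_norm[OF assms(2)]])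
      (use assms(2) m_int b in auto)
  show "(\<integral>x. \<bar>grad g x \<bullet> m x\<bar> \<partial>\<alpha>) \<le> (\<integral>x. norm (grad g x) \<partial>\<alpha>)"
    by (rule integral_mono[OF integrable_abs[OF i] integrable_norm[OF assms(2)] b])
qed

text \<open>Here \<open>\<phi>\<close> has no compact support, so integrability of the two terms of
  the product rule comes from bounds on \<open>g\<close>, \<open>\<phi>\<close> and their
  gradients.\<close>

lemma trace_mult:
  assumes g: "g \<in> Cb1 \<Omega>" and \<phi>: "\<phi> \<in> Cb1 \<Omega>"
  shows "vector_integral \<Omega> (dens \<Omega> \<alpha> (\<lambda>x. g x *\<^sub>R m x)) (grad \<phi>)
      + (\<integral>x. \<phi> x * (grad g x \<bullet> m x) \<partial>\<alpha>)
    = vector_integral \<Omega> (dens \<Omega> \<alpha> m) (grad (\<lambda>x. g x * \<phi> x))"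
proof -
  have C: "g \<in> Ck 1 \<Omega>" "\<phi> \<in> Ck 1 \<Omega>" using g \<phi> by (auto simp: Cb1_def)
  have gp: "(\<lambda>x. g x * \<phi> x) \<in> Cb1 \<Omega>" by (rule Cb1_mult[OF g \<phi>])
  then have gpC: "(\<lambda>x. g x * \<phi> x) \<in> Ck 1 \<Omega>" by (simp add: Cb1_def)
  obtain B where B: "B \<ge> 0" "\<And>x. x \<in> \<Omega> \<Longrightarrow> \<bar>g x\<bar> \<le> B" "\<And>x. x \<in> \<Omega> \<Longrightarrow> norm (grad g x) \<le> B"
    by (rule Cb1_bounded[OF g]) (assumption | rule that)+
  obtain B' where B': "B' \<ge> 0" "\<And>x. x \<in> \<Omega> \<Longrightarrow> \<bar>\<phi> x\<bar> \<le> B'" "\<And>x. x \<in> \<Omega> \<Longrightarrow> norm (grad \<phi> x) \<le> B'"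
    by (rule Cb1_bounded[OF \<phi>]) (assumption | rule that)+
  obtain B'' where B'': "\<And>x. x \<in> \<Omega> \<Longrightarrow> norm (grad (\<lambda>x. g x * \<phi> x) x) \<le> B''"
    by (rule Cb1_bounded[OF gp]) (assumption | rule that)+
  have c: "continuous_on \<Omega> (\<lambda>x. g x *\<^sub>R grad \<phi> x)" "continuous_on \<Omega> (\<lambda>x. \<phi> x *\<^sub>R grad g x)"
    using C by (auto intro!: continuous_intros Ck1D)
  have i1: "integrable \<alpha> (\<lambda>x. (g x *\<^sub>R grad \<phi> x) \<bullet> m x)"
    by (rule integrable_inner_m[OF measurable_of_continuous_on[OF s\<alpha> c(1)], of "B * B'"])
      (use B B' in \<open>auto intro!: mult_mono\<close>)
  have i2: "integrable \<alpha> (\<lambda>x. (\<phi> x *\<^sub>R grad g x) \<bullet> m x)"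
    by (rule integrable_inner_m[OF measurable_of_continuous_on[OF s\<alpha> c(2)], of "B' * B"])
      (use B B' in \<open>auto intro!: mult_mono\<close>)
  have "vector_integral \<Omega> (dens \<Omega> \<alpha> m) (grad (\<lambda>x. g x * \<phi> x)) = (\<integral>x. grad (\<lambda>x. g x * \<phi> x) x \<bullet> m x \<partial>\<alpha>)"
    by (rule vector_integral_dens[OF s\<alpha> m_int measurable_of_continuous_on[OF s\<alpha> Ck1D(2)[OF gpC]] B''])
  also have "\<dots> = (\<integral>x. (g x *\<^sub>R grad \<phi> x) \<bullet> m x + (\<phi> x *\<^sub>R grad g x) \<bullet> m x \<partial>\<alpha>)"
    using grad_mult[OF Ck1D(1)[OF C(1)] Ck1D(1)[OF C(2)]]
    by (intro Bochner_Integration.integral_cong) (auto simp: space_\<alpha> inner_left_distrib)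
  also have "\<dots> = (\<integral>x. (g x *\<^sub>R grad \<phi> x) \<bullet> m x \<partial>\<alpha>) + (\<integral>x. (\<phi> x *\<^sub>R grad g x) \<bullet> m x \<partial>\<alpha>)"
    by (rule Bochner_Integration.integral_add[OF i1 i2])
  also have "(\<integral>x. (g x *\<^sub>R grad \<phi> x) \<bullet> m x \<partial>\<alpha>) = (\<integral>x. grad \<phi> x \<bullet> (g x *\<^sub>R m x) \<partial>\<alpha>)" by simp
  also have "\<dots> = vector_integral \<Omega> (dens \<Omega> \<alpha> (\<lambda>x. g x *\<^sub>R m x)) (grad \<phi>)"
    by (rule vector_integral_dens[OF s\<alpha> integrable_scaled_density[OF s\<alpha> fin\<alpha> m_int m_le Ck1D(3)[OF C(1)] B(2)]
        measurable_of_continuous_on[OF s\<alpha> Ck1D(2)[OF C(2)]] B'(3), symmetric])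
  finally show ?thesis by simp
qed

end

text \<open>The product rule adds a multiple of \<open>div \<mu>\<close> and a multiple of
  \<open>\<alpha>\<close>. Writing also \<open>\<alpha> = a \<tau>\<close> gives the sum a single
  density with respect to \<open>\<tau>\<close>, to which the integration lemmas apply.\<close>

locale DM_field = div_field \<Omega> \<alpha> m \<tau> s
  for \<Omega> :: "'a::euclidean_space set" and \<alpha> m \<tau> s +
  fixes a :: "'a \<Rightarrow> real"
  assumes fin\<tau>: "finite_measure \<tau>" and s_integrable: "integrable \<tau> s"
    and a_meas: "a \<in> borel_measurable \<tau>" and a_nonneg: "\<And>x. 0 \<le> a x"
    and \<alpha>_eq: "\<alpha> = density \<tau> (\<lambda>x. ennreal (a x))"
begin

lemma
  fixes k :: "'a \<Rightarrow> real"
  assumes "integrable \<alpha> k"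
  shows integrable_\<tau>: "integrable \<tau> (\<lambda>x. a x * k x)"
    and integral_\<tau>: "(\<integral>x. k x \<partial>\<alpha>) = (\<integral>x. a x * k x \<partial>\<tau>)"
proof -
  have k: "k \<in> borel_measurable \<tau>" using assms measurable_\<alpha>_\<tau> by auto
  show "integrable \<tau> (\<lambda>x. a x * k x)"
    using assms integrable_density[OF k a_meas] a_nonneg unfolding \<alpha>_eq by simp
  show "(\<integral>x. k x \<partial>\<alpha>) = (\<integral>x. a x * k x \<partial>\<tau>)"
    using integral_density[OF k a_meas] a_nonneg unfolding \<alpha>_eq by simp
qed

definition div_dens :: "('a \<Rightarrow> real) \<Rightarrow> 'a \<Rightarrow> real" where
  "div_dens g x = g x * s x + a x * (grad g x \<bullet> m x)"

text \<open>In the norm bound the gradient term is carried back from \<open>\<tau>\<close> to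
  \<open>\<alpha>\<close>, where \<open>\<bar>m\<bar> \<le> 1\<close> leaves the integral of
  \<open>norm (grad g)\<close>, the quantity assumed to tend to 0.\<close>

lemma div_dens:
  assumes g: "g \<in> Ck 1 \<Omega>" and B: "\<And>x. x \<in> \<Omega> \<Longrightarrow> \<bar>g x\<bar> \<le> B" and gi: "integrable \<alpha> (grad g)"
  shows "integrable \<tau> (\<lambda>x. g x * s x)" and "integrable \<tau> (div_dens g)"
    and "M_norm \<Omega> (dens \<Omega> \<tau> (div_dens g)) \<le> ennreal (B * (\<integral>x. \<bar>s x\<bar> \<partial>\<tau>) + (\<integral>x. norm (grad g x) \<partial>\<alpha>))"
    and "has_div_measure \<Omega> (dens \<Omega> \<alpha> (\<lambda>x. g x *\<^sub>R m x)) (dens \<Omega> \<tau> (div_dens g))"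
proof -
  note gm = integrable_grad_m[OF g gi]
  have r: "integrable \<tau> (\<lambda>x. a x * (grad g x \<bullet> m x))" by (rule integrable_\<tau>[OF gm(1)])
  show gs: "integrable \<tau> (\<lambda>x. g x * s x)"
    by (rule signed_integral_dens_bounded(1)[OF s\<tau> s_integrable Ck1D(3)[OF g] B])
  show d: "integrable \<tau> (div_dens g)"
    unfolding div_dens_def[abs_def] by (rule Bochner_Integration.integrable_add[OF gs r])
  have "(\<integral>x. norm (div_dens g x) \<partial>\<tau>) \<le> (\<integral>x. B * \<bar>s x\<bar> + a x * \<bar>grad g x \<bullet> m x\<bar> \<partial>\<tau>)"
  proof (rule integral_mono)
    fix x assume "x \<in> space \<tau>"
    then have "\<bar>g x * s x\<bar> \<le> B * \<bar>s x\<bar>"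
      using B[of x] by (simp add: space_\<tau> abs_mult mult_right_mono)
    then show "norm (div_dens g x) \<le> B * \<bar>s x\<bar> + a x * \<bar>grad g x \<bullet> m x\<bar>"
      using a_nonneg[of x] abs_triangle_ineq[of "g x * s x" "a x * (grad g x \<bullet> m x)"]
      by (simp add: div_dens_def abs_mult)
  next
    show "integrable \<tau> (\<lambda>x. norm (div_dens g x))" using d by (rule integrable_norm)
    show "integrable \<tau> (\<lambda>x. B * \<bar>s x\<bar> + a x * \<bar>grad g x \<bullet> m x\<bar>)"
      using s_integrable integrable_\<tau>[OF integrable_abs[OF gm(1)]] by simp
  qed
  also have "\<dots> = B * (\<integral>x. \<bar>s x\<bar> \<partial>\<tau>) + (\<integral>x. \<bar>grad g x \<bullet> m x\<bar> \<partial>\<alpha>)"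
    using s_integrable integrable_\<tau>[OF integrable_abs[OF gm(1)]] integral_\<tau>[OF integrable_abs[OF gm(1)]]
    by simp
  also have "\<dots> \<le> B * (\<integral>x. \<bar>s x\<bar> \<partial>\<tau>) + (\<integral>x. norm (grad g x) \<partial>\<alpha>)"
    using gm(2) by simp
  finally show "M_norm \<Omega> (dens \<Omega> \<tau> (div_dens g))
      \<le> ennreal (B * (\<integral>x. \<bar>s x\<bar> \<partial>\<tau>) + (\<integral>x. norm (grad g x) \<partial>\<alpha>))"
    by (intro order_trans[OF M_norm_dens_le[OF s\<tau> d] ennreal_leI])
  show "has_div_measure \<Omega> (dens \<Omega> \<alpha> (\<lambda>x. g x *\<^sub>R m x)) (dens \<Omega> \<tau> (div_dens g))"
    unfolding has_div_measure_def
  proof (intro conjI ballI)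
    show "dens \<Omega> \<tau> (div_dens g) \<in> bmeas \<Omega>" by (rule dens_bmeas[OF s\<tau> d])
    fix \<phi> assume \<phi>: "\<phi> \<in> Cc_infty \<Omega>"
    note gi' = integrable_scaled_density[OF s\<alpha> fin\<alpha> m_int m_le Ck1D(3)[OF g] B]
    have "(\<integral>x. \<phi> x * div_dens g x \<partial>\<tau>)
        = (\<integral>x. \<phi> x * (g x * s x) + \<phi> x * (a x * (grad g x \<bullet> m x)) \<partial>\<tau>)"
      by (simp add: div_dens_def algebra_simps)
    also have "\<dots> = (\<integral>x. \<phi> x * (g x * s x) \<partial>\<tau>) + (\<integral>x. \<phi> x * (a x * (grad g x \<bullet> m x)) \<partial>\<tau>)"
      by (intro Bochner_Integration.integral_add signed_integral_dens_test(1)[OF op s\<tau> _ \<phi>] gs r)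
    also have "(\<integral>x. \<phi> x * (a x * (grad g x \<bullet> m x)) \<partial>\<tau>) = (\<integral>x. \<phi> x * (grad g x \<bullet> m x) \<partial>\<alpha>)"
      using integral_\<tau>[OF signed_integral_dens_test(1)[OF op s\<alpha> gm(1) \<phi>]] by (simp add: algebra_simps)
    finally have 1: "(\<integral>x. \<phi> x * div_dens g x \<partial>\<tau>)
        = (\<integral>x. \<phi> x * (g x * s x) \<partial>\<tau>) + (\<integral>x. \<phi> x * (grad g x \<bullet> m x) \<partial>\<alpha>)" .
    have v: "vector_integral \<Omega> (dens \<Omega> \<alpha> (\<lambda>x. g x *\<^sub>R m x)) (grad \<phi>)
        = (\<integral>x. grad \<phi> x \<bullet> (g x *\<^sub>R m x) \<partial>\<alpha>)"
      by (rule vector_integral_dens_test[OF op s\<alpha> gi' \<phi>])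
    show "vector_integral \<Omega> (dens \<Omega> \<alpha> (\<lambda>x. g x *\<^sub>R m x)) (grad \<phi>)
        = - signed_integral \<Omega> (dens \<Omega> \<tau> (div_dens g)) \<phi>"
      unfolding signed_integral_dens_test(2)[OF op s\<tau> d \<phi>] v 1
      using div_mult_tests[OF g \<phi>] by simp
  qed
qed

text \<open>The term \<open>\<phi> \<nabla>g \<cdot> \<mu>\<close> contributed by the divergence of
  \<open>g \<mu>\<close> joins \<open>g \<nabla>\<phi> \<cdot> \<mu>\<close> to form the gradient of
  \<open>g \<phi>\<close>. The factor \<open>g\<close> thus moves from the field to the test
  function.\<close>

lemma normal_trace_mult:
  assumes g: "g \<in> Cb1_closure \<Omega>" and gi: "integrable \<alpha> (grad g)" and \<phi>: "\<phi> \<in> Cb1_closure \<Omega>"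
    and div: "div_measure \<Omega> (dens \<Omega> \<alpha> m) = dens \<Omega> \<tau> s"
  shows "normal_trace_DM \<Omega> \<phi> (dens \<Omega> \<alpha> (\<lambda>x. g x *\<^sub>R m x))
    = normal_trace_DM \<Omega> (\<lambda>x. g x * \<phi> x) (dens \<Omega> \<alpha> m)"
proof -
  have gC: "g \<in> Cb1 \<Omega>" "g \<in> Ck 1 \<Omega>" and \<phi>C: "\<phi> \<in> Cb1 \<Omega>" "\<phi> \<in> Ck 1 \<Omega>"
    using g \<phi> by (auto simp: Cb1_closure_def Cb1_def)
  have gp: "(\<lambda>x. g x * \<phi> x) \<in> Cb1 \<Omega>" by (rule Cb1_mult[OF gC(1) \<phi>C(1)])
  then have gpC: "(\<lambda>x. g x * \<phi> x) \<in> Ck 1 \<Omega>" by (simp add: Cb1_def)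
  obtain B where B: "\<And>x. x \<in> \<Omega> \<Longrightarrow> \<bar>g x\<bar> \<le> B"
    by (rule Cb1_bounded[OF gC(1)]) (assumption | rule that)+
  obtain B' where B': "\<And>x. x \<in> \<Omega> \<Longrightarrow> \<bar>\<phi> x\<bar> \<le> B'"
    by (rule Cb1_bounded[OF \<phi>C(1)]) (assumption | rule that)+
  obtain B'' where B'': "\<And>x. x \<in> \<Omega> \<Longrightarrow> \<bar>g x * \<phi> x\<bar> \<le> B''"
    by (rule Cb1_bounded[OF gp]) (assumption | rule that)+
  note d = div_dens[OF gC(2) B gi]
  note gm = integrable_grad_m[OF gC(2) gi]
  note r = integrable_\<tau>[OF gm(1)]
  note bi = signed_integral_dens_bounded[OF _ _ Ck1D(3)[OF \<phi>C(2)] B']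
  have "(\<integral>x. \<phi> x * div_dens g x \<partial>\<tau>)
      = (\<integral>x. \<phi> x * (g x * s x) + \<phi> x * (a x * (grad g x \<bullet> m x)) \<partial>\<tau>)"
    by (simp add: div_dens_def algebra_simps)
  also have "\<dots> = (\<integral>x. \<phi> x * (g x * s x) \<partial>\<tau>) + (\<integral>x. \<phi> x * (a x * (grad g x \<bullet> m x)) \<partial>\<tau>)"
    by (intro Bochner_Integration.integral_add bi(1)[OF s\<tau>] d r)
  also have "(\<integral>x. \<phi> x * (a x * (grad g x \<bullet> m x)) \<partial>\<tau>) = (\<integral>x. \<phi> x * (grad g x \<bullet> m x) \<partial>\<alpha>)"
    using integral_\<tau>[OF bi(1)[OF s\<alpha> gm(1)]] by (simp add: algebra_simps)
  finally have 1: "(\<integral>x. \<phi> x * div_dens g x \<partial>\<tau>)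
      = (\<integral>x. \<phi> x * (g x * s x) \<partial>\<tau>) + (\<integral>x. \<phi> x * (grad g x \<bullet> m x) \<partial>\<alpha>)" .
  have s2: "signed_integral \<Omega> (dens \<Omega> \<tau> s) (\<lambda>x. g x * \<phi> x) = (\<integral>x. (g x * \<phi> x) * s x \<partial>\<tau>)"
    by (rule signed_integral_dens_bounded(2)[OF s\<tau> s_integrable Ck1D(3)[OF gpC] B''])
  have dv: "div_measure \<Omega> (dens \<Omega> \<alpha> (\<lambda>x. g x *\<^sub>R m x)) = dens \<Omega> \<tau> (div_dens g)"
    by (rule div_measure_eqI[OF op d(4)])
  have s1: "signed_integral \<Omega> (dens \<Omega> \<tau> (div_dens g)) \<phi> = (\<integral>x. \<phi> x * div_dens g x \<partial>\<tau>)"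
    by (rule bi(2)[OF s\<tau> d(2)])
  show ?thesis
    unfolding normal_trace_DM_def div dv s1 s2 1
    using trace_mult[OF gC(1) \<phi>C(1)] by (simp add: algebra_simps)
qed

end

text \<open>Any finite measure dominating both the divergence and \<open>\<alpha>\<close> can serve
  as \<open>\<tau>\<close>; both densities then come from \<open>dominated_dens\<close>.\<close>

lemma DM_representation:
  assumes op: "open \<Omega>" and \<alpha>: "\<alpha> \<in> pos_bmeas \<Omega>" and \<mu>: "\<mu> \<in> DM \<Omega>" and le: "variation_le \<Omega> \<mu> \<alpha>"
  obtains m \<tau> s a where "DM_field \<Omega> \<alpha> m \<tau> s a" "\<mu> = dens \<Omega> \<alpha> m" "div_measure \<Omega> \<mu> = dens \<Omega> \<tau> s"
proof -
  have s\<alpha>: "sets \<alpha> = Bor \<Omega>" and fin: "finite_measure \<alpha>" using \<alpha> by (auto simp: pos_bmeas_def)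
  obtain \<sigma> where \<mu>b: "\<mu> \<in> bmeas \<Omega>" and \<sigma>: "has_div_measure \<Omega> \<mu> \<sigma>" using \<mu> by (auto simp: DM_def)
  have \<sigma>b: "\<sigma> \<in> bmeas \<Omega>" using \<sigma> by (simp add: has_div_measure_def)
  obtain m where m: "integrable \<alpha> m" "\<And>x. norm (m x) \<le> 1" "\<mu> = dens \<Omega> \<alpha> m"
    by (rule variation_le_imp_density[OF \<mu>b \<alpha> le]) (assumption | rule that)+
  note \<alpha>b = measure_bmeas[OF s\<alpha> fin]
  obtain \<tau> where s\<tau>: "sets \<tau> = Bor \<Omega>" and fin\<tau>: "finite_measure \<tau>"
    and d1: "\<And>A. A \<in> Bor \<Omega> \<Longrightarrow> \<bar>\<sigma> A\<bar> \<le> measure \<tau> A" and d2: "\<And>A. A \<in> Bor \<Omega> \<Longrightarrow> \<bar>measure \<alpha> A\<bar> \<le> measure \<tau> A"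
    by (rule bmeas_dominated2[OF \<sigma>b \<alpha>b]) (assumption | rule that)+
  interpret \<tau>: finite_measure \<tau> by (rule fin\<tau>)
  obtain s where s: "integrable \<tau> s" "\<sigma> = dens \<Omega> \<tau> s"
    by (rule dominated_dens[OF \<sigma>b s\<tau> fin\<tau> d1]) (assumption | rule that)+
  obtain a where a: "integrable \<tau> a" "measure \<alpha> = dens \<Omega> \<tau> a"
    by (rule dominated_dens[OF \<alpha>b s\<tau> fin\<tau> d2]) (assumption | rule that)+
  have "\<alpha> = density \<tau> (\<lambda>x. ennreal (a x))"
    by (rule density_of_measure_eq(2)[OF \<tau>.sigma_finite_measure_axioms fin _ a(1)])
      (use s\<alpha> s\<tau> in \<open>auto simp: a(2) dens_def\<close>)
  \<comment> \<open>Truncation at 0 does not change the measure, as \<open>ennreal\<close> already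
    discards negative values, and it makes the density non-negative at every point.\<close>
  also have "\<dots> = density \<tau> (\<lambda>x. ennreal (max 0 (a x)))"
    by (rule arg_cong[where f="density \<tau>"]) (auto simp: max_def ennreal_neg)
  finally have \<alpha>_eq: "\<alpha> = density \<tau> (\<lambda>x. ennreal (max 0 (a x)))" .
  have "DM_field \<Omega> \<alpha> m \<tau> s (\<lambda>x. max 0 (a x))"
  proof (intro DM_field.intro div_field.intro DM_field_axioms.intro)
    show "integrable \<tau> (\<lambda>x. indicator K x * s x)" if "compact K" "K \<subseteq> \<Omega>" for K
      using that integrable_mult_indicator[OF _ s(1), of K] s\<tau> Bor_iff[OF op, of K] by (simp add: borel_compact)
    show "(\<integral>x. grad \<phi> x \<bullet> m x \<partial>\<alpha>) = - (\<integral>x. \<phi> x * s x \<partial>\<tau>)" if \<phi>: "\<phi> \<in> Cc_infty \<Omega>" for \<phi>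
      using \<sigma> \<phi> signed_integral_dens_test(2)[OF op s\<tau> s(1) \<phi>] vector_integral_dens_test[OF op s\<alpha> m(1) \<phi>]
      unfolding has_div_measure_def s(2) m(3) by simp
    show "s \<in> borel_measurable \<tau>" "(\<lambda>x. max 0 (a x)) \<in> borel_measurable \<tau>" using s a by auto
    show "norm (m x) \<le> 1" "0 \<le> max 0 (a x)" for x using m(2) by auto
  qed (fact op s\<alpha> fin m(1) s\<tau> \<tau>.sigma_finite_measure_axioms fin\<tau> s(1) \<alpha>_eq)+
  then show thesis
    by (rule that) (simp_all add: m(3)[symmetric] div_measure_eqI[OF op \<sigma>] s(2))
qed

section \<open>Fields whose divergence is a function\<close>

lemma sets_leb: "sets (leb \<Omega>) = Bor \<Omega>"
  by (rule sets_restrict_space_cong) simp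

lemma sigma_finite_leb: "open \<Omega> \<Longrightarrow> sigma_finite_measure (leb \<Omega>)"
  by (rule sigma_finite_measure_restrict_space[OF sigma_finite_lborel]) simp

lemma emeasure_leb_compact:
  assumes "open \<Omega>" "compact K" "K \<subseteq> \<Omega>"
  shows "K \<in> sets (leb \<Omega>)" and "emeasure (leb \<Omega>) K < \<infinity>"
proof -
  show "K \<in> sets (leb \<Omega>)"
    using assms Bor_iff[OF assms(1)] by (simp add: sets_leb borel_compact)
  have "emeasure (leb \<Omega>) K = emeasure lborel K"
    using assms by (intro emeasure_restrict_space) auto
  then show "emeasure (leb \<Omega>) K < \<infinity>"
    using emeasure_compact_finite[OF assms(2)] by simp
qed

lemma one_le_enn2real: "1 \<le> p \<Longrightarrow> p \<noteq> \<infinity> \<Longrightarrow> 1 \<le> enn2real p"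
  by (cases p) (auto simp: ennreal_1[symmetric] simp del: ennreal_1)

text \<open>A compact set has finite Lebesgue measure, so for finite \<open>p\<close> the bound
  \<open>\<bar>t\<bar> \<le> 1 + \<bar>t\<bar> powr p\<close> replaces Hoelder's inequality; for
  \<open>p = \<infinity>\<close> the essential supremum is the majorant.\<close>

lemma Lp_locally_integrable:
  assumes op: "open \<Omega>" and p: "1 \<le> p" and h: "h \<in> Lp (leb \<Omega>) p" and K: "compact K" "K \<subseteq> \<Omega>"
  shows "integrable (leb \<Omega>) (\<lambda>x. indicator K x * h x)"
proof -
  note Ks = emeasure_leb_compact[OF op K]
  have [measurable]: "h \<in> borel_measurable (leb \<Omega>)" "K \<in> sets (leb \<Omega>)" using h Ks by (auto simp: Lp_def)
  have fin: "Lp_norm (leb \<Omega>) p h < \<infinity>" using h by (simp add: Lp_def)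
  have "(\<integral>\<^sup>+x. ennreal (norm (indicator K x * h x)) \<partial>leb \<Omega>) < \<infinity>"
  proof (cases "p = \<infinity>")
    case True
    let ?e = "esssup (leb \<Omega>) (\<lambda>x. ennreal \<bar>h x\<bar>)"
    have ess: "?e < \<infinity>" using True fin by (simp add: Lp_norm_def)
    have "(\<integral>\<^sup>+x. ennreal (norm (indicator K x * h x)) \<partial>leb \<Omega>)
        \<le> (\<integral>\<^sup>+x. ?e * indicator K x \<partial>leb \<Omega>)"
    proof (rule nn_integral_mono_AE)
      show "AE x in leb \<Omega>. ennreal (norm (indicator K x * h x))
          \<le> ?e * indicator K x"
        using esssup_AE[of "\<lambda>x. ennreal \<bar>h x\<bar>" "leb \<Omega>"] by eventually_elim (auto simp: indicator_def)
    qed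
    also have "\<dots> = ?e * emeasure (leb \<Omega>) K"
      by (rule nn_integral_cmult_indicator) simp
    also have "\<dots> < \<infinity>" using ess Ks(2) by (simp add: ennreal_mult_less_top)
    finally show ?thesis .
  next
    case False
    let ?p = "enn2real p"
    have p1: "1 \<le> ?p" by (rule one_le_enn2real[OF p False])
    have I: "(\<integral>\<^sup>+x. ennreal (\<bar>h x\<bar> powr ?p) \<partial>leb \<Omega>) < \<infinity>"
      using fin False by (auto simp: Lp_norm_def Let_def less_top split: if_splits)
    have le: "\<bar>t\<bar> \<le> 1 + \<bar>t\<bar> powr ?p" for t :: real
    proof (cases "\<bar>t\<bar> \<le> 1")
      case False
      then have "\<bar>t\<bar> powr 1 \<le> \<bar>t\<bar> powr ?p" using p1 by (intro powr_mono) auto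
      then show ?thesis using False by simp
    qed (simp add: add_increasing2)
    have "(\<integral>\<^sup>+x. ennreal (norm (indicator K x * h x)) \<partial>leb \<Omega>)
        \<le> (\<integral>\<^sup>+x. indicator K x + ennreal (\<bar>h x\<bar> powr ?p) \<partial>leb \<Omega>)"
    proof (rule nn_integral_mono)
      fix x
      show "ennreal (norm (indicator K x * h x)) \<le> indicator K x + ennreal (\<bar>h x\<bar> powr ?p)"
        using ennreal_leI[OF le[of "h x"]] by (cases "x \<in> K") (auto simp: ennreal_plus)
    qed
    also have "\<dots> = emeasure (leb \<Omega>) K + (\<integral>\<^sup>+x. ennreal (\<bar>h x\<bar> powr ?p) \<partial>leb \<Omega>)"
      by (subst nn_integral_add) auto
    also have "\<dots> < \<infinity>" using I Ks(2) by simp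
    finally show ?thesis .
  qed
  then show ?thesis by (intro integrableI_bounded) auto
qed

text \<open>A triangle inequality up to the constant 4, good enough for limits at 0. One factor 2
  comes from \<open>(b + c) powr p \<le> 2 powr p * (b powr p + c powr p)\<close>, the other from
  bounding a sum of two equal powers by \<open>2 powr p\<close> times one of them; neither depends
  on \<open>p\<close> after taking roots. If the norm of \<open>q\<close> is infinite the bound is
  trivial.\<close>

lemma Lp_norm_dominated:
  assumes p: "1 \<le> p" and meas: "f \<in> borel_measurable M" "h \<in> borel_measurable M" "q \<in> borel_measurable M"
    and B: "B \<ge> 0" and h: "Lp_norm M p h < \<infinity>"
    and le: "AE x in M. \<bar>f x\<bar> \<le> B * \<bar>h x\<bar> + \<bar>q x\<bar>"
  shows "Lp_norm M p f \<le> 4 * (ennreal B * Lp_norm M p h + Lp_norm M p q)"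
proof (cases "p = \<infinity>")
  case True
  note [measurable] = meas
  let ?e = "\<lambda>u. esssup M (\<lambda>x. ennreal \<bar>u x\<bar>)"
  have "?e f \<le> ennreal B * ?e h + ?e q"
  proof (rule esssup_I)
    show "AE x in M. ennreal \<bar>f x\<bar> \<le> ennreal B * ?e h + ?e q"
      using le esssup_AE[of "\<lambda>x. ennreal \<bar>h x\<bar>" M] esssup_AE[of "\<lambda>x. ennreal \<bar>q x\<bar>" M]
    proof eventually_elim
      case (elim x)
      have "ennreal \<bar>f x\<bar> \<le> ennreal B * ennreal \<bar>h x\<bar> + ennreal \<bar>q x\<bar>"
        using ennreal_leI[OF elim(1)] B by (simp add: ennreal_plus ennreal_mult)
      also have "\<dots> \<le> ennreal B * ?e h + ?e q"
        using elim by (intro add_mono mult_left_mono) auto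
      finally show ?case .
    qed
  qed measurable
  also have "\<dots> \<le> 4 * (ennreal B * ?e h + ?e q)"
  proof -
    have "c \<le> 4 * c" for c :: ennreal using mult_right_mono[of 1 4 c] by simp
    then show ?thesis .
  qed
  finally show ?thesis using True by (simp add: Lp_norm_def)
next
  case False
  note [measurable] = meas
  let ?p = "enn2real p"
  have p1: "1 \<le> ?p" by (rule one_le_enn2real[OF p False])
  define I where "I f = (\<integral>\<^sup>+x. ennreal (\<bar>f x\<bar> powr ?p) \<partial>M)" for f
  have norm_eq: "Lp_norm M p f = (if I f = \<infinity> then \<infinity> else ennreal (enn2real (I f) powr (1 / ?p)))" for f
    using False by (simp add: Lp_norm_def Let_def I_def)
  show ?thesis
  proof (cases "I q = \<infinity>")
    case True
    then show ?thesis by (simp add: norm_eq[of q] ennreal_mult_top)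
  next
    case q: False
    have hI: "I h \<noteq> \<infinity>" using h norm_eq[of h] by auto
    define x y where "x = enn2real (I h)" and "y = enn2real (I q)"
    have xy: "I h = ennreal x" "I q = ennreal y" "0 \<le> x" "0 \<le> y"
      using hI q by (auto simp: x_def y_def less_top)
    define X Y where "X = x powr (1 / ?p)" and "Y = y powr (1 / ?p)"
    have XY: "x = X powr ?p" "y = Y powr ?p" "0 \<le> X" "0 \<le> Y"
      using xy p1 by (auto simp: X_def Y_def powr_powr)
    \<comment> \<open>With the maximum \<open>D\<close> of the two norms, both \<open>p\<close>-th
      powers are at most \<open>D powr p\<close>; at the end \<open>D\<close> is at most the
      sum.\<close>
    define D where "D = max (B * X) Y"
    have D: "0 \<le> D" "B * X \<le> D" "Y \<le> D" using XY(4) by (auto simp: D_def)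
    have pt: "(b + c) powr ?p \<le> 2 powr ?p * (b powr ?p + c powr ?p)" if "0 \<le> b" "0 \<le> c" for b c :: real
    proof -
      have "(b + c) powr ?p \<le> (2 * max b c) powr ?p"
        using that p1 by (intro powr_mono2) auto
      also have "\<dots> = 2 powr ?p * max b c powr ?p" using that by (intro powr_mult) 
      also have "\<dots> \<le> 2 powr ?p * (b powr ?p + c powr ?p)"
        by (intro mult_left_mono) (auto simp: max_def)
      finally show ?thesis .
    qed
    have "I f \<le> (\<integral>\<^sup>+x. ennreal (2 powr ?p) * (ennreal (B powr ?p) * ennreal (\<bar>h x\<bar> powr ?p) + ennreal (\<bar>q x\<bar> powr ?p)) \<partial>M)"
      unfolding I_def
    proof (rule nn_integral_mono_AE)
      show "AE x in M. ennreal (\<bar>f x\<bar> powr ?p)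
        \<le> ennreal (2 powr ?p) * (ennreal (B powr ?p) * ennreal (\<bar>h x\<bar> powr ?p) + ennreal (\<bar>q x\<bar> powr ?p))"
        using le
      proof eventually_elim
        case (elim x)
        have "\<bar>f x\<bar> powr ?p \<le> (B * \<bar>h x\<bar> + \<bar>q x\<bar>) powr ?p"
          using elim p1 by (intro powr_mono2) auto
        also have "\<dots> \<le> 2 powr ?p * ((B * \<bar>h x\<bar>) powr ?p + \<bar>q x\<bar> powr ?p)"
          using B by (intro pt) auto
        also have "(B * \<bar>h x\<bar>) powr ?p = B powr ?p * \<bar>h x\<bar> powr ?p" using B by (intro powr_mult)
        finally have "ennreal (\<bar>f x\<bar> powr ?p)
            \<le> ennreal (2 powr ?p * (B powr ?p * \<bar>h x\<bar> powr ?p + \<bar>q x\<bar> powr ?p))"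
          by (rule ennreal_leI)
        then show ?case by (simp add: ennreal_mult ennreal_plus)
      qed
    qed
    also have "\<dots> = ennreal (2 powr ?p) * (ennreal (B powr ?p) * I h + I q)"
      unfolding I_def by (simp add: nn_integral_cmult nn_integral_add)
    also have "\<dots> = ennreal (2 powr ?p * (B powr ?p * x + y))"
      using xy by (simp add: ennreal_mult ennreal_plus)
    finally have If: "I f \<le> ennreal (2 powr ?p * (B powr ?p * x + y))" .
    have "2 powr ?p * (B powr ?p * x + y) = 2 powr ?p * ((B * X) powr ?p + Y powr ?p)"
      using XY B by (simp add: powr_mult)
    also have "\<dots> \<le> 2 powr ?p * (D powr ?p + D powr ?p)"
      using D XY B p1 by (intro mult_left_mono add_mono powr_mono2) auto
    also have "\<dots> \<le> 2 powr ?p * (2 powr ?p * D powr ?p)"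
      using powr_mono[of 1 ?p "2::real"] p1 by (intro mult_left_mono) (auto simp: mult_right_mono)
    also have "\<dots> = (4 * D) powr ?p"
      using D powr_mult[of 2 2 ?p] by (simp add: powr_mult)
    finally have If': "I f \<le> ennreal ((4 * D) powr ?p)"
      by (rule order_trans[OF If ennreal_leI])
    have fin: "I f \<noteq> \<infinity>"
      using order_le_less_trans[OF If' ennreal_less_top] by simp
    have "enn2real (I f) \<le> (4 * D) powr ?p"
      using enn2real_mono[OF If' ennreal_less_top] by simp
    then have "enn2real (I f) powr (1 / ?p) \<le> ((4 * D) powr ?p) powr (1 / ?p)"
      using p1 by (intro powr_mono2) auto
    also have "\<dots> = 4 * D" using D p1 by (simp add: powr_powr)
    also have "\<dots> \<le> 4 * (B * X + Y)"
      using XY(4) mult_nonneg_nonneg[OF B XY(3)] by (simp add: D_def max_def)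
    finally have "Lp_norm M p f \<le> ennreal (4 * (B * X + Y))"
      using fin by (simp add: norm_eq ennreal_leI)
    also have "\<dots> = 4 * (ennreal B * Lp_norm M p h + Lp_norm M p q)"
      using B XY(3,4) hI q by (simp add: norm_eq X_def Y_def x_def y_def ennreal_mult ennreal_plus)
    finally show ?thesis .
  qed
qed

section \<open>The support of the singular part\<close>

text \<open>The complement of the support is a union of possibly uncountably many open null sets.
  The Lindelof property reduces it to a countable union, which is null.\<close>

lemma msupp_null:
  assumes op: "open \<Omega>" and s: "sets \<alpha>s = Bor \<Omega>"
  shows "open (\<Omega> - msupp \<Omega> \<alpha>s)" and "emeasure \<alpha>s (\<Omega> - msupp \<Omega> \<alpha>s) = 0"
proof -
  let ?F = "{\<Omega> - C | C. closedin (top_of_set \<Omega>) C \<and> emeasure \<alpha>s (\<Omega> - C) = 0}"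
  have op_F: "open U" if U: "U \<in> ?F" for U
  proof -
    obtain C where C: "U = \<Omega> - C" "closedin (top_of_set \<Omega>) C" using U by blast
    then have "openin (top_of_set \<Omega>) U" using openin_diff[OF openin_topspace C(2)] by simp
    then show "open U" using openin_open_eq[OF op] by blast
  qed
  have eq: "\<Omega> - msupp \<Omega> \<alpha>s = \<Union>?F" unfolding msupp_def by blast
  show "open (\<Omega> - msupp \<Omega> \<alpha>s)" unfolding eq using op_F by (rule open_Union[OF ballI])
  obtain G where G: "G \<subseteq> ?F" "countable G" "\<Union>G = \<Union>?F"
    by (rule Lindelof[of ?F, OF op_F]) (assumption | rule that)+
  have "U \<in> null_sets \<alpha>s" if "U \<in> G" for U
  proof -
    have "U \<in> ?F" using that G(1) by blast
    then have "open U" "U \<subseteq> \<Omega>" "emeasure \<alpha>s U = 0" using op_F by auto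
    then show ?thesis using Bor_iff[OF op] s by (auto simp: null_sets_def)
  qed
  then have "(\<Union>U\<in>G. U) \<in> null_sets \<alpha>s" by (intro null_sets_UN' G(2))
  then show "emeasure \<alpha>s (\<Omega> - msupp \<Omega> \<alpha>s) = 0" unfolding eq using G(3) by auto
qed

text \<open>Only the part of \<open>\<alpha>\<close> on the complement of the support of
  \<open>\<alpha>s\<close> contributes to the integral of \<open>k\<close>, and there
  \<open>\<alpha>\<close> has density \<open>F\<close> with respect to Lebesgue measure.\<close>

lemma integral_off_singular_support:
  fixes k :: "'a::euclidean_space \<Rightarrow> real"
  assumes op: "open \<Omega>" and \<alpha>: "\<alpha> \<in> pos_bmeas \<Omega>" and dec: "lebesgue_decomposition \<Omega> \<alpha> (leb \<Omega>) F \<alpha>s"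
    and k: "integrable \<alpha> k" and k0: "\<And>x. x \<in> \<Omega> \<Longrightarrow> x \<in> msupp \<Omega> \<alpha>s \<Longrightarrow> k x = 0"
  shows "integrable (leb \<Omega>) (\<lambda>x. F x * k x)" and "(\<integral>x. k x \<partial>\<alpha>) = (\<integral>x. F x * k x \<partial>leb \<Omega>)"
proof -
  let ?U = "\<Omega> - msupp \<Omega> \<alpha>s" and ?l = "leb \<Omega>"
  have s\<alpha>: "sets \<alpha> = Bor \<Omega>" and fin: "finite_measure \<alpha>" using \<alpha> by (auto simp: pos_bmeas_def)
  interpret finite_measure \<alpha> by (rule fin)
  have s: "sets \<alpha>s = Bor \<Omega>" and F: "integrable ?l F"
    and eq: "\<And>A. A \<in> Bor \<Omega> \<Longrightarrow> measure \<alpha> A = (LINT x:A|?l. F x) + measure \<alpha>s A"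
    using dec by (auto simp: lebesgue_decomposition_def pos_bmeas_def)
  have U: "?U \<in> Bor \<Omega>" using msupp_null(1)[OF op s] Bor_iff[OF op] by auto
  have U\<alpha>: "?U \<in> sets \<alpha>" and Ul: "?U \<in> sets ?l" using U s\<alpha> sets_leb by auto
  \<comment> \<open>The restriction of \<open>\<alpha>\<close> to \<open>?U\<close>, kept as a
    measure on all of \<open>\<Omega>\<close>. It has no singular part, so it is identified with a
    density of Lebesgue measure.\<close>
  define \<beta> where "\<beta> = density \<alpha> (\<lambda>x. ennreal (indicator ?U x))"
  have em\<beta>: "emeasure \<beta> A = emeasure \<alpha> (A \<inter> ?U)" if "A \<in> Bor \<Omega>" for A
  proof -
    have "emeasure \<beta> A = (\<integral>\<^sup>+x. ennreal (indicator ?U x) * indicator A x \<partial>\<alpha>)"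
      unfolding \<beta>_def
      by (rule emeasure_density) (use that U\<alpha> s\<alpha> in \<open>auto intro!: measurable_compose[OF borel_measurable_indicator]\<close>)
    also have "\<dots> = (\<integral>\<^sup>+x. indicator (A \<inter> ?U) x \<partial>\<alpha>)"
      by (rule nn_integral_cong) (simp split: split_indicator)
    also have "\<dots> = emeasure \<alpha> (A \<inter> ?U)" using that U\<alpha> s\<alpha> by (intro nn_integral_indicator) auto
    finally show ?thesis .
  qed
  have FU: "integrable ?l (\<lambda>x. indicator ?U x * F x)"
    using integrable_mult_indicator[OF Ul F] by simp
  have "emeasure \<beta> (space \<beta>) \<noteq> \<infinity>"
    using em\<beta>[of \<Omega>] space_eq_of_sets_Bor[OF s\<alpha>] by (simp add: \<beta>_def)
  then have fin\<beta>: "finite_measure \<beta>" by (rule finite_measureI)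
  have s\<beta>: "sets \<beta> = sets ?l" by (simp add: \<beta>_def s\<alpha> sets_leb)
  have \<beta>_meas: "measure \<beta> A = (LINT x:A|?l. indicator ?U x * F x)" if "A \<in> sets ?l" for A
  proof -
    have A: "A \<in> Bor \<Omega>" using that by (simp add: sets_leb)
    have AU: "A \<inter> ?U \<in> Bor \<Omega>" using A U by (rule sets.Int)
    have "emeasure \<alpha>s (A \<inter> ?U) \<le> emeasure \<alpha>s ?U" using U s by (intro emeasure_mono) auto
    then have "measure \<alpha>s (A \<inter> ?U) = 0" using msupp_null(2)[OF op s] by (simp add: measure_def)
    then have "measure \<beta> A = (LINT x:A \<inter> ?U|?l. F x)"
      using em\<beta>[OF A] eq[OF AU] by (simp add: measure_def)
    also have "\<dots> = (LINT x:A|?l. indicator ?U x * F x)"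
      unfolding set_lebesgue_integral_def by (intro Bochner_Integration.integral_cong) (auto simp: indicator_def)
    finally show ?thesis .
  qed
  have \<beta>_eq: "AE x in ?l. 0 \<le> indicator ?U x * F x" "\<beta> = density ?l (\<lambda>x. ennreal (indicator ?U x * F x))"
    by (rule density_of_measure_eq[OF sigma_finite_leb[OF op] fin\<beta> s\<beta> FU \<beta>_meas]; assumption)+
  have km: "k \<in> borel_measurable \<alpha>" using k by simp
  have "sets \<alpha> = sets ?l" by (rule trans[OF s\<alpha> sets_leb[symmetric]])
  from measurable_cong_sets[OF this refl] km have kl: "k \<in> borel_measurable ?l" by blast
  have Fm: "(\<lambda>x. indicator ?U x * F x) \<in> borel_measurable ?l" using FU by simp
  have Um: "(\<lambda>x. indicator ?U x :: real) \<in> borel_measurable \<alpha>" using U\<alpha> by simp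
  have c1: "(indicator ?U x * F x) *\<^sub>R k x = F x * k x" if "x \<in> space ?l" for x
    using k0[of x] that by (auto simp: indicator_def space_restrict_space)
  have c2: "indicator ?U x *\<^sub>R k x = k x" if "x \<in> space \<alpha>" for x
    using k0[of x] that space_eq_of_sets_Bor[OF s\<alpha>] by (auto simp: indicator_def)
  have "integrable \<alpha> (\<lambda>x. indicator ?U x *\<^sub>R k x)" by (rule integrable_mult_indicator[OF U\<alpha> k])
  then have "integrable \<beta> k"
    unfolding \<beta>_def by (subst integrable_density[OF km Um]) auto
  then have "integrable ?l (\<lambda>x. (indicator ?U x * F x) *\<^sub>R k x)"
    unfolding \<beta>_eq(2) using integrable_density[OF kl Fm \<beta>_eq(1)] by simp
  moreover have "integrable ?l (\<lambda>x. (indicator ?U x * F x) *\<^sub>R k x) \<longleftrightarrow> integrable ?l (\<lambda>x. F x * k x)"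
    by (rule Bochner_Integration.integrable_cong[OF refl]) (simp only: c1)
  ultimately show "integrable ?l (\<lambda>x. F x * k x)" by simp
  have "(\<integral>x. k x \<partial>\<alpha>) = (\<integral>x. indicator ?U x *\<^sub>R k x \<partial>\<alpha>)"
    by (rule Bochner_Integration.integral_cong[OF refl]) (simp only: c2)
  also have "\<dots> = (\<integral>x. k x \<partial>\<beta>)"
    unfolding \<beta>_def by (rule integral_density[OF km Um, symmetric]) auto
  also have "\<dots> = (\<integral>x. (indicator ?U x * F x) *\<^sub>R k x \<partial>?l)"
    unfolding \<beta>_eq(2) by (rule integral_density[OF kl Fm \<beta>_eq(1)])
  also have "\<dots> = (\<integral>x. F x * k x \<partial>?l)"
    by (rule Bochner_Integration.integral_cong[OF refl]) (simp only: c1)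
  finally show "(\<integral>x. k x \<partial>\<alpha>) = (\<integral>x. F x * k x \<partial>leb \<Omega>)" .
qed

section \<open>The product rule for an L^p divergence\<close>

text \<open>Two functions representing the same divergence have a locally integrable difference that
  every test annihilates. The representative picked by choice may therefore be exchanged for any
  other in norms and integrals.\<close>

lemma div_Lp:
  assumes op: "open \<Omega>" and p: "1 \<le> p" and h: "has_div_Lp p \<Omega> \<mu> h"
  shows "has_div_Lp p \<Omega> \<mu> (div_Lp p \<Omega> \<mu>)" and "AE x in leb \<Omega>. div_Lp p \<Omega> \<mu> x = h x"
proof -
  let ?h = "div_Lp p \<Omega> \<mu>"
  show h': "has_div_Lp p \<Omega> \<mu> ?h"
    unfolding div_Lp_def by (rule someI[of "has_div_Lp p \<Omega> \<mu>", OF h])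
  have Lp: "h \<in> Lp (leb \<Omega>) p" "?h \<in> Lp (leb \<Omega>) p" using h h' by (auto simp: has_div_Lp_def)
  note loc = Lp_locally_integrable[OF op p Lp(1)] Lp_locally_integrable[OF op p Lp(2)]
  have "AE x in leb \<Omega>. ?h x - h x = 0"
  proof (rule AE_zero_of_tests[OF op sets_leb sigma_finite_leb[OF op]])
    show "(\<lambda>x. ?h x - h x) \<in> borel_measurable (leb \<Omega>)" using Lp by (auto simp: Lp_def)
    show "integrable (leb \<Omega>) (\<lambda>x. indicator K x * (?h x - h x))" if "compact K" "K \<subseteq> \<Omega>" for K
      using loc[OF that] by (simp add: right_diff_distrib)
    fix \<phi> assume \<phi>: "\<phi> \<in> Cc_infty \<Omega>"
    obtain K where K: "compact K" "K \<subseteq> \<Omega>" "\<And>x. x \<in> \<Omega> \<Longrightarrow> x \<notin> K \<Longrightarrow> \<phi> x = 0"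
      by (rule Cc_infty_support[OF \<phi>]) (assumption | rule that)+
    note i = locally_integrable_mult[OF sets_leb _ Ck1D(3)[OF Cc_infty_Ck[OF \<phi>]] K]
    have "(\<integral>x. \<phi> x * ?h x \<partial>leb \<Omega>) = (\<integral>x. \<phi> x * h x \<partial>leb \<Omega>)"
      using h h' \<phi> unfolding has_div_Lp_def by force
    then show "(\<integral>x. \<phi> x * (?h x - h x) \<partial>leb \<Omega>) = 0"
      using Bochner_Integration.integral_diff[OF i[OF loc(2)] i[OF loc(1)]]
      by (simp add: right_diff_distrib)
  qed
  then show "AE x in leb \<Omega>. ?h x = h x" by auto
qed

locale Mp_field = div_field \<Omega> \<alpha> m "leb \<Omega>" h
  for \<Omega> :: "'a::euclidean_space set" and \<alpha> m h +
  fixes p :: ennreal and F :: "'a \<Rightarrow> real" and \<alpha>s :: "'a measure"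
  assumes p: "1 \<le> p" and h_Lp: "h \<in> Lp (leb \<Omega>) p" and \<alpha>_pos: "\<alpha> \<in> pos_bmeas \<Omega>"
    and dec: "lebesgue_decomposition \<Omega> \<alpha> (leb \<Omega>) F \<alpha>s"
begin

text \<open>These conditions make \<open>\<nabla>g \<cdot> \<mu>\<close> a function in
  \<open>L^p\<close>. They refer to \<open>g\<close> only through its regularity and gradient, so
  \<open>g - 1\<close> inherits them, and the zero function satisfies them.\<close>

definition admissible :: "('a \<Rightarrow> real) \<Rightarrow> bool" where
  "admissible g \<longleftrightarrow> g \<in> Ck 1 \<Omega> \<and> integrable \<alpha> (grad g) \<and> (\<forall>x\<in>msupp \<Omega> \<alpha>s. grad g x = 0) \<and>
     Lp_norm (leb \<Omega>) p (\<lambda>x. norm (grad g x) * F x) < \<infinity>"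

definition div_dens :: "('a \<Rightarrow> real) \<Rightarrow> 'a \<Rightarrow> real" where
  "div_dens g x = g x * h x + F x * (grad g x \<bullet> m x)"

text \<open>The factor \<open>\<phi>\<close> is merely bounded and continuous, so that functions
  testing normal traces are covered along with compactly supported ones.\<close>

lemma
  assumes adm: "admissible g" and \<phi>: "continuous_on \<Omega> \<phi>" "\<And>x. x \<in> \<Omega> \<Longrightarrow> \<bar>\<phi> x\<bar> \<le> C"
  shows integrable_grad_leb: "integrable (leb \<Omega>) (\<lambda>x. \<phi> x * (F x * (grad g x \<bullet> m x)))"
    and integral_grad_leb: "(\<integral>x. \<phi> x * (grad g x \<bullet> m x) \<partial>\<alpha>) = (\<integral>x. \<phi> x * (F x * (grad g x \<bullet> m x)) \<partial>leb \<Omega>)"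
proof -
  have g: "g \<in> Ck 1 \<Omega>" "integrable \<alpha> (grad g)" "\<And>x. x \<in> msupp \<Omega> \<alpha>s \<Longrightarrow> grad g x = 0"
    using adm by (auto simp: admissible_def)
  have k: "integrable \<alpha> (\<lambda>x. \<phi> x * (grad g x \<bullet> m x))"
    by (rule signed_integral_dens_bounded(1)[OF s\<alpha> integrable_grad_m(1)[OF g(1,2)] \<phi>])
  have comm: "F x * (\<phi> x * (grad g x \<bullet> m x)) = \<phi> x * (F x * (grad g x \<bullet> m x))" for x by simp
  show "integrable (leb \<Omega>) (\<lambda>x. \<phi> x * (F x * (grad g x \<bullet> m x)))"
    using integral_off_singular_support(1)[OF op \<alpha>_pos dec k] g(3) unfolding comm by simp
  show "(\<integral>x. \<phi> x * (grad g x \<bullet> m x) \<partial>\<alpha>) = (\<integral>x. \<phi> x * (F x * (grad g x \<bullet> m x)) \<partial>leb \<Omega>)"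
    using integral_off_singular_support(2)[OF op \<alpha>_pos dec k] g(3) unfolding comm by simp
qed

lemma div_dens_bound:
  assumes B: "\<And>x. x \<in> \<Omega> \<Longrightarrow> \<bar>g x\<bar> \<le> B"
  shows "AE x in leb \<Omega>. \<bar>div_dens g x\<bar> \<le> B * \<bar>h x\<bar> + \<bar>norm (grad g x) * F x\<bar>"
proof (rule AE_I2)
  fix x assume "x \<in> space (leb \<Omega>)"
  then have "\<bar>g x * h x\<bar> \<le> B * \<bar>h x\<bar>"
    using B[of x] by (simp add: space_\<tau> abs_mult mult_right_mono)
  moreover have "\<bar>grad g x \<bullet> m x\<bar> \<le> norm (grad g x)"
    using order_trans[OF Cauchy_Schwarz_ineq2 mult_left_mono[OF m_le[of x] norm_ge_zero[of "grad g x"]]]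
    by simp
  then have "\<bar>F x * (grad g x \<bullet> m x)\<bar> \<le> \<bar>norm (grad g x) * F x\<bar>"
    using mult_left_mono[of "\<bar>grad g x \<bullet> m x\<bar>" "norm (grad g x)" "\<bar>F x\<bar>"]
    by (simp add: abs_mult mult.commute)
  ultimately show "\<bar>div_dens g x\<bar> \<le> B * \<bar>h x\<bar> + \<bar>norm (grad g x) * F x\<bar>"
    unfolding div_dens_def using abs_triangle_ineq[of "g x * h x" "F x * (grad g x \<bullet> m x)"] by linarith
qed

lemma div_dens:
  assumes adm: "admissible g" and B: "\<And>x. x \<in> \<Omega> \<Longrightarrow> \<bar>g x\<bar> \<le> B" "0 \<le> B"
  shows "has_div_Lp p \<Omega> (dens \<Omega> \<alpha> (\<lambda>x. g x *\<^sub>R m x)) (div_dens g)"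
    and "Lp_norm (leb \<Omega>) p (div_Lp p \<Omega> (dens \<Omega> \<alpha> (\<lambda>x. g x *\<^sub>R m x)))
      \<le> 4 * (ennreal B * Lp_norm (leb \<Omega>) p h + Lp_norm (leb \<Omega>) p (\<lambda>x. norm (grad g x) * F x))"
proof -
  let ?\<nu> = "dens \<Omega> \<alpha> (\<lambda>x. g x *\<^sub>R m x)"
  have g: "g \<in> Ck 1 \<Omega>" and gLp: "Lp_norm (leb \<Omega>) p (\<lambda>x. norm (grad g x) * F x) < \<infinity>"
    using adm by (auto simp: admissible_def)
  have hm: "h \<in> borel_measurable (leb \<Omega>)" and hn: "Lp_norm (leb \<Omega>) p h < \<infinity>"
    using h_Lp by (auto simp: Lp_def)
  have Fm: "F \<in> borel_measurable (leb \<Omega>)" using dec by (auto simp: lebesgue_decomposition_def)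
  have gm: "g \<in> borel_measurable (leb \<Omega>)" "grad g \<in> borel_measurable (leb \<Omega>)"
    by (rule measurable_of_continuous_on[OF sets_leb Ck1D(3)[OF g]])
      (rule measurable_of_continuous_on[OF sets_leb Ck1D(2)[OF g]])
  have mm: "m \<in> borel_measurable (leb \<Omega>)"
    using m_int measurable_\<alpha>_\<tau>[of m] by auto
  have dm: "div_dens g \<in> borel_measurable (leb \<Omega>)"
    unfolding div_dens_def[abs_def] using hm Fm gm mm by measurable
  have qm: "(\<lambda>x. norm (grad g x) * F x) \<in> borel_measurable (leb \<Omega>)"
    using Fm gm by measurable
  have "Lp_norm (leb \<Omega>) p (div_dens g)
      \<le> 4 * (ennreal B * Lp_norm (leb \<Omega>) p h + Lp_norm (leb \<Omega>) p (\<lambda>x. norm (grad g x) * F x))"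
    by (rule Lp_norm_dominated[OF p dm hm qm B(2) hn div_dens_bound[OF B(1)]])
  also have "\<dots> < \<infinity>" using hn gLp by (simp add: ennreal_mult_less_top)
  finally have dLp: "div_dens g \<in> Lp (leb \<Omega>) p" using dm by (simp add: Lp_def)
  note gi = integrable_scaled_density[OF s\<alpha> fin\<alpha> m_int m_le Ck1D(3)[OF g] B(1)]
  show has: "has_div_Lp p \<Omega> ?\<nu> (div_dens g)"
    unfolding has_div_Lp_def
  proof (intro conjI dLp ballI)
    fix \<phi> assume \<phi>: "\<phi> \<in> Cc_infty \<Omega>"
    have \<phi>c: "continuous_on \<Omega> \<phi>" by (rule Ck1D(3)[OF Cc_infty_Ck[OF \<phi>]])
    obtain K where K: "compact K" "K \<subseteq> \<Omega>" "\<And>x. x \<in> \<Omega> \<Longrightarrow> x \<notin> K \<Longrightarrow> \<phi> x = 0"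
      by (rule Cc_infty_support[OF \<phi>]) (assumption | rule that)+
    obtain C where C: "\<And>x. x \<in> \<Omega> \<Longrightarrow> \<bar>\<phi> x\<bar> \<le> C"
      by (rule test_bounded[OF \<phi> op]) (assumption | rule that)+
    have "integrable (leb \<Omega>) (\<lambda>x. (\<phi> x * g x) * h x)"
      by (rule locally_integrable_mult[OF sets_leb s_int _ K(1,2)])
        (use K(3) \<phi>c Ck1D(3)[OF g] in \<open>auto intro: continuous_on_mult\<close>)
    then have i1: "integrable (leb \<Omega>) (\<lambda>x. \<phi> x * (g x * h x))" by (simp add: mult.assoc)
    have "(\<integral>x. \<phi> x * div_dens g x \<partial>leb \<Omega>)
        = (\<integral>x. \<phi> x * (g x * h x) + \<phi> x * (F x * (grad g x \<bullet> m x)) \<partial>leb \<Omega>)"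
      by (simp add: div_dens_def distrib_left)
    also have "\<dots> = (\<integral>x. \<phi> x * (g x * h x) \<partial>leb \<Omega>) + (\<integral>x. \<phi> x * (F x * (grad g x \<bullet> m x)) \<partial>leb \<Omega>)"
      by (rule Bochner_Integration.integral_add[OF i1 integrable_grad_leb[OF adm \<phi>c C]])
    finally have 1: "(\<integral>x. \<phi> x * div_dens g x \<partial>leb \<Omega>)
        = (\<integral>x. \<phi> x * (g x * h x) \<partial>leb \<Omega>) + (\<integral>x. \<phi> x * (grad g x \<bullet> m x) \<partial>\<alpha>)"
      by (simp only: integral_grad_leb[OF adm \<phi>c C])
    have v: "vector_integral \<Omega> ?\<nu> (grad \<phi>) = (\<integral>x. grad \<phi> x \<bullet> (g x *\<^sub>R m x) \<partial>\<alpha>)"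
      by (rule vector_integral_dens_test[OF op s\<alpha> gi \<phi>])
    show "vector_integral \<Omega> ?\<nu> (grad \<phi>) = - (\<integral>x. \<phi> x * div_dens g x \<partial>leb \<Omega>)"
      unfolding v 1 div_mult_tests[OF g \<phi>] by simp
  qed
  note d = div_Lp[OF op p has]
  have dm': "div_Lp p \<Omega> ?\<nu> \<in> borel_measurable (leb \<Omega>)"
    using d(1) by (auto simp: has_div_Lp_def Lp_def)
  have "AE x in leb \<Omega>. \<bar>div_dens g x\<bar> \<le> B * \<bar>h x\<bar> + \<bar>norm (grad g x) * F x\<bar>"
    by (rule div_dens_bound[OF B(1)])
  \<comment> \<open>The norm concerns the chosen representative, which agrees with
    \<open>div_dens g\<close> almost everywhere, so the pointwise bound carries over.\<close>
  then have "AE x in leb \<Omega>. \<bar>div_Lp p \<Omega> ?\<nu> x\<bar> \<le> B * \<bar>h x\<bar> + \<bar>norm (grad g x) * F x\<bar>"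
    using d(2) by eventually_elim simp
  then show "Lp_norm (leb \<Omega>) p (div_Lp p \<Omega> ?\<nu>)
      \<le> 4 * (ennreal B * Lp_norm (leb \<Omega>) p h + Lp_norm (leb \<Omega>) p (\<lambda>x. norm (grad g x) * F x))"
    by (rule Lp_norm_dominated[OF p dm' hm qm B(2) hn])
qed

text \<open>On a domain of infinite measure, membership of the divergence in \<open>L^p\<close> does
  not make \<open>\<phi> div (g \<mu>)\<close> integrable. Integrability comes from the trace
  condition on \<open>\<mu>\<close> tested with \<open>g \<phi>\<close>, and for the gradient term
  from the finiteness of \<open>\<alpha>\<close> and the integrability of
  \<open>grad g\<close>.\<close>

lemma normal_trace_mult:
  assumes adm: "admissible g" and g: "g \<in> Cb1_closure \<Omega>" and \<phi>: "\<phi> \<in> Cb1_closure \<Omega>"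
    and div: "div_Lp p \<Omega> (dens \<Omega> \<alpha> m) = h"
    and int: "integrable (leb \<Omega>) (\<lambda>x. (g x * \<phi> x) * h x)"
  shows "integrable (leb \<Omega>) (\<lambda>x. \<phi> x * div_Lp p \<Omega> (dens \<Omega> \<alpha> (\<lambda>x. g x *\<^sub>R m x)) x)"
    and "normal_trace_Mp p \<Omega> \<phi> (dens \<Omega> \<alpha> (\<lambda>x. g x *\<^sub>R m x))
      = normal_trace_Mp p \<Omega> (\<lambda>x. g x * \<phi> x) (dens \<Omega> \<alpha> m)"
proof -
  let ?\<nu> = "dens \<Omega> \<alpha> (\<lambda>x. g x *\<^sub>R m x)"
  have gC: "g \<in> Cb1 \<Omega>" "g \<in> Ck 1 \<Omega>" and \<phi>C: "\<phi> \<in> Cb1 \<Omega>" "\<phi> \<in> Ck 1 \<Omega>"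
    using g \<phi> by (auto simp: Cb1_closure_def Cb1_def)
  obtain B where B: "B \<ge> 0" "\<And>x. x \<in> \<Omega> \<Longrightarrow> \<bar>g x\<bar> \<le> B"
    by (rule Cb1_bounded[OF gC(1)]) (assumption | rule that)+
  obtain B' where B': "\<And>x. x \<in> \<Omega> \<Longrightarrow> \<bar>\<phi> x\<bar> \<le> B'"
    by (rule Cb1_bounded[OF \<phi>C(1)]) (assumption | rule that)+
  have has: "has_div_Lp p \<Omega> ?\<nu> (div_dens g)" by (rule div_dens(1)[OF adm B(2,1)])
  note d = div_Lp[OF op p has]
  note \<phi>c = Ck1D(3)[OF \<phi>C(2)]
  have i1: "integrable (leb \<Omega>) (\<lambda>x. \<phi> x * (g x * h x))" using int by (simp add: ac_simps)
  note i2 = integrable_grad_leb[OF adm \<phi>c B']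
  have i12: "integrable (leb \<Omega>) (\<lambda>x. \<phi> x * (g x * h x) + \<phi> x * (F x * (grad g x \<bullet> m x)))"
    by (rule Bochner_Integration.integrable_add[OF i1 i2])
  have \<phi>m: "\<phi> \<in> borel_measurable (leb \<Omega>)" by (rule measurable_of_continuous_on[OF sets_leb \<phi>c])
  have dm: "(\<lambda>x. \<phi> x * div_Lp p \<Omega> ?\<nu> x) \<in> borel_measurable (leb \<Omega>)"
    using d(1) \<phi>m by (auto simp: has_div_Lp_def Lp_def)
  have ae: "AE x in leb \<Omega>. \<phi> x * (g x * h x) + \<phi> x * (F x * (grad g x \<bullet> m x)) = \<phi> x * div_Lp p \<Omega> ?\<nu> x"
    using d(2) by eventually_elim (simp add: div_dens_def distrib_left)
  show "integrable (leb \<Omega>) (\<lambda>x. \<phi> x * div_Lp p \<Omega> ?\<nu> x)"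
    by (rule Bochner_Integration.integrable_cong_AE_imp[OF i12 dm ae])
  have "(\<integral>x. \<phi> x * div_Lp p \<Omega> ?\<nu> x \<partial>leb \<Omega>)
      = (\<integral>x. \<phi> x * (g x * h x) + \<phi> x * (F x * (grad g x \<bullet> m x)) \<partial>leb \<Omega>)"
    using ae i12 dm by (intro integral_cong_AE) auto
  also have "\<dots> = (\<integral>x. \<phi> x * (g x * h x) \<partial>leb \<Omega>) + (\<integral>x. \<phi> x * (F x * (grad g x \<bullet> m x)) \<partial>leb \<Omega>)"
    by (rule Bochner_Integration.integral_add[OF i1 i2])
  finally have 1: "(\<integral>x. \<phi> x * div_Lp p \<Omega> ?\<nu> x \<partial>leb \<Omega>)
      = (\<integral>x. \<phi> x * (g x * h x) \<partial>leb \<Omega>) + (\<integral>x. \<phi> x * (grad g x \<bullet> m x) \<partial>\<alpha>)"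
    by (simp only: integral_grad_leb[OF adm \<phi>c B'])
  show "normal_trace_Mp p \<Omega> \<phi> ?\<nu> = normal_trace_Mp p \<Omega> (\<lambda>x. g x * \<phi> x) (dens \<Omega> \<alpha> m)"
    unfolding normal_trace_Mp_def div 1
    using trace_mult[OF gC(1) \<phi>C(1)] by (simp add: ac_simps)
qed

end

text \<open>The density of the divergence is taken to be the chosen representative itself, so that
  normal traces of \<open>\<mu>\<close> are literally integrals against it.\<close>

lemma Mp_representation:
  assumes op: "open \<Omega>" and p: "1 \<le> p" and \<alpha>: "\<alpha> \<in> pos_bmeas \<Omega>" and \<mu>: "\<mu> \<in> Mp p \<Omega>"
    and le: "variation_le \<Omega> \<mu> \<alpha>" and dec: "lebesgue_decomposition \<Omega> \<alpha> (leb \<Omega>) F \<alpha>s"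
  obtains m where "Mp_field \<Omega> \<alpha> m (div_Lp p \<Omega> \<mu>) p F \<alpha>s" "\<mu> = dens \<Omega> \<alpha> m"
proof -
  have s\<alpha>: "sets \<alpha> = Bor \<Omega>" and fin: "finite_measure \<alpha>" using \<alpha> by (auto simp: pos_bmeas_def)
  obtain h where \<mu>b: "\<mu> \<in> bmeas \<Omega>" and h: "has_div_Lp p \<Omega> \<mu> h" using \<mu> by (auto simp: Mp_def)
  obtain m where m: "integrable \<alpha> m" "\<And>x. norm (m x) \<le> 1" "\<mu> = dens \<Omega> \<alpha> m"
    by (rule variation_le_imp_density[OF \<mu>b \<alpha> le]) (assumption | rule that)+
  note d = div_Lp(1)[OF op p h]
  then have Lp: "div_Lp p \<Omega> \<mu> \<in> Lp (leb \<Omega>) p" by (simp add: has_div_Lp_def)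
  have "Mp_field \<Omega> \<alpha> m (div_Lp p \<Omega> \<mu>) p F \<alpha>s"
  proof (intro Mp_field.intro div_field.intro Mp_field_axioms.intro)
    show "norm (m x) \<le> 1" for x by (rule m(2))
    show "div_Lp p \<Omega> \<mu> \<in> borel_measurable (leb \<Omega>)" using Lp by (simp add: Lp_def)
    show "integrable (leb \<Omega>) (\<lambda>x. indicator K x * div_Lp p \<Omega> \<mu> x)" if "compact K" "K \<subseteq> \<Omega>" for K
      by (rule Lp_locally_integrable[OF op p Lp that])
    show "(\<integral>x. grad \<phi> x \<bullet> m x \<partial>\<alpha>) = - (\<integral>x. \<phi> x * div_Lp p \<Omega> \<mu> x \<partial>leb \<Omega>)"
      if \<phi>: "\<phi> \<in> Cc_infty \<Omega>" for \<phi>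
      using d \<phi> vector_integral_dens_test[OF op s\<alpha> m(1) \<phi>]
      unfolding has_div_Lp_def m(3)[symmetric] by simp
  qed (fact op s\<alpha> fin m(1) sets_leb sigma_finite_leb[OF op] p Lp \<alpha> dec)+
  then show thesis by (rule that) (rule m(3))
qed

section \<open>The approximating sequence\<close>

text \<open>Both functions have the same derivatives at every point, so the choice operator in
  \<open>frechet_derivative\<close> selects the same map for both; the identity thus holds even
  where neither is differentiable.\<close>

lemma grad_diff_const: "grad (\<lambda>x. f x - c) = grad f"
proof -
  have "((\<lambda>x. f x - c) has_derivative f') (at x) \<longleftrightarrow> (f has_derivative f') (at x)" for f' x
    using has_derivative_add[of "\<lambda>x. f x - c" f' "at x" "\<lambda>_. c" "\<lambda>_. 0"]
      has_derivative_diff[of f f' "at x" "\<lambda>_. c" "\<lambda>_. 0"] by auto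
  then show ?thesis by (simp add: grad_def[abs_def] frechet_derivative_def)
qed

lemma Ck1_diff_const: "f \<in> Ck 1 \<Omega> \<Longrightarrow> (\<lambda>x. f x - c) \<in> Ck 1 \<Omega>"
  unfolding Ck1_iff grad_diff_const by (auto intro: differentiable_diff)

lemma grad_const_zero: "grad (\<lambda>x. c) = (\<lambda>x. 0)"
  using grad_eqI[of "\<lambda>x. c" 0] by auto

lemma zero_Cb1_closure: "(\<lambda>x. 0) \<in> Cb1_closure \<Omega>"
  by (auto simp: Cb1_closure_def Ck_UNIV_subset[OF Ck_const] grad_const_zero intro!: Cb1I[where B=0])

lemma Lp_norm_zero: "Lp_norm M p (\<lambda>x. 0) = 0"
  using esssup_I[of "\<lambda>x. 0 :: ennreal" M 0] by (simp add: Lp_norm_def)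

text \<open>Rewriting with an empty \<open>\<Gamma>\<close> lets one argument prove the statements
  with and without boundary conditions.\<close>

lemma K0_eq: "K0 \<Omega> \<alpha> = K0_Gamma \<Omega> {} \<alpha>"
  by (simp add: K0_def K0_Gamma_def DM_Gamma_def)

lemma Kp_eq: "Kp p \<Omega> \<alpha> = Kp_Gamma p \<Omega> {} \<alpha>"
  by (simp add: Kp_def Kp_Gamma_def Mp_Gamma_def)

locale approximating_measures =
  fixes \<Omega> :: "'a::euclidean_space set"
    and \<alpha> :: "'a measure" and \<alpha>n \<alpha>ns :: "nat \<Rightarrow> 'a measure"
    and g :: "nat \<Rightarrow> 'a \<Rightarrow> real"
  assumes op: "open \<Omega>"
    and \<alpha>n: "\<And>n. \<alpha>n n \<in> pos_bmeas \<Omega>" and \<alpha>: "\<alpha> \<in> pos_bmeas \<Omega>"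
    and dec: "\<And>n. lebesgue_decomposition \<Omega> (\<alpha>n n) \<alpha> (g n) (\<alpha>ns n)"
    and g: "\<And>n. g n \<in> Ck 1 \<Omega>"
    and g_bounded: "\<And>n. bounded (g n ` \<Omega>)"
    and grad_int: "\<And>n. integrable \<alpha> (grad (g n))"
    and conv: "(\<lambda>n. SUP x\<in>\<Omega>. ennreal \<bar>g n x - 1\<bar>) \<longlonglongrightarrow> 0"
begin

lemma s\<alpha>: "sets \<alpha> = Bor \<Omega>" and fin\<alpha>: "finite_measure \<alpha>"
  using \<alpha> by (auto simp: pos_bmeas_def)

definition \<beta> :: "nat \<Rightarrow> real" where
  "\<beta> n = enn2real (SUP x\<in>\<Omega>. ennreal \<bar>g n x - 1\<bar>)"

lemma \<beta>_nonneg: "0 \<le> \<beta> n" by (simp add: \<beta>_def)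

text \<open>\<open>enn2real\<close> would send an infinite supremum to 0 and destroy the bound;
  boundedness of \<open>g n\<close> rules this out for every \<open>n\<close>, not just
  eventually.\<close>

lemma \<beta>_bound: assumes "x \<in> \<Omega>" shows "\<bar>g n x - 1\<bar> \<le> \<beta> n"
proof -
  obtain M where M: "\<And>x. x \<in> \<Omega> \<Longrightarrow> \<bar>g n x\<bar> \<le> M"
    using g_bounded[of n] unfolding bounded_iff by force
  have "(SUP x\<in>\<Omega>. ennreal \<bar>g n x - 1\<bar>) \<le> ennreal (M + 1)"
    using M by (intro SUP_least ennreal_leI) (smt (verit))
  then have "(SUP x\<in>\<Omega>. ennreal \<bar>g n x - 1\<bar>) < \<infinity>"
    using ennreal_less_top[of "M + 1"] order_le_less_trans by fastforce
  then have "ennreal \<bar>g n x - 1\<bar> \<le> ennreal (\<beta> n)"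
    using SUP_upper[OF assms, of "\<lambda>x. ennreal \<bar>g n x - 1\<bar>"] by (simp add: \<beta>_def less_top)
  then show ?thesis by (simp add: ennreal_le_iff \<beta>_nonneg)
qed

lemma \<beta>_tendsto: "\<beta> \<longlonglongrightarrow> 0"
  unfolding \<beta>_def[abs_def] using conv by (intro tendsto_enn2real) auto

lemma g_bound: "x \<in> \<Omega> \<Longrightarrow> \<bar>g n x\<bar> \<le> 1 + \<beta> n"
  using \<beta>_bound[of x n] by linarith

lemma
  assumes m: "integrable \<alpha> m" "\<And>x. norm (m x) \<le> 1"
  shows scaled_integrable: "integrable \<alpha> (\<lambda>x. g n x *\<^sub>R m x)"
    and scaled_variation_le: "variation_le \<Omega> (dens \<Omega> \<alpha> (\<lambda>x. g n x *\<^sub>R m x)) (\<alpha>n n)"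
    and scaled_diff: "dens \<Omega> \<alpha> (\<lambda>x. g n x *\<^sub>R m x) A - dens \<Omega> \<alpha> m A
      = dens \<Omega> \<alpha> (\<lambda>x. (g n x - 1) *\<^sub>R m x) A"
proof -
  show i: "integrable \<alpha> (\<lambda>x. g n x *\<^sub>R m x)"
    by (rule integrable_scaled_density[OF s\<alpha> fin\<alpha> m Ck1D(3)[OF g] g_bound])
  show "variation_le \<Omega> (dens \<Omega> \<alpha> (\<lambda>x. g n x *\<^sub>R m x)) (\<alpha>n n)"
    by (rule variation_le_scaled_density[OF \<alpha> \<alpha>n m i dec])
  show "dens \<Omega> \<alpha> (\<lambda>x. g n x *\<^sub>R m x) A - dens \<Omega> \<alpha> m A = dens \<Omega> \<alpha> (\<lambda>x. (g n x - 1) *\<^sub>R m x) A"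
    using dens_diff[OF s\<alpha> i m(1)] by (simp add: scaleR_left_diff_distrib)
qed

text \<open>Regularity of \<open>g n\<close> up to the closure enters only through normal traces,
  hence the disjunction in the first hypothesis.\<close>

lemma DM_part:
  assumes \<Gamma>: "\<Gamma> = {} \<or> (\<forall>n. g n \<in> Cb1_closure \<Omega>)"
    and grad0: "(\<lambda>n. \<integral>x. norm (grad (g n) x) \<partial>\<alpha>) \<longlonglongrightarrow> 0"
    and \<mu>: "\<mu> \<in> K0_Gamma \<Omega> \<Gamma> \<alpha>"
  shows "\<exists>\<mu>n. (\<forall>n. \<mu>n n \<in> K0_Gamma \<Omega> \<Gamma> (\<alpha>n n)) \<and> (\<lambda>n. DM_norm \<Omega> (\<lambda>A. \<mu>n n A - \<mu> A)) \<longlonglongrightarrow> 0"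
proof -
  have \<mu>DM: "\<mu> \<in> DM \<Omega>" and le: "variation_le \<Omega> \<mu> \<alpha>"
    using \<mu> by (auto simp: K0_Gamma_def DM_Gamma_def split: if_splits)
  obtain m \<tau> s a where field: "DM_field \<Omega> \<alpha> m \<tau> s a" and \<mu>_eq: "\<mu> = dens \<Omega> \<alpha> m"
      and div: "div_measure \<Omega> \<mu> = dens \<Omega> \<tau> s"
    by (rule DM_representation[OF op \<alpha> \<mu>DM le]) (assumption | rule that)+
  interpret DM_field \<Omega> \<alpha> m \<tau> s a by (rule field)
  define \<mu>n where "\<mu>n n = dens \<Omega> \<alpha> (\<lambda>x. g n x *\<^sub>R m x)" for n
  have "\<mu>n n \<in> K0_Gamma \<Omega> \<Gamma> (\<alpha>n n)" for n
  proof -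
    have "has_div_measure \<Omega> (\<mu>n n) (dens \<Omega> \<tau> (div_dens (g n)))"
      unfolding \<mu>n_def by (rule div_dens(4)[OF g g_bound grad_int])
    moreover have "\<mu>n n \<in> bmeas \<Omega>"
      unfolding \<mu>n_def by (rule dens_bmeas[OF s\<alpha> scaled_integrable[OF m_int m_le]])
    ultimately have "\<mu>n n \<in> DM \<Omega>" by (auto simp: DM_def)
    moreover have "normal_trace_DM \<Omega> \<phi> (\<mu>n n) = 0" if "\<Gamma> \<noteq> {}" and \<phi>: "\<phi> \<in> trace_tests \<Omega> \<Gamma>" for \<phi>
    proof -
      have gC: "g n \<in> Cb1_closure \<Omega>" using that(1) \<Gamma> by blast
      have "\<phi> \<in> Cb1_closure \<Omega>" using \<phi> by (simp add: trace_tests_def)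
      then have "normal_trace_DM \<Omega> \<phi> (\<mu>n n) = normal_trace_DM \<Omega> (\<lambda>x. g n x * \<phi> x) \<mu>"
        unfolding \<mu>n_def \<mu>_eq by (rule normal_trace_mult[OF gC grad_int _ div[unfolded \<mu>_eq]])
      also have "\<dots> = 0"
        using \<mu> that(1) trace_tests_mult[OF \<phi> gC] by (auto simp: K0_Gamma_def DM_Gamma_def)
      finally show ?thesis .
    qed
    moreover have "variation_le \<Omega> (\<mu>n n) (\<alpha>n n)"
      unfolding \<mu>n_def by (rule scaled_variation_le[OF m_int m_le])
    ultimately show ?thesis by (simp add: K0_Gamma_def DM_Gamma_def)
  qed
  moreover have "(\<lambda>n. DM_norm \<Omega> (\<lambda>A. \<mu>n n A - \<mu> A)) \<longlonglongrightarrow> 0"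
  proof (rule tendsto_sandwich[OF _ _ tendsto_const])
    let ?u = "\<lambda>n. ennreal (\<beta> n * measure \<alpha> \<Omega>) +
      ennreal (\<beta> n * (\<integral>x. \<bar>s x\<bar> \<partial>\<tau>) + (\<integral>x. norm (grad (g n) x) \<partial>\<alpha>))"
    show "\<forall>\<^sub>F n in sequentially. DM_norm \<Omega> (\<lambda>A. \<mu>n n A - \<mu> A) \<le> ?u n"
    proof (intro always_eventually allI)
      fix n
      \<comment> \<open>The difference is again a scaled field, so its divergence is read off from
        the product rule, with no appeal to linearity of \<open>div_measure\<close>.\<close>
      have eq: "(\<lambda>A. \<mu>n n A - \<mu> A) = dens \<Omega> \<alpha> (\<lambda>x. (g n x - 1) *\<^sub>R m x)"
        unfolding \<mu>n_def \<mu>_eq by (rule ext) (rule scaled_diff[OF m_int m_le])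
      have C: "(\<lambda>x. g n x - 1) \<in> Ck 1 \<Omega>" by (rule Ck1_diff_const[OF g])
      have gi: "integrable \<alpha> (grad (\<lambda>x. g n x - 1))" unfolding grad_diff_const by (rule grad_int)
      have "div_measure \<Omega> (dens \<Omega> \<alpha> (\<lambda>x. (g n x - 1) *\<^sub>R m x)) = dens \<Omega> \<tau> (div_dens (\<lambda>x. g n x - 1))"
        by (rule div_measure_eqI[OF op div_dens(4)[OF C \<beta>_bound gi]])
      moreover have "M_norm \<Omega> (dens \<Omega> \<tau> (div_dens (\<lambda>x. g n x - 1)))
          \<le> ennreal (\<beta> n * (\<integral>x. \<bar>s x\<bar> \<partial>\<tau>) + (\<integral>x. norm (grad (\<lambda>x. g n x - 1) x) \<partial>\<alpha>))"
        by (rule div_dens(3)[OF C \<beta>_bound gi])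
      moreover have "M_norm \<Omega> (dens \<Omega> \<alpha> (\<lambda>x. (g n x - 1) *\<^sub>R m x)) \<le> ennreal (\<beta> n * measure \<alpha> \<Omega>)"
        by (rule M_norm_scaled_density_le[OF s\<alpha> fin\<alpha> m_int m_le Ck1D(3)[OF C] \<beta>_bound])
      ultimately show "DM_norm \<Omega> (\<lambda>A. \<mu>n n A - \<mu> A) \<le> ?u n"
        unfolding DM_norm_def eq grad_diff_const by (simp add: add_mono)
    qed
    have "?u \<longlonglongrightarrow> ennreal (0 * measure \<alpha> \<Omega>) + ennreal (0 * (\<integral>x. \<bar>s x\<bar> \<partial>\<tau>) + 0)"
      by (intro tendsto_intros \<beta>_tendsto grad0)
    then show "?u \<longlonglongrightarrow> 0" by simp
  qed simp
  ultimately show ?thesis by blast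
qed

lemma Mp_part:
  assumes \<Gamma>: "\<Gamma> = {} \<or> (\<forall>n. g n \<in> Cb1_closure \<Omega>)"
    and p: "1 \<le> p" and dec\<alpha>: "lebesgue_decomposition \<Omega> \<alpha> (leb \<Omega>) F \<alpha>s"
    and supp: "\<And>n x. x \<in> msupp \<Omega> \<alpha>s \<Longrightarrow> grad (g n) x = 0"
    and \<mu>: "\<mu> \<in> Kp_Gamma p \<Omega> \<Gamma> \<alpha>"
    and grad0: "(\<lambda>n. Lp_norm (leb \<Omega>) p (\<lambda>x. norm (grad (g n) x) * F x)) \<longlonglongrightarrow> 0"
  shows "\<exists>\<mu>n. (\<forall>n. \<mu>n n \<in> Kp_Gamma p \<Omega> \<Gamma> (\<alpha>n n)) \<and> (\<lambda>n. Mp_norm p \<Omega> (\<lambda>A. \<mu>n n A - \<mu> A)) \<longlonglongrightarrow> 0"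
proof -
  have \<mu>Mp: "\<mu> \<in> Mp p \<Omega>" and le: "variation_le \<Omega> \<mu> \<alpha>"
    using \<mu> by (auto simp: Kp_Gamma_def Mp_Gamma_def split: if_splits)
  obtain m where field: "Mp_field \<Omega> \<alpha> m (div_Lp p \<Omega> \<mu>) p F \<alpha>s" and \<mu>_eq: "\<mu> = dens \<Omega> \<alpha> m"
    by (rule Mp_representation[OF op p \<alpha> \<mu>Mp le dec\<alpha>]) (assumption | rule that)+
  define h where "h = div_Lp p \<Omega> \<mu>"
  interpret Mp_field \<Omega> \<alpha> m h p F \<alpha>s unfolding h_def by (rule field)
  define q where "q n = Lp_norm (leb \<Omega>) p (\<lambda>x. norm (grad (g n) x) * F x)" for n
  \<comment> \<open>The hypothesis allows the norm \<open>q n\<close> to be infinite for finitely many \<open>n\<close>; there the zero measure is used.\<close>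
  define G where "G n = (if q n < \<infinity> then g n else (\<lambda>x. 0))" for n
  have zero_norm: "Lp_norm (leb \<Omega>) p (\<lambda>x. 0) < \<infinity>" by (simp add: Lp_norm_zero)
  have adm: "admissible (G n)" for n
    using g grad_int supp zero_norm
    by (auto simp: G_def admissible_def q_def grad_const_zero Ck_UNIV_subset[OF Ck_const])
  then have GC: "G n \<in> Ck 1 \<Omega>" for n by (simp add: admissible_def)
  have G_bound: "\<bar>G n x\<bar> \<le> 1 + \<beta> n" if "x \<in> \<Omega>" for n x
    using g_bound[OF that, of n] \<beta>_nonneg[of n] by (simp add: G_def)
  define \<mu>n where "\<mu>n n = dens \<Omega> \<alpha> (\<lambda>x. G n x *\<^sub>R m x)" for n
  have "\<mu>n n \<in> Kp_Gamma p \<Omega> \<Gamma> (\<alpha>n n)" for n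
  proof -
    have i: "integrable \<alpha> (\<lambda>x. G n x *\<^sub>R m x)"
      by (rule integrable_scaled_density[OF s\<alpha> fin\<alpha> m_int m_le Ck1D(3)[OF GC] G_bound])
    have "has_div_Lp p \<Omega> (\<mu>n n) (div_dens (G n))"
      unfolding \<mu>n_def by (rule div_dens(1)[OF adm G_bound]) (use \<beta>_nonneg[of n] in auto)
    moreover have "\<mu>n n \<in> bmeas \<Omega>"
      unfolding \<mu>n_def by (rule dens_bmeas[OF s\<alpha> i])
    ultimately have "\<mu>n n \<in> Mp p \<Omega>" by (auto simp: Mp_def)
    moreover have "integrable (leb \<Omega>) (\<lambda>x. \<phi> x * div_Lp p \<Omega> (\<mu>n n) x) \<and> normal_trace_Mp p \<Omega> \<phi> (\<mu>n n) = 0"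
      if "\<Gamma> \<noteq> {}" and \<phi>: "\<phi> \<in> trace_tests \<Omega> \<Gamma>" for \<phi>
    proof -
      \<comment> \<open>The zero function used where \<open>q n\<close> is infinite also extends
        continuously to the closure, so the trace argument is uniform in \<open>n\<close>.\<close>
      have gC: "G n \<in> Cb1_closure \<Omega>" using that(1) \<Gamma> zero_Cb1_closure by (auto simp: G_def)
      have \<phi>C: "\<phi> \<in> Cb1_closure \<Omega>" using \<phi> by (simp add: trace_tests_def)
      have 0: "integrable (leb \<Omega>) (\<lambda>x. (G n x * \<phi> x) * h x)"
          "normal_trace_Mp p \<Omega> (\<lambda>x. G n x * \<phi> x) \<mu> = 0"
        using \<mu> that(1) trace_tests_mult[OF \<phi> gC] by (auto simp: Kp_Gamma_def Mp_Gamma_def h_def)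
      have div: "div_Lp p \<Omega> (dens \<Omega> \<alpha> m) = h" by (simp add: h_def \<mu>_eq)
      show ?thesis
        using normal_trace_mult[OF adm gC \<phi>C div 0(1)] 0(2) by (simp add: \<mu>n_def \<mu>_eq)
    qed
    moreover have "variation_le \<Omega> (\<mu>n n) (\<alpha>n n)"
    \<comment> \<open>For infinite \<open>q n\<close> the field is zero, and its variation lies
      below any non-negative measure.\<close>
    proof (cases "q n < \<infinity>")
      case True
      then show ?thesis
        unfolding \<mu>n_def G_def using scaled_variation_le[OF m_int m_le, of n] by simp
    next
      case False
      then have "\<mu>n n A = 0" for A by (simp add: \<mu>n_def G_def dens_def set_lebesgue_integral_def)
      then show ?thesis
        unfolding variation_le_def using \<alpha>n[of n] by (auto simp: pos_bmeas_def intro!: total_variation_le)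
    qed
    ultimately show ?thesis by (simp add: Kp_Gamma_def Mp_Gamma_def)
  qed
  moreover have "(\<lambda>n. Mp_norm p \<Omega> (\<lambda>A. \<mu>n n A - \<mu> A)) \<longlonglongrightarrow> 0"
  proof (rule tendsto_sandwich[OF _ _ tendsto_const])
    let ?H = "Lp_norm (leb \<Omega>) p h"
    let ?u = "\<lambda>n. ennreal (\<beta> n * measure \<alpha> \<Omega>) + 4 * (ennreal (\<beta> n) * ?H + q n)"
    have H: "?H < \<infinity>" using h_Lp by (simp add: Lp_def)
    \<comment> \<open>Norms tending to 0 are eventually finite, so the replacement by zero leaves
      the tail of the sequence, and with it the limit, untouched.\<close>
    have "eventually (\<lambda>n. q n < \<infinity>) sequentially"
      using order_tendstoD(2)[OF grad0, of \<infinity>] by (simp add: q_def)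
    then show "\<forall>\<^sub>F n in sequentially. Mp_norm p \<Omega> (\<lambda>A. \<mu>n n A - \<mu> A) \<le> ?u n"
    proof eventually_elim
      case (elim n)
      have eq: "(\<lambda>A. \<mu>n n A - \<mu> A) = dens \<Omega> \<alpha> (\<lambda>x. (g n x - 1) *\<^sub>R m x)"
        unfolding \<mu>n_def \<mu>_eq G_def if_P[OF elim] by (rule ext) (rule scaled_diff[OF m_int m_le])
      have C: "(\<lambda>x. g n x - 1) \<in> Ck 1 \<Omega>" by (rule Ck1_diff_const[OF g])
      have adm': "admissible (\<lambda>x. g n x - 1)"
        using elim C grad_int supp by (simp add: admissible_def grad_diff_const q_def)
      have "Lp_norm (leb \<Omega>) p (div_Lp p \<Omega> (dens \<Omega> \<alpha> (\<lambda>x. (g n x - 1) *\<^sub>R m x)))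
          \<le> 4 * (ennreal (\<beta> n) * ?H + Lp_norm (leb \<Omega>) p (\<lambda>x. norm (grad (\<lambda>x. g n x - 1) x) * F x))"
        by (rule div_dens(2)[OF adm' \<beta>_bound \<beta>_nonneg])
      moreover have "M_norm \<Omega> (dens \<Omega> \<alpha> (\<lambda>x. (g n x - 1) *\<^sub>R m x)) \<le> ennreal (\<beta> n * measure \<alpha> \<Omega>)"
        by (rule M_norm_scaled_density_le[OF s\<alpha> fin\<alpha> m_int m_le Ck1D(3)[OF C] \<beta>_bound])
      ultimately show ?case
        unfolding Mp_norm_def eq grad_diff_const q_def by (rule add_mono[rotated])
    qed
    \<comment> \<open>Multiplication of extended reals is discontinuous at zero times infinity;
      finiteness of \<open>?H\<close> makes the limit of the product legitimate.\<close>
    have "?u \<longlonglongrightarrow> ennreal (0 * measure \<alpha> \<Omega>) + 4 * (ennreal 0 * ?H + 0)"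
      using H grad0 unfolding q_def[symmetric]
      by (intro tendsto_add tendsto_ennrealI tendsto_mult_ennreal tendsto_mult tendsto_const \<beta>_tendsto)
        (auto simp: less_top)
    then show "?u \<longlonglongrightarrow> 0" by simp
  qed simp
  ultimately show ?thesis by blast
qed

end

theorem theorem4p13:
  fixes \<Omega> :: "'a::euclidean_space set"
    and \<alpha> :: "'a measure" and \<alpha>n \<alpha>ns :: "nat \<Rightarrow> 'a measure"
    and g :: "nat \<Rightarrow> 'a \<Rightarrow> real"
  assumes "open \<Omega>"
    and "\<And>n. \<alpha>n n \<in> pos_bmeas \<Omega>" and "\<alpha> \<in> pos_bmeas \<Omega>"
    and "\<And>n. lebesgue_decomposition \<Omega> (\<alpha>n n) \<alpha> (g n) (\<alpha>ns n)"
    and "(\<lambda>n. M_norm \<Omega> (measure (\<alpha>ns n))) \<longlonglongrightarrow> 0"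
    and "\<And>n. g n \<in> Ck 1 \<Omega>"
    and "\<And>n. bounded (g n ` \<Omega>)"
    and "\<And>n. integrable \<alpha> (grad (g n))"
    and "(\<lambda>n. SUP x\<in>\<Omega>. ennreal \<bar>g n x - 1\<bar>) \<longlonglongrightarrow> 0"
  shows
    "((\<lambda>n. \<integral>x. norm (grad (g n) x) \<partial>\<alpha>) \<longlonglongrightarrow> 0 \<longrightarrow>
        (\<forall>\<mu>\<in>K0 \<Omega> \<alpha>. \<exists>\<mu>n. (\<forall>n. \<mu>n n \<in> K0 \<Omega> (\<alpha>n n)) \<and>
           (\<lambda>n. DM_norm \<Omega> (\<lambda>A. \<mu>n n A - \<mu> A)) \<longlonglongrightarrow> 0))
     \<and>
     (\<forall>p F \<alpha>s. 1 \<le> p \<and> lebesgue_decomposition \<Omega> \<alpha> (leb \<Omega>) F \<alpha>s \<and>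
        (\<forall>n. \<forall>x\<in>msupp \<Omega> \<alpha>s. grad (g n) x = 0) \<longrightarrow>
        (\<forall>\<mu>\<in>Kp p \<Omega> \<alpha>.
           (\<lambda>n. Lp_norm (leb \<Omega>) p (\<lambda>x. norm (grad (g n) x) * F x)) \<longlonglongrightarrow> 0 \<longrightarrow>
           (\<exists>\<mu>n. (\<forall>n. \<mu>n n \<in> Kp p \<Omega> (\<alpha>n n)) \<and>
              (\<lambda>n. Mp_norm p \<Omega> (\<lambda>A. \<mu>n n A - \<mu> A)) \<longlonglongrightarrow> 0)))
     \<and>
     (\<forall>\<Gamma>. frontier \<Omega> \<noteq> {} \<and> \<Gamma> \<subseteq> frontier \<Omega> \<and> (\<forall>n. g n \<in> Cb1_closure \<Omega>) \<longrightarrow>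
        ((\<lambda>n. \<integral>x. norm (grad (g n) x) \<partial>\<alpha>) \<longlonglongrightarrow> 0 \<longrightarrow>
           (\<forall>\<mu>\<in>K0_Gamma \<Omega> \<Gamma> \<alpha>. \<exists>\<mu>n. (\<forall>n. \<mu>n n \<in> K0_Gamma \<Omega> \<Gamma> (\<alpha>n n)) \<and>
              (\<lambda>n. DM_norm \<Omega> (\<lambda>A. \<mu>n n A - \<mu> A)) \<longlonglongrightarrow> 0))
        \<and>
        (\<forall>p F \<alpha>s. 1 \<le> p \<and> lebesgue_decomposition \<Omega> \<alpha> (leb \<Omega>) F \<alpha>s \<and>
           (\<forall>n. \<forall>x\<in>msupp \<Omega> \<alpha>s. grad (g n) x = 0) \<longrightarrow>
           (\<forall>\<mu>\<in>Kp_Gamma p \<Omega> \<Gamma> \<alpha>.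
              (\<lambda>n. Lp_norm (leb \<Omega>) p (\<lambda>x. norm (grad (g n) x) * F x)) \<longlonglongrightarrow> 0 \<longrightarrow>
              (\<exists>\<mu>n. (\<forall>n. \<mu>n n \<in> Kp_Gamma p \<Omega> \<Gamma> (\<alpha>n n)) \<and>
                 (\<lambda>n. Mp_norm p \<Omega> (\<lambda>A. \<mu>n n A - \<mu> A)) \<longlonglongrightarrow> 0))))"
proof -
  interpret approximating_measures \<Omega> \<alpha> \<alpha>n \<alpha>ns g
    by (rule approximating_measures.intro) fact+
  show ?thesis
    unfolding K0_eq Kp_eq
    by (intro conjI allI impI ballI) (auto intro: DM_part Mp_part)
qed

end
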